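(* Let $p\in[1,\infty]$, let $\alpha\in[0,1]$ be irrational with rational approximants $\alpha_m$, $\theta\in[0,1)$, $\lambda\in\mathbb{R}$, and let $H_{\lambda,\alpha,\theta}$ be the aperiodic Schrödinger operator on $\ell^p(\mathbb{Z})$. For $k\in\mathbb{Z}$ set $\theta_k:=k\alpha\bmod 1$. Then the following are equivalent: (i) The finite section method for $H_{\lambda,\alpha,\theta}$ is applicable. (ii) The operators $(H_{\lambda,\alpha,\psi})_+$ and $(\widetilde H_{\lambda,\alpha,\psi})_+$ are invertible for every $\psi\in[0,1)$. (iii) The operators $(H_{\lambda,\alpha,\theta_k})_+$ are invertible for all $k\in\mathbb{Z}$ and their inverses are uniformly bounded. (iv) The operators $(\widetilde H_{\lambda,\alpha,\theta_k})_+$ are invertible for all $k\in\mathbb{Z}$ and their inverses are uniformly bounded. (v) For all $k\in\mathbb{Z}$, the sequence $((H_{\lambda,\alpha_m,\theta_k})_+)_{m\in\mathbb{N}}$ is stable and \[\limsup_{m\to\infty}\Big(\max_{k\in\mathbb{Z}}\big\|(H_{\lambda,\alpha_m,\theta_k})_+^{-1}\big\|\Big)<\infty,\] where $\|A^{-1}\|:=\infty$ if $A$ is not invertible.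
   Context: For $\beta\in[0,1]$, $\psi\in[0,1)$: $v_{\beta,\psi}(n)=\chi_{[1-\beta,1)}(n\beta+\psi\bmod 1)$ and $\widetilde v_{\beta,\psi}(n)=\chi_{(1-\beta,1]\cup\{0\}}(n\beta+\psi\bmod 1)$, $n\in\mathbb{Z}$; $(H_{\lambda,\beta,\psi}x)_n=x_{n+1}+x_{n-1}+\lambda v_{\beta,\psi}(n)x_n$ and $(\widetilde H_{\lambda,\beta,\psi}x)_n=x_{n+1}+x_{n-1}+\lambda\widetilde v_{\beta,\psi}(n)x_n$ on $\ell^p(\mathbb{Z})$. Rational approximants: with $\alpha=[a_1,a_2,\dots]$ the continued fraction expansion, $p_{-1}=1,p_0=0,p_n=a_np_{n-1}+p_{n-2}$, $q_{-1}=0,q_0=1,q_n=a_nq_{n-1}+q_{n-2}$, $\alpha_m=p_m/q_m$. For an operator $A$ on $\ell^p(\mathbb{Z})$ with matrix $(a_{ij})$, $A_+:=(a_{ij})_{i,j=0}^\infty$ acting on $\ell^p(\mathbb{Z}_+)$, $\mathbb{Z}_+=\{0,1,2,\dots\}$. A sequence $(A_n)$ is stable if there is $n_0$ such that $A_n$ is invertible for $n\geq n_0$ and $\sup_{n\ge n_0}\|A_n^{-1}\|<\infty$. FSM: with $A_n=(a_{ij})_{i,j=-n}^n$, the FSM for $A$ is applicable if $A$ is invertible, $A_n$ invertible for large $n$, and the inverses (embedded) converge strongly to $A^{-1}$.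
   Formalization: For p=∞, where strong convergence of the embedded inverses can never hold, applicability of the finite section method instead means that ||P_k(A_n^{-1}P_n − A^{-1})|| and ||(A_n^{-1}P_n − A^{-1})P_k|| tend to 0 for every k; for p<∞ it is strong convergence as stated. *)

theory Defs
  imports "HOL-Analysis.Analysis"
begin

text \<open>Elements of \<open>\<ell>^p(I)\<close> are complex sequences indexed by \<int> that vanish outside I.
  Thus \<open>\<ell>^p(\<int>)\<close> is \<open>lp p UNIV\<close>, \<open>\<ell>^p(\<int>_+)\<close> is \<open>lp p {0..}\<close> and the space of the
  n-th finite section is \<open>lp p {-n..n}\<close>. The exponent p is an extended real (p = \<infinity> allowed).\<close>

definition lp :: "ereal \<Rightarrow> int set \<Rightarrow> (int \<Rightarrow> complex) set" where
  "lp p I = {x. (\<forall>n. n \<notin> I \<longrightarrow> x n = 0) \<and>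
     (if p = \<infinity> then bounded (range x)
      else (\<lambda>n. norm (x n) powr real_of_ereal p) summable_on UNIV)}"

definition lpnorm :: "ereal \<Rightarrow> (int \<Rightarrow> complex) \<Rightarrow> real" where
  "lpnorm p x = (if p = \<infinity> then (SUP n. norm (x n))
     else (infsum (\<lambda>n. norm (x n) powr real_of_ereal p) UNIV) powr (1 / real_of_ereal p))"

definition opnorm :: "ereal \<Rightarrow> int set \<Rightarrow> ((int \<Rightarrow> complex) \<Rightarrow> (int \<Rightarrow> complex)) \<Rightarrow> ereal" where
  "opnorm p I B = (SUP x \<in> {x \<in> lp p I. lpnorm p x \<le> 1}. ereal (lpnorm p (B x)))"

definition is_inverse_on :: "ereal \<Rightarrow> int set \<Rightarrow> ((int \<Rightarrow> complex) \<Rightarrow> (int \<Rightarrow> complex))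
    \<Rightarrow> ((int \<Rightarrow> complex) \<Rightarrow> (int \<Rightarrow> complex)) \<Rightarrow> bool" where
  "is_inverse_on p I A B \<longleftrightarrow>
     (\<forall>x \<in> lp p I. B x \<in> lp p I \<and> A (B x) = x \<and> B (A x) = x) \<and>
     (\<exists>C. \<forall>x \<in> lp p I. lpnorm p (B x) \<le> C * lpnorm p x)"

definition invertible_on :: "ereal \<Rightarrow> int set \<Rightarrow> ((int \<Rightarrow> complex) \<Rightarrow> (int \<Rightarrow> complex)) \<Rightarrow> bool" where
  "invertible_on p I A \<longleftrightarrow> (\<exists>B. is_inverse_on p I A B)"

definition inverse_on :: "ereal \<Rightarrow> int set \<Rightarrow> ((int \<Rightarrow> complex) \<Rightarrow> (int \<Rightarrow> complex))
    \<Rightarrow> ((int \<Rightarrow> complex) \<Rightarrow> (int \<Rightarrow> complex))" where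
  "inverse_on p I A = (SOME B. is_inverse_on p I A B)"

definition inv_norm :: "ereal \<Rightarrow> int set \<Rightarrow> ((int \<Rightarrow> complex) \<Rightarrow> (int \<Rightarrow> complex)) \<Rightarrow> ereal" where
  "inv_norm p I A = (if invertible_on p I A then opnorm p I (inverse_on p I A) else \<infinity>)"

definition cut :: "int set \<Rightarrow> (int \<Rightarrow> complex) \<Rightarrow> (int \<Rightarrow> complex)" where
  "cut I x = (\<lambda>n. if n \<in> I then x n else 0)"

definition compress :: "int set \<Rightarrow> ((int \<Rightarrow> complex) \<Rightarrow> (int \<Rightarrow> complex))
    \<Rightarrow> ((int \<Rightarrow> complex) \<Rightarrow> (int \<Rightarrow> complex))" where
  "compress I A = (\<lambda>x. cut I (A (cut I x)))"

definition plus_part :: "((int \<Rightarrow> complex) \<Rightarrow> (int \<Rightarrow> complex)) \<Rightarrow> ((int \<Rightarrow> complex) \<Rightarrow> (int \<Rightarrow> complex))" where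
  "plus_part A = compress {0..} A"

definition box :: "nat \<Rightarrow> int set" where
  "box n = {- int n .. int n}"

definition stable_seq :: "ereal \<Rightarrow> int set \<Rightarrow> (nat \<Rightarrow> ((int \<Rightarrow> complex) \<Rightarrow> (int \<Rightarrow> complex))) \<Rightarrow> bool" where
  "stable_seq p I A \<longleftrightarrow> (\<exists>n0. (\<forall>n \<ge> n0. invertible_on p I (A n)) \<and>
      (\<exists>C::real. \<forall>n \<ge> n0. inv_norm p I (A n) \<le> ereal C))"

definition fsm_applicable :: "ereal \<Rightarrow> ((int \<Rightarrow> complex) \<Rightarrow> (int \<Rightarrow> complex)) \<Rightarrow> bool" where
  "fsm_applicable p A \<longleftrightarrow>
     invertible_on p UNIV A \<and>
     (\<exists>n0. \<forall>n \<ge> n0. invertible_on p (box n) (compress (box n) A)) \<and>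
     (let Ai = inverse_on p UNIV A;
          Bn = (\<lambda>n. inverse_on p (box n) (compress (box n) A) \<circ> cut (box n))
      in if p = \<infinity> then
           (\<forall>k. (\<lambda>n. opnorm p UNIV (\<lambda>y. cut (box k) (Bn n y - Ai y))) \<longlonglongrightarrow> 0 \<and>
                (\<lambda>n. opnorm p UNIV (\<lambda>y. Bn n (cut (box k) y) - Ai (cut (box k) y))) \<longlonglongrightarrow> 0)
         else
           (\<forall>y \<in> lp p UNIV. (\<lambda>n. lpnorm p (Bn n y - Ai y)) \<longlonglongrightarrow> 0))"

definition vpot :: "real \<Rightarrow> real \<Rightarrow> int \<Rightarrow> real" where
  "vpot \<beta> \<psi> n = indicator {1 - \<beta> ..< 1} (frac (of_int n * \<beta> + \<psi>))"

definition vpot_tilde :: "real \<Rightarrow> real \<Rightarrow> int \<Rightarrow> real" where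
  "vpot_tilde \<beta> \<psi> n = indicator ({1 - \<beta> <.. 1} \<union> {0}) (frac (of_int n * \<beta> + \<psi>))"

definition schr_op :: "(int \<Rightarrow> real) \<Rightarrow> real \<Rightarrow> (int \<Rightarrow> complex) \<Rightarrow> (int \<Rightarrow> complex)" where
  "schr_op v lam x = (\<lambda>n. x (n + 1) + x (n - 1) + complex_of_real (lam * v n) * x n)"

definition H :: "real \<Rightarrow> real \<Rightarrow> real \<Rightarrow> (int \<Rightarrow> complex) \<Rightarrow> (int \<Rightarrow> complex)" where
  "H lam \<beta> \<psi> = schr_op (vpot \<beta> \<psi>) lam"

definition H_tilde :: "real \<Rightarrow> real \<Rightarrow> real \<Rightarrow> (int \<Rightarrow> complex) \<Rightarrow> (int \<Rightarrow> complex)" where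
  "H_tilde lam \<beta> \<psi> = schr_op (vpot_tilde \<beta> \<psi>) lam"

text \<open>For \<open>\<alpha> \<in> (0,1)\<close> irrational, \<open>\<alpha> = [a_1, a_2, \<dots>] = 1/(a_1 + 1/(a_2 + \<dots>))\<close>.
  \<open>cf_rem \<alpha> n\<close> is the n-th iterate of the Gauss map.\<close>
fun cf_rem :: "real \<Rightarrow> nat \<Rightarrow> real" where
  "cf_rem x 0 = x"
| "cf_rem x (Suc n) = frac (1 / cf_rem x n)"

text \<open>\<open>cf_a \<alpha> (Suc n) = a_{n+1}\<close>\<close>
definition cf_a :: "real \<Rightarrow> nat \<Rightarrow> int" where
  "cf_a x n = \<lfloor>1 / cf_rem x (n - 1)\<rfloor>"

fun cf_p :: "real \<Rightarrow> nat \<Rightarrow> int" where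
  "cf_p x 0 = 0"
| "cf_p x (Suc 0) = 1"
| "cf_p x (Suc (Suc n)) = cf_a x (Suc (Suc n)) * cf_p x (Suc n) + cf_p x n"

fun cf_q :: "real \<Rightarrow> nat \<Rightarrow> int" where
  "cf_q x 0 = 1"
| "cf_q x (Suc 0) = cf_a x 1"
| "cf_q x (Suc (Suc n)) = cf_a x (Suc (Suc n)) * cf_q x (Suc n) + cf_q x n"

definition approximant :: "real \<Rightarrow> nat \<Rightarrow> real" where
  "approximant x m = real_of_int (cf_p x m) / real_of_int (cf_q x m)"

end

theory Submission
  imports Defs
begin

text \<open>
  All five conditions are equivalent to a uniform lower bound
  \<open>c \<parallel>x\<parallel> \<le> \<parallel>A\<^sub>+ x\<parallel>\<close> in the supremum norm, for finitely supported \<open>x\<close> and all sequences \<open>v\<close>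
  coded by the rotation by \<open>\<alpha>\<close>; this bound depends only on the finite words of these sequences.

  Exponential weights carry lower bounds on \<open>\<ell>\<^sup>p\<close> over to the supremum norm, and slowly varying
  tent functions localise them. Since the set of words is invariant under reflection, the bounds for
  the right and the left half line combine to bounds for long finite intervals. There the matrices
  are square, their inverses exist and decay exponentially off the diagonal, and they converge to the
  inverses on the half line and on the line, on every \<open>\<ell>\<^sup>p\<close>.

  The words of a given length of the rotation by \<open>\<beta>\<close> agree with those of the rotation by \<open>\<alpha>\<close> when
  \<open>\<beta>\<close> is close to \<open>\<alpha>\<close>, which handles the rational approximants; compactness of the circle of phases
  turns pointwise into uniform invertibility.

  For \<open>p = \<infinity>\<close> applicability of the finite section method does not contain the uniform boundedness of
  the inverses. If the uniform lower bound fails, then some half line operator has an exponentially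
  decaying Dirichlet solution. A prefix of its potential of length about \<open>q' = q\<^bsub>k+1\<^esub>\<close> occurs in the
  given potential at some \<open>-n\<close> with \<open>n\<close> at most about \<open>q\<^bsub>k\<^esub> + q'\<close>, and every word of length less than
  \<open>q'\<close> is a cyclic factor of this prefix. Hence the growth over the remaining sites up to \<open>0\<close> cannot
  compensate for the decay, and the entry of the inverse of the \<open>n\<close>-th section at \<open>(0, -n)\<close> or
  \<open>(1, -n)\<close> is unbounded.
\<close>

section \<open>Sequence spaces\<close>

text \<open>The supremum norm is chosen because a finitely supported sequence attains its maximum.
  With a tent or a weight centred at a maximiser \<open>k\<close>, every commutator error is a small
  multiple of \<open>norm (x k)\<close> and is absorbed, which costs half of the constant; this
  explains the recurring \<open>c / 2\<close> and the radius 4/c. Coded sequences are described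
  without a phase (\<open>sturm\<close>), so that both potentials, their shifts and their
  reflections are treated alike. The two potentials are the two one-sided limits in the phase, which
  is why both operators occur. In the resonance argument the decaying solution and the column of the
  inverse have Wronskian -1, so decay along the prefix forces the column to grow. On the remaining
  sites the potential consists, up to one letter, of at most two factors of the same prefix, and
  reduction of order lets the column lose there no more than the same solution decays along them.
  The balance is decided by the surplus q_{k+1} - q_k \<ge> q_{k-1}, which is unbounded in
  k.\<close>

lemma finite_int_bounded:
  assumes "finite (F::int set)"
  obtains N where "\<And>d. d \<in> F \<Longrightarrow> nat \<bar>d\<bar> \<le> N"
proof -
  have "\<exists>N. \<forall>n\<in>(\<lambda>d. nat \<bar>d\<bar>) ` F. n \<le> N"
    using finite_nat_set_iff_bounded_le assms by blast
  then show ?thesis using that by blast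
qed

text \<open>\<open>F\<close> lies in {0..N} and its mirror image; counting 0 twice gives the factor
  2. Uniformity in \<open>F\<close> yields both summability and a bound on the infinite sum.\<close>

lemma exp_abs_sum_bounded:
  fixes \<epsilon> :: real
  assumes "\<epsilon> > 0"
  obtains E where "E > 0" "\<And>F::int set. finite F \<Longrightarrow> (\<Sum>d\<in>F. exp (-\<epsilon> * \<bar>real_of_int d\<bar>)) \<le> E"
proof -
  define r where "r = exp (-\<epsilon>)"
  have r: "0 < r" "r < 1" using assms by (auto simp: r_def)
  have pw: "exp (-\<epsilon> * \<bar>real_of_int d\<bar>) = r ^ nat \<bar>d\<bar>" for d
    by (simp add: r_def exp_of_nat_mult [symmetric] mult.commute)
  have geo: "(\<Sum>n\<le>N. r ^ n) \<le> 1 / (1 - r)" for N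
  proof -
    have "(\<Sum>n\<le>N. r ^ n) \<le> (\<Sum>n. r ^ n)"
      using r by (intro sum_le_suminf summable_geometric) auto
    then show ?thesis using r by (simp add: suminf_geometric)
  qed
  have "(\<Sum>d\<in>F. exp (-\<epsilon> * \<bar>real_of_int d\<bar>)) \<le> 2 / (1 - r)" if "finite F" for F :: "int set"
  proof -
    obtain N where N: "\<And>d. d \<in> F \<Longrightarrow> nat \<bar>d\<bar> \<le> N"
      using finite_int_bounded[OF \<open>finite F\<close>] by metis
    have sub: "F \<subseteq> int ` {..N} \<union> (\<lambda>n. - int n) ` {..N}"
    proof
      fix d assume "d \<in> F"
      then have "nat \<bar>d\<bar> \<in> {..N}" "d = int (nat \<bar>d\<bar>) \<or> d = - int (nat \<bar>d\<bar>)" using N by auto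
      then show "d \<in> int ` {..N} \<union> (\<lambda>n. - int n) ` {..N}" by blast
    qed
    have "(\<Sum>d\<in>F. r ^ nat \<bar>d\<bar>) \<le> (\<Sum>d\<in>int ` {..N} \<union> (\<lambda>n. - int n) ` {..N}. r ^ nat \<bar>d\<bar>)"
      by (rule sum_mono2[OF _ sub]) (use r in auto)
    also have "\<dots> \<le> (\<Sum>d\<in>int ` {..N}. r ^ nat \<bar>d\<bar>) + (\<Sum>d\<in>(\<lambda>n. - int n) ` {..N}. r ^ nat \<bar>d\<bar>)"
      using r by (subst sum.union_inter[symmetric]) (auto intro!: sum_nonneg)
    also have "\<dots> = 2 * (\<Sum>n\<le>N. r ^ n)"
      by (simp add: sum.reindex inj_on_def)
    also have "\<dots> \<le> 2 / (1 - r)" using geo[of N] by simp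
    finally show ?thesis unfolding pw .
  qed
  then show ?thesis using that[of "2 / (1 - r)"] r by simp
qed

lemma exp_abs_summable_on:
  fixes \<epsilon> :: real
  assumes "\<epsilon> > 0"
  shows "(\<lambda>j::int. exp (-\<epsilon> * \<bar>real_of_int (i - j)\<bar>)) summable_on UNIV"
proof -
  obtain E where E: "\<And>F::int set. finite F \<Longrightarrow> (\<Sum>d\<in>F. exp (-\<epsilon> * \<bar>real_of_int d\<bar>)) \<le> E"
    using exp_abs_sum_bounded[OF assms] by metis
  have "(\<Sum>j\<in>F. exp (-\<epsilon> * \<bar>real_of_int (i - j)\<bar>)) \<le> E" if "finite F" for F
  proof -
    have "(\<Sum>j\<in>F. exp (-\<epsilon> * \<bar>real_of_int (i - j)\<bar>)) = (\<Sum>d\<in>(\<lambda>j. i - j) ` F. exp (-\<epsilon> * \<bar>real_of_int d\<bar>))"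
      by (subst sum.reindex) (auto simp: inj_on_def)
    then show ?thesis using E that by simp
  qed
  then show ?thesis
    by (intro nonneg_bdd_above_summable_on) (auto simp: bdd_above_def)
qed

lemma exp_abs_infsum_bounded:
  fixes \<epsilon> :: real
  assumes "\<epsilon> > 0"
  obtains E where "E > 0" "\<And>i::int. infsum (\<lambda>j. exp (-\<epsilon> * \<bar>real_of_int (i - j)\<bar>)) UNIV \<le> E"
proof -
  obtain E where E: "E > 0" "\<And>F::int set. finite F \<Longrightarrow> (\<Sum>d\<in>F. exp (-\<epsilon> * \<bar>real_of_int d\<bar>)) \<le> E"
    using exp_abs_sum_bounded[OF assms] by metis
  have "infsum (\<lambda>j. exp (-\<epsilon> * \<bar>real_of_int (i - j)\<bar>)) UNIV \<le> E" for i
  proof (rule infsum_le_finite_sums[OF exp_abs_summable_on[OF assms]])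
    fix F :: "int set" assume "finite F"
    have "(\<Sum>j\<in>F. exp (-\<epsilon> * \<bar>real_of_int (i - j)\<bar>)) = (\<Sum>d\<in>(\<lambda>j. i - j) ` F. exp (-\<epsilon> * \<bar>real_of_int d\<bar>))"
      by (subst sum.reindex) (auto simp: inj_on_def)
    then show "(\<Sum>j\<in>F. exp (-\<epsilon> * \<bar>real_of_int (i - j)\<bar>)) \<le> E" using E \<open>finite F\<close> by simp
  qed
  then show ?thesis using that E by blast
qed

section \<open>Basic facts on \<ell>^p and its norm\<close>

lemma lp_exponent_cases:
  assumes "1 \<le> (p::ereal)"
  obtains "p = \<infinity>" | r where "p = ereal r" "r \<ge> 1" "p \<noteq> \<infinity>"
  using assms by (cases p) auto

lemma lp_UNIV: "x \<in> lp p I \<Longrightarrow> x \<in> lp p UNIV"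
  by (auto simp: lp_def)

lemma lp_iff: "x \<in> lp p I \<longleftrightarrow> x \<in> lp p UNIV \<and> (\<forall>n. n \<notin> I \<longrightarrow> x n = 0)"
  by (auto simp: lp_def)

lemma lpnorm_nonneg: "0 \<le> lpnorm p x" if "p = \<infinity> \<Longrightarrow> bounded (range x)"
proof (cases "p = \<infinity>")
  case True
  then have "bdd_above (range (\<lambda>n. norm (x n)))"
    using that by (auto simp: bounded_iff bdd_above_def)
  then have "norm (x 0) \<le> (SUP n. norm (x n))" by (rule cSUP_upper[rotated]) simp
  then show ?thesis using True norm_ge_zero[of "x 0"] by (simp add: lpnorm_def del: norm_ge_zero)
qed (simp add: lpnorm_def)

lemma lpnorm_nonneg_lp: "x \<in> lp p I \<Longrightarrow> 0 \<le> lpnorm p x"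
  by (rule lpnorm_nonneg) (auto simp: lp_def)

lemma norm_le_lpnorm:
  assumes "1 \<le> p" "x \<in> lp p I"
  shows "norm (x n) \<le> lpnorm p x"
proof (cases rule: lp_exponent_cases[OF assms(1)])
  case 1
  then have "bdd_above (range (\<lambda>n. norm (x n)))"
    using assms(2) by (auto simp: lp_def bounded_iff bdd_above_def)
  then have "norm (x n) \<le> (SUP n. norm (x n))" by (rule cSUP_upper[rotated]) simp
  then show ?thesis using 1 by (simp add: lpnorm_def)
next
  case (2 r)
  have s: "(\<lambda>n. norm (x n) powr r) summable_on UNIV" using assms 2 by (auto simp: lp_def)
  have "(\<Sum>n\<in>{n}. norm (x n) powr r) \<le> infsum (\<lambda>n. norm (x n) powr r) UNIV"
    by (rule finite_sum_le_infsum[OF s]) auto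
  then have "(norm (x n) powr r) powr (1/r) \<le> (infsum (\<lambda>n. norm (x n) powr r) UNIV) powr (1/r)"
    using 2 by (intro powr_mono2) auto
  then show ?thesis using 2 by (simp add: lpnorm_def powr_powr)
qed

lemma lp_bounded: "1 \<le> p \<Longrightarrow> x \<in> lp p I \<Longrightarrow> \<exists>X. \<forall>n. norm (x n) \<le> X"
  using norm_le_lpnorm by blast

lemma lpI_infinity: "\<lbrakk>\<And>n. norm (x n) \<le> X; \<And>n. n \<notin> I \<Longrightarrow> x n = 0\<rbrakk> \<Longrightarrow> x \<in> lp \<infinity> I \<and> lpnorm \<infinity> x \<le> X"
  by (auto simp: lp_def bounded_iff lpnorm_def intro!: cSUP_least)

lemma lpI_finite:
  assumes "r \<ge> 1" "\<And>F. finite F \<Longrightarrow> (\<Sum>n\<in>F. norm (x n) powr r) \<le> X" "\<And>n. n \<notin> I \<Longrightarrow> x n = 0"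
  shows "x \<in> lp (ereal r) I \<and> lpnorm (ereal r) x \<le> X powr (1/r)"
proof -
  have s: "(\<lambda>n. norm (x n) powr r) summable_on UNIV"
    using assms(2) by (intro nonneg_bdd_above_summable_on) (auto simp: bdd_above_def)
  have "infsum (\<lambda>n. norm (x n) powr r) UNIV \<le> X"
    by (rule infsum_le_finite_sums[OF s]) (use assms in auto)
  then have "(infsum (\<lambda>n. norm (x n) powr r) UNIV) powr (1/r) \<le> X powr (1/r)"
    using assms by (intro powr_mono2) (auto intro!: infsum_nonneg)
  then show ?thesis using s assms by (auto simp: lp_def lpnorm_def)
qed

lemma lp_finite_support:
  assumes "finite {n. x n \<noteq> 0}" "\<And>n. n \<notin> I \<Longrightarrow> x n = 0" "1 \<le> p"
  shows "x \<in> lp p I"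
proof (cases rule: lp_exponent_cases[OF assms(3)])
  case 1
  have "range x \<subseteq> insert 0 (x ` {n. x n \<noteq> 0})" by auto
  then have "finite (range x)" using assms(1) finite_subset by blast
  then show ?thesis using 1 assms by (auto simp: lp_def finite_imp_bounded)
next
  case (2 r)
  have "(\<lambda>n. norm (x n) powr r) summable_on {n. x n \<noteq> 0}" using assms by simp
  then have "(\<lambda>n. norm (x n) powr r) summable_on UNIV"
    by (rule summable_on_cong_neutral[THEN iffD1, rotated -1]) auto
  then show ?thesis using 2 assms by (auto simp: lp_def)
qed

text \<open>A substitute for Young's inequality in which the sum over the kernel is replaced by its
  largest term.\<close>
lemma lp_exp_dominated:
  assumes "1 \<le> p" "\<epsilon> > 0"
  obtains K where "K > 0"
    "\<And>C x y. \<lbrakk>C \<ge> 0; x \<in> lp p UNIV; \<And>n. \<exists>m. norm (y n) \<le> C * exp (-\<epsilon> * \<bar>real_of_int (n - m)\<bar>) * norm (x m)\<rbrakk>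
       \<Longrightarrow> y \<in> lp p UNIV \<and> lpnorm p y \<le> C * K * lpnorm p x"
proof (cases rule: lp_exponent_cases[OF assms(1)])
  case 1
  show ?thesis
  proof (rule that[of 1])
    fix C :: real and x y :: "int \<Rightarrow> complex"
    assume C: "C \<ge> 0" and x: "x \<in> lp p UNIV"
      and y: "\<And>n. \<exists>m. norm (y n) \<le> C * exp (-\<epsilon> * \<bar>real_of_int (n - m)\<bar>) * norm (x m)"
    have "norm (y n) \<le> C * lpnorm p x" for n
    proof -
      obtain m where "norm (y n) \<le> C * exp (-\<epsilon> * \<bar>real_of_int (n - m)\<bar>) * norm (x m)" using y by blast
      also have "\<dots> \<le> (C * 1) * lpnorm p x"
        using C assms norm_le_lpnorm[OF assms(1) x] by (intro mult_mono) auto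
      finally show ?thesis by simp
    qed
    then show "y \<in> lp p UNIV \<and> lpnorm p y \<le> C * 1 * lpnorm p x"
      using lpI_infinity[of y "C * lpnorm p x" UNIV] 1 by simp
  qed simp
next
  case (2 r)
  have "r * \<epsilon> > 0" using 2 assms by simp
  then obtain E where E: "E > 0" "\<And>F::int set. finite F \<Longrightarrow> (\<Sum>d\<in>F. exp (-(r*\<epsilon>) * \<bar>real_of_int d\<bar>)) \<le> E"
    using exp_abs_sum_bounded by metis
  show ?thesis
  proof (rule that[of "E powr (1/r)"])
    show "E powr (1/r) > 0" using E by simp
    fix C :: real and x y :: "int \<Rightarrow> complex"
    assume C: "C \<ge> 0" and x: "x \<in> lp p UNIV"
      and y: "\<And>n. \<exists>m. norm (y n) \<le> C * exp (-\<epsilon> * \<bar>real_of_int (n - m)\<bar>) * norm (x m)"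
    obtain m where m: "\<And>n. norm (y n) \<le> C * exp (-\<epsilon> * \<bar>real_of_int (n - m n)\<bar>) * norm (x (m n))"
      using y by metis
    have s: "(\<lambda>n. norm (x n) powr r) summable_on UNIV" using x 2 by (auto simp: lp_def)
    define S where "S = infsum (\<lambda>n. norm (x n) powr r) UNIV"
    have fin: "(\<Sum>n\<in>F. norm (y n) powr r) \<le> C powr r * (E * S)" if "finite F" for F
    proof -
      let ?D = "(\<lambda>n. n - m n) ` F"
      let ?h = "\<lambda>d n. exp (-(r*\<epsilon>) * \<bar>real_of_int d\<bar>) * norm (x (n - d)) powr r"
      have "(\<Sum>n\<in>F. norm (y n) powr r) \<le> (\<Sum>n\<in>F. C powr r * ?h (n - m n) n)"
      proof (rule sum_mono)
        fix n
        have "norm (y n) powr r \<le> (C * exp (-\<epsilon> * \<bar>real_of_int (n - m n)\<bar>) * norm (x (m n))) powr r"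
          using m 2 by (intro powr_mono2) auto
        also have "\<dots> = C powr r * ?h (n - m n) n"
          using C by (simp add: powr_mult exp_powr_real algebra_simps)
        finally show "norm (y n) powr r \<le> C powr r * ?h (n - m n) n" .
      qed
      \<comment> \<open>The chosen displacement \<open>n - m n\<close> is one element of
        \<open>?D\<close>. Summing over all displacements makes \<open>d\<close> independent of
        \<open>n\<close>, so that the two sums can be exchanged.\<close>
      also have "\<dots> \<le> (\<Sum>n\<in>F. C powr r * (\<Sum>d\<in>?D. ?h d n))"
        by (intro sum_mono mult_left_mono member_le_sum) (use that in auto)
      also have "\<dots> = C powr r * (\<Sum>n\<in>F. \<Sum>d\<in>?D. ?h d n)"
        by (rule sum_distrib_left[symmetric])
      also have "\<dots> = C powr r * (\<Sum>d\<in>?D. \<Sum>n\<in>F. ?h d n)"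
        by (subst sum.swap) (rule refl)
      also have "\<dots> \<le> C powr r * (\<Sum>d\<in>?D. exp (-(r*\<epsilon>) * \<bar>real_of_int d\<bar>) * S)"
      proof (intro mult_left_mono sum_mono)
        fix d
        have "(\<Sum>n\<in>F. norm (x (n - d)) powr r) = (\<Sum>n\<in>(\<lambda>n. n - d) ` F. norm (x n) powr r)"
          by (subst sum.reindex) (auto simp: inj_on_def)
        also have "\<dots> \<le> S" unfolding S_def by (rule finite_sum_le_infsum[OF s]) (use that in auto)
        finally show "(\<Sum>n\<in>F. ?h d n) \<le> exp (-(r*\<epsilon>) * \<bar>real_of_int d\<bar>) * S"
          by (simp add: sum_distrib_left[symmetric])
      qed auto
      also have "\<dots> \<le> C powr r * (E * S)"
        unfolding sum_distrib_right[symmetric]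
        by (intro mult_left_mono mult_right_mono E) (use that in \<open>auto simp: S_def intro!: infsum_nonneg\<close>)
      finally show ?thesis .
    qed
    have "y \<in> lp p UNIV \<and> lpnorm p y \<le> (C powr r * (E * S)) powr (1/r)"
      using lpI_finite[of r y _ UNIV, OF _ fin] 2 by auto
    moreover have "(C powr r * (E * S)) powr (1/r) = C * E powr (1/r) * lpnorm p x"
      using C E 2 by (simp add: powr_mult powr_powr lpnorm_def S_def infsum_nonneg)
    ultimately show "y \<in> lp p UNIV \<and> lpnorm p y \<le> C * E powr (1/r) * lpnorm p x" by simp
  qed
qed

text \<open>Serves in place of Minkowski's inequality: under a pointwise maximum the r-th powers
  simply add up, and 2 powr (1/r) \<le> 2 makes the constant independent of \<open>p\<close>. Sums
  are fed in through multiples of their terms.\<close>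

lemma lp_max_dominated:
  assumes "1 \<le> p" "a \<in> lp p UNIV" "b \<in> lp p UNIV"
    and z: "\<And>n. norm (z n) \<le> norm (a n) \<or> norm (z n) \<le> norm (b n)"
  shows "z \<in> lp p UNIV \<and> lpnorm p z \<le> 2 * (lpnorm p a + lpnorm p b)"
proof (cases rule: lp_exponent_cases[OF assms(1)])
  case 1
  have n: "lpnorm p a \<ge> 0" "lpnorm p b \<ge> 0" using assms lpnorm_nonneg_lp by blast+
  have "norm (z n) \<le> 2 * (lpnorm p a + lpnorm p b)" for n
  proof -
    have "norm (z n) \<le> lpnorm p a \<or> norm (z n) \<le> lpnorm p b"
      using z[of n] norm_le_lpnorm[OF assms(1,2), of n] norm_le_lpnorm[OF assms(1,3), of n]
      by (auto intro: order_trans)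
    then show ?thesis using n by auto
  qed
  then have "z \<in> lp \<infinity> UNIV \<and> lpnorm \<infinity> z \<le> 2 * (lpnorm p a + lpnorm p b)" by (intro lpI_infinity) auto
  then show ?thesis using 1 by simp
next
  case (2 r)
  have n: "lpnorm p a \<ge> 0" "lpnorm p b \<ge> 0" using assms lpnorm_nonneg_lp by blast+
  have s: "(\<lambda>n. norm (a n) powr r) summable_on UNIV" "(\<lambda>n. norm (b n) powr r) summable_on UNIV"
    using assms 2 by (auto simp: lp_def)
  define A where "A = infsum (\<lambda>n. norm (a n) powr r) UNIV"
  define B where "B = infsum (\<lambda>n. norm (b n) powr r) UNIV"
  have AB: "A \<ge> 0" "B \<ge> 0" by (auto simp: A_def B_def intro!: infsum_nonneg)
  have fin: "(\<Sum>n\<in>F. norm (z n) powr r) \<le> A + B" if "finite F" for F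
  proof -
    have "(\<Sum>n\<in>F. norm (z n) powr r) \<le> (\<Sum>n\<in>F. norm (a n) powr r + norm (b n) powr r)"
    proof (rule sum_mono)
      fix n
      have "norm (z n) powr r \<le> norm (a n) powr r \<or> norm (z n) powr r \<le> norm (b n) powr r"
        using z[of n] 2 by (auto intro: powr_mono2)
      then show "norm (z n) powr r \<le> norm (a n) powr r + norm (b n) powr r"
        using powr_ge_zero[of "norm (a n)" r] powr_ge_zero[of "norm (b n)" r] by linarith
    qed
    also have "\<dots> = (\<Sum>n\<in>F. norm (a n) powr r) + (\<Sum>n\<in>F. norm (b n) powr r)" by (rule sum.distrib)
    also have "\<dots> \<le> A + B" unfolding A_def B_def
      by (intro add_mono finite_sum_le_infsum s that) auto
    finally show ?thesis .
  qed
  have le: "z \<in> lp p UNIV \<and> lpnorm p z \<le> (A + B) powr (1/r)"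
    using lpI_finite[of r z _ UNIV, OF _ fin] 2 by auto
  have ab: "lpnorm p a = A powr (1/r)" "lpnorm p b = B powr (1/r)"
    using 2 by (auto simp: lpnorm_def A_def B_def)
  have "(A + B) powr (1/r) \<le> (2 * max A B) powr (1/r)" using AB 2 by (intro powr_mono2) auto
  also have "\<dots> = 2 powr (1/r) * max A B powr (1/r)" using AB by (simp add: powr_mult)
  also have "\<dots> \<le> 2 powr 1 * max A B powr (1/r)" using 2 by (intro mult_right_mono powr_mono) auto
  also have "max A B powr (1/r) \<le> A powr (1/r) + B powr (1/r)" by (auto simp: max_def)
  finally have "(A + B) powr (1/r) \<le> 2 * (lpnorm p a + lpnorm p b)" using ab by simp
  then show ?thesis using le by simp
qed

lemma lpnorm_scale: "lpnorm p (\<lambda>n. c * x n) = norm c * lpnorm p x" and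
  lp_scale: "(\<lambda>n. c * x n) \<in> lp p I" if "1 \<le> p" "x \<in> lp p I"
proof -
  have "lpnorm p (\<lambda>n. c * x n) = norm c * lpnorm p x \<and> (\<lambda>n. c * x n) \<in> lp p I"
  proof (cases rule: lp_exponent_cases[OF that(1)])
    case 1
    have bd: "bdd_above (range (\<lambda>n. norm (x n)))"
      using that 1 by (auto simp: lp_def bounded_iff bdd_above_def)
    have "(SUP n. norm c * norm (x n)) = norm c * (SUP n. norm (x n))"
    proof (cases "c = 0")
      case False
      show ?thesis
        using continuous_at_Sup_mono[of "\<lambda>t. norm c * t" "range (\<lambda>n. norm (x n))"] bd
        by (auto simp: mono_def mult_left_mono image_image continuous_mult_left continuous_ident)
    qed simp
    moreover have "bounded (range (\<lambda>n. c * x n))"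
      using bounded_linear_image[OF _ bounded_linear_mult_right[of c], of "range x"] that 1
      by (auto simp: lp_def image_image)
    ultimately show ?thesis using that 1 by (auto simp: lpnorm_def norm_mult lp_def)
  next
    case (2 r)
    have "(\<lambda>n. norm (c * x n) powr r) = (\<lambda>n. norm c powr r * norm (x n) powr r)"
      by (simp add: norm_mult powr_mult)
    then show ?thesis
      using that 2 by (auto simp: lpnorm_def lp_def infsum_cmult_right powr_mult powr_powr infsum_nonneg
          intro: summable_on_cmult_right)
  qed
  then show "lpnorm p (\<lambda>n. c * x n) = norm c * lpnorm p x" "(\<lambda>n. c * x n) \<in> lp p I" by auto
qed

lemma lpnorm_indicator:
  assumes "1 \<le> p"
  shows "lpnorm p (\<lambda>n. if n = k then c else 0) = norm c"
proof (cases rule: lp_exponent_cases[OF assms])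
  case 1
  have "norm (if n = k then c else 0) \<le> norm c" for n :: int by simp
  moreover have "(SUP n::int. norm (if n = k then c else 0)) = norm c"
    by (rule cSup_eq_maximum) (auto simp: image_iff intro!: exI[of _ k])
  ultimately show ?thesis using 1 by (simp add: lpnorm_def)
next
  case (2 r)
  have "infsum (\<lambda>n. norm (if n = k then c else 0) powr r) UNIV = infsum (\<lambda>n. norm (if n = k then c else 0) powr r) {k}"
    by (rule infsum_cong_neutral) auto
  then show ?thesis using 2 by (simp add: lpnorm_def powr_powr)
qed

text \<open>Density of the finitely supported sequences. It fails for \<open>p = \<infinity>\<close>
  (constant sequences), where \<open>fsm_applicable\<close> uses another mode of
  convergence.\<close>

lemma lp_tail_small:
  assumes "1 \<le> p" "p \<noteq> \<infinity>" "x \<in> lp p UNIV" "e > 0"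
  obtains k where "lpnorm p (\<lambda>n. x n - cut (box k) x n) < e" "(\<lambda>n. x n - cut (box k) x n) \<in> lp p UNIV"
proof -
  obtain r where r: "p = ereal r" "r \<ge> 1" using assms lp_exponent_cases by metis
  have s: "(\<lambda>n. norm (x n) powr r) summable_on UNIV" using assms r by (auto simp: lp_def)
  obtain F where F: "finite F" "\<bar>infsum (\<lambda>n. norm (x n) powr r) UNIV - (\<Sum>n\<in>F. norm (x n) powr r)\<bar> < (e/2) powr r"
    using infsum_finite_approximation[OF s, of "(e/2) powr r / 2"] assms
    by (auto simp: dist_real_def abs_minus_commute) (smt (verit, best) assms(4) powr_gt_zero field_sum_of_halves zero_less_divide_iff)
  obtain k where k: "F \<subseteq> box k"
  proof -
    obtain N where "\<And>d. d \<in> F \<Longrightarrow> nat \<bar>d\<bar> \<le> N"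
      using finite_int_bounded[OF F(1)] by metis
    then have "F \<subseteq> box N" by (fastforce simp: box_def)
    then show ?thesis using that by blast
  qed
  let ?t = "\<lambda>n. x n - cut (box k) x n"
  have fin: "(\<Sum>n\<in>F'. norm (?t n) powr r) \<le> (e/2) powr r" if "finite F'" for F'
  proof -
    have "(\<Sum>n\<in>F'. norm (?t n) powr r) \<le> (\<Sum>n\<in>F' - F. norm (x n) powr r)"
    proof -
      have "(\<Sum>n\<in>F'. norm (?t n) powr r) = (\<Sum>n\<in>F' - F. norm (?t n) powr r)"
        by (rule sum.mono_neutral_right) (use that k r in \<open>auto simp: cut_def\<close>)
      also have "\<dots> \<le> (\<Sum>n\<in>F' - F. norm (x n) powr r)"
        by (rule sum_mono) (use r in \<open>auto simp: cut_def\<close>)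
      finally show ?thesis .
    qed
    also have "(\<Sum>n\<in>F. norm (x n) powr r) + (\<Sum>n\<in>F' - F. norm (x n) powr r) = (\<Sum>n\<in>F \<union> F'. norm (x n) powr r)"
      using F that by (subst sum.union_disjoint[symmetric]) (auto intro: arg_cong2[where f=sum])
    moreover have "\<dots> \<le> infsum (\<lambda>n. norm (x n) powr r) UNIV"
      by (rule finite_sum_le_infsum[OF s]) (use F that in auto)
    ultimately show ?thesis using F by linarith
  qed
  have "?t \<in> lp p UNIV \<and> lpnorm p ?t \<le> ((e/2) powr r) powr (1/r)"
    using lpI_finite[of r ?t _ UNIV, OF _ fin] r by auto
  moreover have "((e/2) powr r) powr (1/r) = e / 2" using r assms by (simp add: powr_powr)
  ultimately show ?thesis using that[of k] assms by simp
qed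

text \<open>The kernel is written as a product of two factors of half the rate. One factor is
  summed; the other is kept as a weight on \<open>x\<close>, whose supremum reduces the claim to
  \<open>lp_exp_dominated\<close>.\<close>

lemma lp_exp_kernel:
  assumes "1 \<le> p" "\<epsilon> > 0"
  obtains K where "K > 0"
    "\<And>C x y. \<lbrakk>C \<ge> 0; x \<in> lp p UNIV;
       \<And>n. norm (y n) \<le> infsum (\<lambda>m. C * exp (-\<epsilon> * \<bar>real_of_int (n - m)\<bar>) * norm (x m)) UNIV\<rbrakk>
       \<Longrightarrow> y \<in> lp p UNIV \<and> lpnorm p y \<le> C * K * lpnorm p x"
proof -
  have e2: "\<epsilon>/2 > 0" using assms by simp
  obtain K where K: "K > 0"
    "\<And>C x y. \<lbrakk>C \<ge> 0; x \<in> lp p UNIV; \<And>n. \<exists>m. norm (y n) \<le> C * exp (-(\<epsilon>/2) * \<bar>real_of_int (n - m)\<bar>) * norm (x m)\<rbrakk>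
       \<Longrightarrow> y \<in> lp p UNIV \<and> lpnorm p y \<le> C * K * lpnorm p x"
    using lp_exp_dominated[OF assms(1) e2] by metis
  obtain E where E: "E > 0" "\<And>i::int. infsum (\<lambda>j. exp (-(\<epsilon>/2) * \<bar>real_of_int (i - j)\<bar>)) UNIV \<le> E"
    using exp_abs_infsum_bounded[OF e2] by metis
  show ?thesis
  proof (rule that[of "2 * E * K"])
    show "2 * E * K > 0" using K E by simp
    fix C :: real and x y :: "int \<Rightarrow> complex"
    assume C: "C \<ge> 0" and x: "x \<in> lp p UNIV"
      and y: "\<And>n. norm (y n) \<le> infsum (\<lambda>m. C * exp (-\<epsilon> * \<bar>real_of_int (n - m)\<bar>) * norm (x m)) UNIV"
    obtain X where X: "\<And>n. norm (x n) \<le> X" using lp_bounded[OF assms(1) x] by blast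
    have "\<exists>m. norm (y n) \<le> (C * (2 * E)) * exp (-(\<epsilon>/2) * \<bar>real_of_int (n - m)\<bar>) * norm (x m)" for n
    proof -
      define h where "h = (\<lambda>m. exp (-(\<epsilon>/2) * \<bar>real_of_int (n - m)\<bar>))"
      define S where "S = (SUP m. h m * norm (x m))"
      have hx: "h m * norm (x m) \<le> X" for m
      proof -
        have "h m * norm (x m) \<le> 1 * X" unfolding h_def using assms X by (intro mult_mono) auto
        then show ?thesis by simp
      qed
      then have bd: "bdd_above (range (\<lambda>m. h m * norm (x m)))" by (auto simp: bdd_above_def)
      have le: "h m * norm (x m) \<le> S" for m unfolding S_def by (rule cSUP_upper[OF _ bd]) simp
      have S0: "S \<ge> 0" using le[of 0] by (smt (verit) h_def exp_ge_zero norm_ge_zero mult_nonneg_nonneg)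
      \<comment> \<open>The supremum need not be attained, hence the factor 2; it reappears in the
        constant \<open>2 * E * K\<close>.\<close>
      obtain m where m: "S \<le> 2 * (h m * norm (x m))"
      proof (cases "S = 0")
        case True then show ?thesis using that[of 0] by (simp add: h_def)
      next
        case False
        then have "S / 2 < S" using S0 by simp
        then obtain m where "S / 2 < h m * norm (x m)"
          using less_cSUP_iff[OF _ bd, of "S / 2"] by (auto simp: S_def[symmetric])
        then show ?thesis using that[of m] by simp
      qed
      have hh: "exp (-\<epsilon> * \<bar>real_of_int (n - m)\<bar>) = h m * h m" for m
        by (simp add: h_def exp_add[symmetric])
      have sh: "(\<lambda>m. C * S * h m) summable_on UNIV"
        unfolding h_def by (intro summable_on_cmult_right exp_abs_summable_on e2)
      have mono: "C * (h m * h m) * norm (x m) \<le> C * S * h m" for m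
      proof -
        have "C * h m * (h m * norm (x m)) \<le> C * h m * S"
          using C le by (intro mult_left_mono) (auto simp: h_def)
        then show ?thesis by (simp add: ac_simps)
      qed
      have "norm (y n) \<le> infsum (\<lambda>m. C * (h m * h m) * norm (x m)) UNIV"
        using y[of n] unfolding hh .
      also have "\<dots> \<le> infsum (\<lambda>m. C * S * h m) UNIV"
      proof (rule infsum_mono[OF _ sh])
        show "(\<lambda>m. C * (h m * h m) * norm (x m)) summable_on UNIV"
          by (rule summable_on_comparison_test[OF sh]) (use mono C in auto)
      qed (use mono in auto)
      also have "\<dots> = C * S * infsum h UNIV" unfolding h_def
        by (rule infsum_cmult_right) (use exp_abs_summable_on[OF e2] in auto)
      also have "\<dots> \<le> C * (2 * (h m * norm (x m))) * E"
        using m E(2)[of n] C S0 by (intro mult_mono) (auto simp: h_def intro!: infsum_nonneg)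
      finally show ?thesis by (auto simp: h_def ac_simps)
    qed
    then have "y \<in> lp p UNIV \<and> lpnorm p y \<le> (C * (2 * E)) * K * lpnorm p x"
      by (intro K(2)) (use C E x in auto)
    then show "y \<in> lp p UNIV \<and> lpnorm p y \<le> C * (2 * E * K) * lpnorm p x" by (simp add: ac_simps)
  qed
qed

section \<open>Lower bounds and Green functions\<close>

text \<open>The residual is tested on \<open>I\<close> only, so this concerns the compression to
  \<open>I\<close>. \<open>M\<close> ranges over upper bounds instead of a supremum; for empty
  \<open>I\<close> it could be negative, so the predicate is then false.\<close>

definition lower_bound :: "real \<Rightarrow> real \<Rightarrow> (int \<Rightarrow> real) \<Rightarrow> int set \<Rightarrow> bool" where
  "lower_bound lam c v I \<longleftrightarrow> (\<forall>x M. finite {n. x n \<noteq> 0} \<longrightarrow> (\<forall>n. n \<notin> I \<longrightarrow> x n = 0) \<longrightarrow>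
     (\<forall>n\<in>I. norm (schr_op v lam x n) \<le> M) \<longrightarrow> (\<forall>n. c * norm (x n) \<le> M))"

lemma lower_boundD:
  "\<lbrakk>lower_bound lam c v I; finite {n. x n \<noteq> 0}; \<And>n. n \<notin> I \<Longrightarrow> x n = 0;
    \<And>n. n \<in> I \<Longrightarrow> norm (schr_op v lam x n) \<le> M\<rbrakk> \<Longrightarrow> c * norm (x n) \<le> M"
  unfolding lower_bound_def by blast

lemma lower_boundI:
  "(\<And>x M n. \<lbrakk>finite {n. x n \<noteq> 0}; \<And>n. n \<notin> I \<Longrightarrow> x n = 0;
    \<And>n. n \<in> I \<Longrightarrow> norm (schr_op v lam x n) \<le> M\<rbrakk> \<Longrightarrow> c * norm (x n) \<le> M) \<Longrightarrow> lower_bound lam c v I"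
  unfolding lower_bound_def by blast

lemma lower_bound_mono:
  assumes "lower_bound lam c v I" "c' \<le> c"
  shows "lower_bound lam c' v I"
proof (rule lower_boundI)
  fix x M n
  assume x: "finite {n. x n \<noteq> 0}" "\<And>n. n \<notin> I \<Longrightarrow> x n = 0"
    "\<And>n. n \<in> I \<Longrightarrow> norm (schr_op v lam x n) \<le> M"
  have "c' * norm (x n) \<le> c * norm (x n)" using assms(2) by (intro mult_right_mono) auto
  also have "\<dots> \<le> M" by (rule lower_boundD[OF assms(1) x])
  finally show "c' * norm (x n) \<le> M" .
qed

text \<open>The potential multiplies \<open>x\<close>, so only its values on the support matter.
  Through this lemma lower bounds pass between sequences that share a word.\<close>

lemma schr_op_cong: "(\<And>n. x n \<noteq> 0 \<Longrightarrow> v n = v' n) \<Longrightarrow> schr_op v lam x = schr_op v' lam x"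
  by (force simp: schr_op_def)

lemma schr_op_diff: "schr_op v lam (\<lambda>n. x n - y n) n = schr_op v lam x n - schr_op v lam y n"
  by (simp add: schr_op_def algebra_simps)

lemma schr_op_add: "schr_op v lam (\<lambda>n. x n + y n) n = schr_op v lam x n + schr_op v lam y n"
  by (simp add: schr_op_def algebra_simps)

lemma schr_op_scale: "schr_op v lam (\<lambda>n. c * x n) n = c * schr_op v lam x n"
  by (simp add: schr_op_def algebra_simps)

lemma schr_op_zero [simp]: "schr_op v lam (\<lambda>n. 0) n = 0"
  by (simp add: schr_op_def)

lemma schr_op_shift: "schr_op (\<lambda>n. v (n + s)) lam (\<lambda>n. x (n + s)) n = schr_op v lam x (n + s)"
  by (simp add: schr_op_def algebra_simps)

lemma schr_op_reflect: "schr_op (\<lambda>n. v (- n)) lam (\<lambda>n. x (- n)) n = schr_op v lam x (- n)"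
  by (simp add: schr_op_def algebra_simps)

lemma lower_bound_shift:
  assumes "lower_bound lam c (\<lambda>n. v (n + s)) J"
  shows "lower_bound lam c v {n. n - s \<in> J}"
proof (rule lower_boundI)
  fix x M n
  assume x: "finite {n. x n \<noteq> 0}" "\<And>n. n \<notin> {n. n - s \<in> J} \<Longrightarrow> x n = 0"
    "\<And>n. n \<in> {n. n - s \<in> J} \<Longrightarrow> norm (schr_op v lam x n) \<le> M"
  have "{n. x (n + s) \<noteq> 0} = (\<lambda>n. n - s) ` {n. x n \<noteq> 0}"
    by (auto simp: image_iff) (metis add_diff_cancel diff_add_cancel)
  then have "c * norm (x ((n - s) + s)) \<le> M"
    by (intro lower_boundD[OF assms]) (use x in \<open>auto simp: schr_op_shift\<close>)
  then show "c * norm (x n) \<le> M" by simp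
qed

lemma lower_bound_reflect:
  assumes "lower_bound lam c (\<lambda>n. v (- n)) J"
  shows "lower_bound lam c v {n. - n \<in> J}"
proof (rule lower_boundI)
  fix x M n
  assume x: "finite {n. x n \<noteq> 0}" "\<And>n. n \<notin> {n. - n \<in> J} \<Longrightarrow> x n = 0"
    "\<And>n. n \<in> {n. - n \<in> J} \<Longrightarrow> norm (schr_op v lam x n) \<le> M"
  have "{n. x (- n) \<noteq> 0} = uminus ` {n. x n \<noteq> 0}"
    by (auto simp: image_iff) (metis minus_minus)
  then have "c * norm (x (- (- n))) \<le> M"
    by (intro lower_boundD[OF assms]) (use x in \<open>auto simp: schr_op_reflect\<close>)
  then show "c * norm (x n) \<le> M" by simp
qed

text \<open>The reason for working with finite supports: errors are compared with the value at a
  maximiser and then absorbed.\<close>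

lemma finite_support_argmax:
  fixes x :: "int \<Rightarrow> complex"
  assumes "finite {n. x n \<noteq> 0}"
  obtains k where "\<And>n. norm (x n) \<le> norm (x k)"
proof (cases "{n. x n \<noteq> 0} = {}")
  case True then show ?thesis using that[of 0] by auto
next
  case False
  obtain k where k: "k \<in> {n. x n \<noteq> 0}" "\<And>n. n \<in> {n. x n \<noteq> 0} \<Longrightarrow> norm (x n) \<le> norm (x k)"
    using arg_min_if_finite[OF assms False, of "\<lambda>n. - norm (x n)"] by force
  then show ?thesis using that[of k] by (metis mem_Collect_eq norm_ge_zero norm_zero)
qed

text \<open>A cut-off with value 1 at \<open>k\<close> and slope 1/R. It perturbs the residual by at
  most \<open>2 * X / R\<close>; with R = 4/c this is half of \<open>c * X\<close>.\<close>

definition tent :: "int \<Rightarrow> real \<Rightarrow> int \<Rightarrow> real" where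
  "tent k R n = max 0 (1 - \<bar>real_of_int (n - k)\<bar> / R)"

lemma tent_bounds: "R > 0 \<Longrightarrow> 0 \<le> tent k R n" "R > 0 \<Longrightarrow> tent k R n \<le> 1" "tent k R k = 1"
  by (auto simp: tent_def)

lemma tent_eq_0: "R > 0 \<Longrightarrow> \<bar>real_of_int (n - k)\<bar> \<ge> R \<Longrightarrow> tent k R n = 0"
  by (auto simp: tent_def)

lemma tent_lipschitz:
  assumes "R > 0"
  shows "\<bar>tent k R (n + 1) - tent k R n\<bar> \<le> 1 / R" "\<bar>tent k R (n - 1) - tent k R n\<bar> \<le> 1 / R"
proof -
  have *: "\<bar>max 0 (1 - a / R) - max 0 (1 - b / R)\<bar> \<le> 1 / R" if "\<bar>a - b\<bar> \<le> 1" for a b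
  proof -
    have "\<bar>a / R - b / R\<bar> \<le> 1 / R"
      using assms that by (simp add: diff_divide_distrib[symmetric] divide_right_mono)
    then show ?thesis by linarith
  qed
  show "\<bar>tent k R (n + 1) - tent k R n\<bar> \<le> 1 / R" unfolding tent_def by (rule *) simp
  show "\<bar>tent k R (n - 1) - tent k R n\<bar> \<le> 1 / R" unfolding tent_def by (rule *) simp
qed

text \<open>Discrete Leibniz rule: the potential commutes with a multiplier, so only the increments
  of \<open>\<phi>\<close> survive.\<close>

lemma schr_op_multiplier:
  "schr_op v lam (\<lambda>n. of_real (\<phi> n) * x n) n = of_real (\<phi> n) * schr_op v lam x n
     + of_real (\<phi> (n + 1) - \<phi> n) * x (n + 1) + of_real (\<phi> (n - 1) - \<phi> n) * x (n - 1)"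
  by (simp add: schr_op_def algebra_simps)

lemma norm_schr_op_multiplier:
  "norm (schr_op v lam (\<lambda>n. of_real (\<phi> n) * x n) n) \<le> \<bar>\<phi> n\<bar> * norm (schr_op v lam x n)
     + \<bar>\<phi> (n + 1) - \<phi> n\<bar> * norm (x (n + 1)) + \<bar>\<phi> (n - 1) - \<phi> n\<bar> * norm (x (n - 1))"
  unfolding schr_op_multiplier
  by (intro norm_triangle_le add_mono) (auto simp: norm_mult simp del: of_real_diff)

lemma norm_schr_op_tent:
  assumes "R > 0" "\<And>n. norm (x n) \<le> X"
  shows "norm (schr_op v lam (\<lambda>n. of_real (tent k R n) * x n) n)
     \<le> tent k R n * norm (schr_op v lam x n) + 2 * X / R"
proof -
  have "\<bar>tent k R (n + 1) - tent k R n\<bar> * norm (x (n + 1)) \<le> 1 / R * X"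
    by (rule mult_mono) (use assms tent_lipschitz[OF assms(1), of k n] in auto)
  moreover have "\<bar>tent k R (n - 1) - tent k R n\<bar> * norm (x (n - 1)) \<le> 1 / R * X"
    by (rule mult_mono) (use assms tent_lipschitz[OF assms(1), of k n] in auto)
  ultimately show ?thesis
    using norm_schr_op_multiplier[of v lam "tent k R" x n] tent_bounds(1)[OF assms(1), of k n] by simp
qed

text \<open>The error terms carry the weight of the neighbouring site, not of \<open>n\<close>. They
  are thus values of the weighted sequence itself and can be absorbed at its maximum.\<close>

lemma norm_schr_op_exp_weight:
  assumes "\<epsilon> \<ge> 0" "\<And>n. \<bar>w (n + 1) - w n\<bar> \<le> \<epsilon>"
  shows "norm (schr_op v lam (\<lambda>n. of_real (exp (w n)) * x n) n) \<le> exp (w n) * norm (schr_op v lam x n)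
     + (exp \<epsilon> - 1) * (exp (w (n + 1)) * norm (x (n + 1)))
     + (exp \<epsilon> - 1) * (exp (w (n - 1)) * norm (x (n - 1)))"
proof -
  \<comment> \<open>For b above a this is immediate. For b below a it needs 1 - exp (-\<epsilon>)
    \<le> exp \<epsilon> - 1, that is cosh \<epsilon> \<ge> 1.\<close>
  have *: "\<bar>exp a - exp b\<bar> \<le> (exp \<epsilon> - 1) * exp a" if "\<bar>a - b\<bar> \<le> \<epsilon>" for a b :: real
  proof -
    have "exp b \<le> exp \<epsilon> * exp a" using that by (auto simp: exp_add[symmetric])
    moreover have "exp (a - \<epsilon>) \<le> exp b" using that unfolding exp_le_cancel_iff by linarith
    moreover have "exp (a - \<epsilon>) \<ge> (2 - exp \<epsilon>) * exp a"
    proof -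
      have "1 \<le> (exp \<epsilon> + exp (-\<epsilon>)) / 2" using cosh_real_ge_1[of \<epsilon>] by (simp add: cosh_def)
      then have "2 - exp \<epsilon> \<le> exp (-\<epsilon>)" by simp
      then have "(2 - exp \<epsilon>) * exp a \<le> exp (-\<epsilon>) * exp a" by (intro mult_right_mono) auto
      then show ?thesis by (simp add: exp_add[symmetric] algebra_simps)
    qed
    ultimately show ?thesis unfolding abs_le_iff left_diff_distrib mult_1 by linarith
  qed
  have "\<bar>exp (w (n + 1)) - exp (w n)\<bar> * norm (x (n + 1)) \<le> (exp \<epsilon> - 1) * exp (w (n + 1)) * norm (x (n + 1))"
    by (intro mult_right_mono *) (use assms(2)[of n] in auto)
  moreover have "\<bar>exp (w (n - 1)) - exp (w n)\<bar> * norm (x (n - 1)) \<le> (exp \<epsilon> - 1) * exp (w (n - 1)) * norm (x (n - 1))"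
    by (intro mult_right_mono *) (use assms(2)[of "n - 1"] in auto)
  ultimately show ?thesis
    using norm_schr_op_multiplier[of v lam "\<lambda>n. exp (w n)" x n] by (simp add: mult.assoc)
qed

text \<open>The sign \<open>s\<close> covers both uses: growing weights prove off-diagonal decay,
  decaying weights localise at a site.\<close>

lemma abs_weight_lipschitz:
  fixes \<epsilon> :: real
  assumes "\<epsilon> \<ge> 0" "\<bar>s\<bar> = 1"
  shows "\<bar>s * (\<epsilon> * \<bar>real_of_int (n + 1 - j)\<bar>) - s * (\<epsilon> * \<bar>real_of_int (n - j)\<bar>)\<bar> \<le> \<epsilon>"
proof -
  have "\<bar>s * (\<epsilon> * \<bar>real_of_int (n + 1 - j)\<bar>) - s * (\<epsilon> * \<bar>real_of_int (n - j)\<bar>)\<bar>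
      = \<bar>s\<bar> * (\<epsilon> * \<bar>\<bar>real_of_int (n + 1 - j)\<bar> - \<bar>real_of_int (n - j)\<bar>\<bar>)"
    using assms by (simp add: right_diff_distrib[symmetric] abs_mult)
  also have "\<dots> \<le> 1 * (\<epsilon> * 1)" using assms by (intro mult_mono) auto
  finally show ?thesis by simp
qed

lemma lower_bound_UNIV:
  assumes "\<And>a. lower_bound lam c v {a..}"
  shows "lower_bound lam c v UNIV"
proof (rule lower_boundI)
  fix x M n
  assume x: "finite {n. x n \<noteq> 0}" "\<And>n. n \<in> UNIV \<Longrightarrow> norm (schr_op v lam x n) \<le> M"
  obtain N where N: "\<And>d. d \<in> {n. x n \<noteq> 0} \<Longrightarrow> nat \<bar>d\<bar> \<le> N" using finite_int_bounded[OF x(1)] by metis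
  have "x n = 0" if "n \<notin> {- int N..}" for n using N[of n] that by force
  then show "c * norm (x n) \<le> M" using lower_boundD[OF assms[of "- int N"] x(1), of M n] x(2) by blast
qed

text \<open>A tent of radius 4/c around a maximiser meets at most one end of an interval of length
  at least 8/c, so the cut-off sequence is subject to one of the two half-line bounds.\<close>

lemma lower_bound_interval:
  assumes l: "lower_bound lam c v {a..}" and r: "lower_bound lam c v {..b}" and c: "c > 0"
    and len: "real_of_int (b - a) \<ge> 8 / c"
  shows "lower_bound lam (c / 2) v {a..b}"
proof (rule lower_boundI)
  fix x M n
  assume x: "finite {n. x n \<noteq> 0}" "\<And>n. n \<notin> {a..b} \<Longrightarrow> x n = 0"
    "\<And>n. n \<in> {a..b} \<Longrightarrow> norm (schr_op v lam x n) \<le> M"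
  have "8 / c > 0" using c by simp
  then have "a \<le> b" using len by linarith
  then have M: "0 \<le> M" using x(3)[of a] by (auto intro: order_trans[OF norm_ge_zero])
  obtain k where k: "\<And>n. norm (x n) \<le> norm (x k)" using finite_support_argmax[OF x(1)] by metis
  define R where "R = 4 / c"
  have R: "R > 0" "2 * R \<le> real_of_int (b - a)" using c len by (auto simp: R_def)
  let ?y = "\<lambda>n. of_real (tent k R n) * x n"
  have supp: "finite {n. ?y n \<noteq> 0}" by (rule finite_subset[OF _ x(1)]) auto
  have y0: "?y n = 0" if "n \<notin> {a..b}" for n using x(2)[OF that] by simp
  have res: "norm (schr_op v lam ?y n) \<le> M + c / 2 * norm (x k)" if "n \<in> {a..b} \<or> tent k R n = 0" for n
  proof -
    have "tent k R n * norm (schr_op v lam x n) \<le> M"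
    proof (cases "n \<in> {a..b}")
      case True
      have "tent k R n * norm (schr_op v lam x n) \<le> 1 * M"
        using tent_bounds(1,2)[OF R(1)] x(3)[OF True] M by (intro mult_mono) auto
      then show ?thesis by simp
    qed (use that M in auto)
    moreover have "2 * norm (x k) / R = c / 2 * norm (x k)" using c by (simp add: R_def)
    ultimately show ?thesis using norm_schr_op_tent[where x = x, OF R(1) k, of v lam k n] by linarith
  qed
  have "c * norm (?y k) \<le> M + c / 2 * norm (x k)"
  proof (cases "2 * k \<le> a + b")
    \<comment> \<open>The maximiser lies in the left half, so the tent has died out beyond
      \<open>b\<close> and the right half line sees no additional residual.\<close>
    case True
    show ?thesis
    proof (rule lower_boundD[OF l supp])
      fix n assume n: "n \<in> {a..}"
      show "norm (schr_op v lam ?y n) \<le> M + c / 2 * norm (x k)"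
      proof (rule res)
        show "n \<in> {a..b} \<or> tent k R n = 0"
        proof (cases "n \<le> b")
          case False
          then have "R \<le> real_of_int (n - k)" using True R by linarith
          then show ?thesis using R by (auto intro!: tent_eq_0)
        qed (use n in auto)
      qed
    qed (use y0 in force)
  next
    case False
    show ?thesis
    proof (rule lower_boundD[OF r supp])
      fix n assume n: "n \<in> {..b}"
      show "norm (schr_op v lam ?y n) \<le> M + c / 2 * norm (x k)"
      proof (rule res)
        show "n \<in> {a..b} \<or> tent k R n = 0"
        proof (cases "n \<ge> a")
          case f: False
          then have "R \<le> real_of_int (k - n)" using False R by linarith
          then show ?thesis using R by (auto intro!: tent_eq_0)
        qed (use n in auto)
      qed
    qed (use y0 in force)
  qed
  then have "c / 2 * norm (x k) \<le> M" by (simp add: tent_bounds)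
  moreover have "c / 2 * norm (x n) \<le> c / 2 * norm (x k)" using k c by (intro mult_left_mono) auto
  ultimately show "c / 2 * norm (x n) \<le> M" by linarith
qed

text \<open>Meant for potentials of which only words of a fixed length are known, such as those of
  the rational approximants. \<open>N\<close> is the diameter 2R = 8/c of the tent plus 2 for
  rounding.\<close>

lemma lower_bound_localize:
  assumes win: "\<And>x M a n. \<lbrakk>a \<ge> 0; \<And>n. n \<notin> {a..a + int N} \<Longrightarrow> x n = 0;
      \<And>n. n \<ge> a \<Longrightarrow> norm (schr_op v lam x n) \<le> M\<rbrakk> \<Longrightarrow> c * norm (x n) \<le> M"
    and c: "c > 0" and N: "real N \<ge> 8 / c + 2"
  shows "lower_bound lam (c / 2) v {0..}"
proof (rule lower_boundI)
  fix x M n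
  assume x: "finite {n. x n \<noteq> 0}" "\<And>n. n \<notin> {0..} \<Longrightarrow> x n = 0"
    "\<And>n. n \<in> {0..} \<Longrightarrow> norm (schr_op v lam x n) \<le> M"
  have M: "0 \<le> M" using x(3)[of 0] by (auto intro: order_trans[OF norm_ge_zero])
  obtain k where k: "\<And>n. norm (x n) \<le> norm (x k)" using finite_support_argmax[OF x(1)] by metis
  define R where "R = 4 / c"
  have R: "R > 0" "2 * R + 2 \<le> real N" using c N by (auto simp: R_def)
  let ?y = "\<lambda>n. of_real (tent k R n) * x n"
  \<comment> \<open>The window follows the tent but is stopped at 0, where the boundary condition
    takes over.\<close>
  define a where "a = max 0 (k - \<lceil>R\<rceil>)"
  have "c * norm (?y k) \<le> M + c / 2 * norm (x k)"
  proof (rule win[where x = ?y and a = a])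
    show "0 \<le> a" by (simp add: a_def)
    show "?y n = 0" if "n \<notin> {a..a + int N}" for n
    proof (cases "n < 0")
      case True then show ?thesis using x(2) by simp
    next
      case False
      have "R \<le> \<bar>real_of_int (n - k)\<bar>"
      proof (cases "n < a")
        case True
        then have "n < k - \<lceil>R\<rceil>" using False by (auto simp: a_def)
        then show ?thesis by linarith
      next
        case f: False
        then have "n > a + int N" using that by auto
        then have "n > k - \<lceil>R\<rceil> + int N" by (auto simp: a_def)
        then show ?thesis using R by linarith
      qed
      then show ?thesis using tent_eq_0[OF R(1)] by simp
    qed
    fix n assume "a \<le> n"
    then have "n \<in> {0..}" by (auto simp: a_def)
    then have "tent k R n * norm (schr_op v lam x n) \<le> 1 * M"
      using tent_bounds(1,2)[OF R(1)] x(3) M by (intro mult_mono) auto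
    moreover have "2 * norm (x k) / R = c / 2 * norm (x k)" using c by (simp add: R_def)
    ultimately show "norm (schr_op v lam ?y n) \<le> M + c / 2 * norm (x k)"
      using norm_schr_op_tent[where x = x, OF R(1) k, of v lam k n] by linarith
  qed
  then have "c / 2 * norm (x k) \<le> M" by (simp add: tent_bounds)
  moreover have "c / 2 * norm (x n) \<le> c / 2 * norm (x k)" using k c by (intro mult_left_mono) auto
  ultimately show "c / 2 * norm (x n) \<le> M" by linarith
qed

text \<open>Extends injectivity from finitely supported to bounded sequences: the tent is so wide
  that its error is half of \<open>c * norm (x n)\<close>.\<close>

lemma lower_bound_injective:
  assumes lb: "lower_bound lam c v I" and c: "c > 0"
    and x: "\<And>n. norm (x n) \<le> X" "\<And>n. n \<notin> I \<Longrightarrow> x n = 0" "\<And>n. n \<in> I \<Longrightarrow> schr_op v lam x n = 0"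
  shows "x n = 0"
proof (rule ccontr)
  assume n: "x n \<noteq> 0"
  have X: "X > 0" using n x(1)[of n] by (auto intro: less_le_trans[of 0 "norm (x n)"])
  define R where "R = 4 * X / (c * norm (x n))"
  have R: "R > 0" using X c n by (simp add: R_def)
  let ?y = "\<lambda>m. of_real (tent n R m) * x m"
  have "c * norm (?y n) \<le> 2 * X / R"
  proof (rule lower_boundD[OF lb, where x = ?y])
    have "{m. ?y m \<noteq> 0} \<subseteq> {n - \<lceil>R\<rceil>..n + \<lceil>R\<rceil>}"
    proof
      fix m assume "m \<in> {m. ?y m \<noteq> 0}"
      then have "\<not> R \<le> \<bar>real_of_int (m - n)\<bar>" using tent_eq_0[OF R] by auto
      then show "m \<in> {n - \<lceil>R\<rceil>..n + \<lceil>R\<rceil>}" by (auto simp: abs_if split: if_splits) linarith+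
    qed
    then show "finite {m. ?y m \<noteq> 0}" by (rule finite_subset) simp
    show "norm (schr_op v lam ?y m) \<le> 2 * X / R" if "m \<in> I" for m
      using norm_schr_op_tent[where x = x, OF R x(1), of v lam n m] x(3)[OF that] by simp
  qed (use x in auto)
  also have "2 * X / R = c * norm (x n) / 2" using X c n by (simp add: R_def field_simps)
  finally show False using c n by (simp add: tent_bounds)
qed

text \<open>The Combes-Thomas argument. The growing weight is 1 at \<open>j\<close>, the only site
  with a residual; the condition on \<open>\<epsilon>\<close> lets the commutator be absorbed into
  half of \<open>c\<close>.\<close>

lemma green_decay:
  assumes lb: "lower_bound lam c v I" and c: "c > 0" and e: "\<epsilon> \<ge> 0" "2 * (exp \<epsilon> - 1) \<le> c / 2"
    and g: "finite {n. g n \<noteq> 0}" "\<And>n. n \<notin> I \<Longrightarrow> g n = 0"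
      "\<And>n. n \<in> I \<Longrightarrow> norm (schr_op v lam g n) \<le> (if n = j then 1 else 0)"
  shows "norm (g i) \<le> 2 / c * exp (-\<epsilon> * \<bar>real_of_int (i - j)\<bar>)"
proof -
  define w where "w = (\<lambda>n. 1 * (\<epsilon> * \<bar>real_of_int (n - j)\<bar>))"
  have w: "\<bar>w (n + 1) - w n\<bar> \<le> \<epsilon>" for n
    unfolding w_def by (rule abs_weight_lipschitz) (use e in auto)
  let ?h = "\<lambda>n. of_real (exp (w n)) * g n"
  have nh: "norm (?h n) = exp (w n) * norm (g n)" for n by (simp add: norm_mult)
  have fin: "finite {n. ?h n \<noteq> 0}" using g(1) by simp
  obtain k where k: "\<And>n. norm (?h n) \<le> norm (?h k)" using finite_support_argmax[OF fin] by metis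
  have "c * norm (?h k) \<le> 1 + c / 2 * norm (?h k)"
  proof (rule lower_boundD[OF lb fin])
    fix n assume n: "n \<in> I"
    have 1: "exp (w n) * norm (schr_op v lam g n) \<le> 1"
      using g(3)[OF n] by (auto simp: w_def split: if_splits)
    have 2: "(exp \<epsilon> - 1) * (exp (w m) * norm (g m)) \<le> (exp \<epsilon> - 1) * norm (?h k)" for m
      using k[of m] e unfolding nh by (intro mult_left_mono) auto
    have "2 * (exp \<epsilon> - 1) * norm (?h k) \<le> c / 2 * norm (?h k)"
      by (rule mult_right_mono[OF e(2)]) simp
    then show "norm (schr_op v lam ?h n) \<le> 1 + c / 2 * norm (?h k)"
      using norm_schr_op_exp_weight[where w = w, OF e(1) w, of v lam g n] 1 2[of "n + 1"] 2[of "n - 1"] by linarith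
  qed (use g in auto)
  then have "c / 2 * norm (?h i) \<le> 1" using k[of i] c mult_left_mono[OF k[of i], of "c/2"] by linarith
  then have "norm (g i) * exp (w i) \<le> 2 / c" using c unfolding nh by (simp add: field_simps)
  then have "norm (g i) * exp (w i) * exp (- w i) \<le> 2 / c * exp (- w i)" by (intro mult_right_mono) auto
  moreover have "exp (w i) * exp (- w i) = 1" by (simp add: exp_add[symmetric])
  ultimately show ?thesis by (simp add: w_def mult.assoc)
qed

section \<open>Shooting on a finite interval\<close>

fun shoot :: "(nat \<Rightarrow> 'a::comm_ring_1) \<Rightarrow> (nat \<Rightarrow> 'a) \<Rightarrow> 'a \<Rightarrow> nat \<Rightarrow> 'a" where
  "shoot \<kappa> f t 0 = 0"
| "shoot \<kappa> f t (Suc 0) = t"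
| "shoot \<kappa> f t (Suc (Suc n)) = f n - shoot \<kappa> f t n - \<kappa> n * shoot \<kappa> f t (Suc n)"

lemma shoot_affine: "shoot \<kappa> f t n = shoot \<kappa> f 0 n + t * shoot \<kappa> (\<lambda>_. 0) 1 n"
  by (induction n rule: shoot.induct[of _ \<kappa> f t]) (auto simp: algebra_simps)

text \<open>Index \<open>n\<close> of \<open>shoot\<close> stands for the site a + n - 1: index 0 is
  the Dirichlet value at a - 1, and \<open>nat (b - a + 2)\<close> is the site b + 1, where
  vanishing is the right boundary condition.\<close>

lemma shoot_solves:
  fixes a b :: int
  assumes "n \<in> {a..b}" "shoot (\<lambda>j. of_real (lam * v (a + int j))) f t (nat (b - a + 2)) = 0"
  shows "schr_op v lam (\<lambda>i. if i \<in> {a..b} then shoot (\<lambda>j. of_real (lam * v (a + int j))) f t (nat (i - a + 1)) else 0) n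
     = f (nat (n - a))"
proof -
  define j where "j = nat (n - a)"
  have n: "n = a + int j" using assms by (simp add: j_def)
  let ?s = "shoot (\<lambda>j. complex_of_real (lam * v (a + int j))) f t"
  have 1: "(if n + 1 \<in> {a..b} then ?s (nat (n + 1 - a + 1)) else 0) = ?s (Suc (Suc j))"
  proof (cases "n + 1 \<le> b")
    case False
    then have "nat (b - a + 2) = Suc (Suc j)" using assms n by auto
    then show ?thesis using False assms(2) by auto
  qed (use n in \<open>auto simp: nat_add_distrib numeral_2_eq_2 add.commute\<close>)
  have 2: "(if n - 1 \<in> {a..b} then ?s (nat (n - 1 - a + 1)) else 0) = ?s j"
    using n assms by (cases j) (auto simp: nat_add_distrib)
  have 3: "(if n \<in> {a..b} then ?s (nat (n - a + 1)) else 0) = ?s (Suc j)"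
    using assms n by (auto simp: nat_add_distrib)
  show ?thesis unfolding schr_op_def 1 2 3 using n by (simp add: j_def)
qed

text \<open>Injectivity implies surjectivity for a square matrix, made explicit. If the homogeneous
  solution vanished at b + 1, it would be a kernel element with value 1 at \<open>a\<close>;
  otherwise the free parameter \<open>t\<close> adjusts the value at b + 1 to 0.\<close>

lemma interval_solvable:
  assumes lb: "lower_bound lam c v {a..b}" and c: "c > 0" and ab: "a \<le> b"
  obtains g where "\<And>n. n \<notin> {a..b} \<Longrightarrow> g n = 0" "\<And>n. n \<in> {a..b} \<Longrightarrow> schr_op v lam g n = f n"
proof -
  let ?\<kappa> = "\<lambda>j. complex_of_real (lam * v (a + int j))"
  let ?F = "\<lambda>j. f (a + int j)"
  let ?L = "nat (b - a + 2)"
  have U: "shoot ?\<kappa> (\<lambda>_. 0) 1 ?L \<noteq> 0"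
  proof
    assume z: "shoot ?\<kappa> (\<lambda>_. 0) 1 ?L = 0"
    let ?x = "\<lambda>i. if i \<in> {a..b} then shoot ?\<kappa> (\<lambda>_. 0) 1 (nat (i - a + 1)) else 0"
    have "c * norm (?x a) \<le> 0"
    proof (rule lower_boundD[OF lb, where x = ?x])
      show "finite {n. ?x n \<noteq> 0}" by (rule finite_subset[of _ "{a..b}"]) auto
      show "norm (schr_op v lam ?x n) \<le> 0" if "n \<in> {a..b}" for n
        unfolding shoot_solves[OF that z] by simp
    qed auto
    then show False using c ab by simp
  qed
  define t where "t = - shoot ?\<kappa> ?F 0 ?L / shoot ?\<kappa> (\<lambda>_. 0) 1 ?L"
  have "shoot ?\<kappa> ?F t ?L = 0" using U by (subst shoot_affine) (simp add: t_def)
  then have "schr_op v lam (\<lambda>i. if i \<in> {a..b} then shoot ?\<kappa> ?F t (nat (i - a + 1)) else 0) n = f n"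
    if "n \<in> {a..b}" for n using shoot_solves[OF that, of lam v ?F t] that by simp
  then show ?thesis by (intro that[of "\<lambda>i. if i \<in> {a..b} then shoot ?\<kappa> ?F t (nat (i - a + 1)) else 0"]) auto
qed

section \<open>Green functions of sections and their limits\<close>

definition is_green :: "real \<Rightarrow> (int \<Rightarrow> real) \<Rightarrow> int set \<Rightarrow> real \<Rightarrow> real \<Rightarrow> (int \<Rightarrow> int \<Rightarrow> complex) \<Rightarrow> bool" where
  "is_green lam v I C \<epsilon> G \<longleftrightarrow> (\<forall>i j. i \<notin> I \<or> j \<notin> I \<longrightarrow> G i j = 0) \<and>
     (\<forall>i\<in>I. \<forall>j\<in>I. schr_op v lam (\<lambda>i. G i j) i = (if i = j then 1 else 0)) \<and>
     (\<forall>i j. norm (G i j) \<le> C * exp (-\<epsilon> * \<bar>real_of_int (i - j)\<bar>))"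

lemma is_green_interval:
  assumes lb: "lower_bound lam c v {a..b}" and c: "c > 0" and ab: "a \<le> b"
    and e: "\<epsilon> \<ge> 0" "2 * (exp \<epsilon> - 1) \<le> c / 2"
  obtains G where "is_green lam v {a..b} (2 / c) \<epsilon> G"
proof -
  have "\<forall>j. \<exists>g. (\<forall>n. n \<notin> {a..b} \<longrightarrow> g n = 0) \<and> (\<forall>n\<in>{a..b}. schr_op v lam g n = (if n = j then 1 else 0))"
  proof
    fix j
    show "\<exists>g. (\<forall>n. n \<notin> {a..b} \<longrightarrow> g n = 0) \<and> (\<forall>n\<in>{a..b}. schr_op v lam g n = (if n = j then 1 else 0))"
      by (rule interval_solvable[OF lb c ab, of "\<lambda>n. if n = j then 1 else 0"]) blast
  qed
  then obtain g where g: "\<And>j n. n \<notin> {a..b} \<Longrightarrow> g j n = 0"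
    "\<And>j n. n \<in> {a..b} \<Longrightarrow> schr_op v lam (g j) n = (if n = j then 1 else 0)" by metis
  define G where "G = (\<lambda>i j. if j \<in> {a..b} then g j i else 0)"
  have "norm (G i j) \<le> 2 / c * exp (-\<epsilon> * \<bar>real_of_int (i - j)\<bar>)" for i j
  proof (cases "j \<in> {a..b}")
    case True
    have "{n. g j n \<noteq> 0} \<subseteq> {a..b}" using g(1) by blast
    then have "finite {n. g j n \<noteq> 0}" by (rule finite_subset) simp
    then have "norm (g j i) \<le> 2 / c * exp (-\<epsilon> * \<bar>real_of_int (i - j)\<bar>)"
      by (rule green_decay[OF lb c e]) (use g in auto)
    then show ?thesis using True by (simp add: G_def)
  qed (use c in \<open>auto simp: G_def\<close>)
  moreover have "schr_op v lam (\<lambda>i. G i j) i = (if i = j then 1 else 0)" if "i \<in> {a..b}" "j \<in> {a..b}" for i j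
    using g that by (simp add: G_def)
  moreover have "G i j = 0" if "i \<notin> {a..b} \<or> j \<notin> {a..b}" for i j
    using g that by (auto simp: G_def)
  ultimately show ?thesis by (intro that[of G]) (auto simp: is_green_def)
qed

text \<open>Enlarging the section perturbs the Green function only by the contributions of the two
  cut bonds.\<close>
lemma is_green_sections_close:
  assumes G: "is_green lam v (I \<inter> box n) C \<epsilon> G" and G': "is_green lam v (I \<inter> box n') C \<epsilon> G'"
    and lb: "lower_bound lam c v (I \<inter> box n)" and c: "c > 0" and C: "C \<ge> 0" and e: "\<epsilon> \<ge> 0" and le: "n \<le> n'"
    and ij: "i \<in> box n" "j \<in> box n"
  shows "norm (G' i j - G i j) \<le> 2 * C\<^sup>2 * exp (-\<epsilon> * (real n - \<bar>real_of_int i\<bar>)) * exp (-\<epsilon> * (real n - \<bar>real_of_int j\<bar>))"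
proof (cases "i \<in> I \<and> j \<in> I")
  case False
  then have "G i j = 0" "G' i j = 0" using G G' by (auto simp: is_green_def)
  then show ?thesis by simp
next
  case True
  let ?J = "I \<inter> box n"
  have sub: "box n \<subseteq> box n'" using le by (auto simp: box_def)
  have iJ: "i \<in> ?J" "j \<in> ?J" "j \<in> I \<inter> box n'" using True ij sub by auto
  define p where "p = G' (int n + 1) j"
  define m where "m = G' (- int n - 1) j"
  \<comment> \<open>Cutting \<open>G'\<close> off at the smaller box creates sources
    \<open>- p\<close> and \<open>- m\<close> at its two ends; the added columns of \<open>G\<close>
    compensate them. The corrected difference lies in the kernel of the smaller section and vanishes
    by \<open>lb\<close>.\<close>
  define d where "d = (\<lambda>i. (if i \<in> box n then G' i j else 0) - G i j + (p * G i (int n) + m * G i (- int n)))"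
  have supp: "d i = 0" if "i \<notin> ?J" for i
    using that G G' by (auto simp: is_green_def d_def)
  have ker: "schr_op v lam d i = 0" if "i \<in> ?J" for i
  proof -
    have i: "i \<in> I" "i \<in> box n" "i \<in> I \<inter> box n'" using that sub by auto
    have "schr_op v lam (\<lambda>i. if i \<in> box n then G' i j else 0) i
       = schr_op v lam (\<lambda>i. G' i j) i - (if i = int n then p else 0) - (if i = - int n then m else 0)"
    proof -
      have "(if i + 1 \<in> box n then G' (i + 1) j else 0) = G' (i + 1) j - (if i = int n then p else 0)"
        "(if i - 1 \<in> box n then G' (i - 1) j else 0) = G' (i - 1) j - (if i = - int n then m else 0)"
        using i(2) by (auto simp: box_def p_def m_def dest: antisym)
      then show ?thesis using i(2) by (simp add: schr_op_def)
    qed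
    moreover have "schr_op v lam (\<lambda>i. G' i j) i = (if i = j then 1 else 0)"
      using G' i iJ unfolding is_green_def by blast
    moreover have "schr_op v lam (\<lambda>i. G i j) i = (if i = j then 1 else 0)"
      using G that iJ unfolding is_green_def by blast
    \<comment> \<open>Columns outside \<open>?J\<close> are included because on a half line the end
      -n is not a site; that column is 0, in agreement with the formula.\<close>
    moreover have "schr_op v lam (\<lambda>i. G i l) i = (if i = l then 1 else 0)" for l
    proof (cases "l \<in> ?J")
      case True then show ?thesis using G that unfolding is_green_def by blast
    next
      case False
      then have "(\<lambda>i. G i l) = (\<lambda>_. 0)" using G by (auto simp: is_green_def)
      then show ?thesis using False that by auto
    qed
    ultimately show ?thesis unfolding d_def schr_op_add schr_op_diff schr_op_scale by auto
  qed
  have "{i. d i \<noteq> 0} \<subseteq> box n" using supp by blast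
  then have "finite {i. d i \<noteq> 0}" by (rule finite_subset) (simp add: box_def)
  then have "c * norm (d i) \<le> 0" by (rule lower_boundD[OF lb]) (use supp ker in auto)
  then have "d i = 0" using c by (simp add: mult_le_0_iff)
  then have eq: "G' i j - G i j = - (p * G i (int n) + m * G i (- int n))"
    using ij unfolding eq_neg_iff_add_eq_0 by (simp add: d_def)
  have ex: "exp (-\<epsilon> * t) \<le> exp (-\<epsilon> * s)" if "s \<le> t" for s t :: real
    using that e by (simp add: mult_left_mono)
  let ?a = "exp (-\<epsilon> * (real n - \<bar>real_of_int i\<bar>))" and ?b = "exp (-\<epsilon> * (real n - \<bar>real_of_int j\<bar>))"
  have nb: "norm (G' k j) \<le> C * ?b" if "\<bar>k\<bar> = int n + 1" for k
  proof -
    have "norm (G' k j) \<le> C * exp (-\<epsilon> * \<bar>real_of_int (k - j)\<bar>)" using G' unfolding is_green_def by blast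
    also have "\<dots> \<le> C * ?b" by (intro mult_left_mono ex C) (use that in linarith)
    finally show ?thesis .
  qed
  have na: "norm (G i k) \<le> C * ?a" if "\<bar>k\<bar> = int n" for k
  proof -
    have "norm (G i k) \<le> C * exp (-\<epsilon> * \<bar>real_of_int (i - k)\<bar>)" using G unfolding is_green_def by blast
    also have "\<dots> \<le> C * ?a" by (intro mult_left_mono ex C) (use that in linarith)
    finally show ?thesis .
  qed
  have "norm (p * G i (int n)) \<le> (C * ?b) * (C * ?a)"
    unfolding norm_mult p_def by (rule mult_mono[OF nb na]) (use C in simp_all)
  moreover have "norm (m * G i (- int n)) \<le> (C * ?b) * (C * ?a)"
    unfolding norm_mult m_def by (rule mult_mono[OF nb na]) (use C in simp_all)
  ultimately have "norm (p * G i (int n) + m * G i (- int n)) \<le> 2 * ((C * ?b) * (C * ?a))"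
    by (intro norm_triangle_le) simp
  then show ?thesis unfolding eq norm_minus_cancel by (simp add: power2_eq_square ac_simps)
qed

text \<open>Entries are Cauchy in the size of the section. The operator involves three entries of a
  column at a time, so the equations, the decay and the closeness estimate pass to entrywise
  limits.\<close>

lemma is_green_limit:
  assumes Gn: "\<And>n. n \<ge> n0 \<Longrightarrow> is_green lam v (I \<inter> box n) C \<epsilon> (Gn n)"
    and lb: "\<And>n. n \<ge> n0 \<Longrightarrow> lower_bound lam c v (I \<inter> box n)"
    and c: "c > 0" and C: "C \<ge> 0" and e: "\<epsilon> > 0"
  obtains G where "is_green lam v I C \<epsilon> G"
    "\<And>n i j. \<lbrakk>n \<ge> n0; i \<in> box n; j \<in> box n\<rbrakk> \<Longrightarrow> norm (G i j - Gn n i j)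
       \<le> 2 * C\<^sup>2 * exp (-\<epsilon> * (real n - \<bar>real_of_int i\<bar>)) * exp (-\<epsilon> * (real n - \<bar>real_of_int j\<bar>))"
proof -
  let ?B = "\<lambda>n i j. 2 * C\<^sup>2 * exp (-\<epsilon> * (real n - \<bar>real_of_int i\<bar>)) * exp (-\<epsilon> * (real n - \<bar>real_of_int j\<bar>))"
  have close: "norm (Gn n' i j - Gn n i j) \<le> ?B n i j" if "n0 \<le> n" "n \<le> n'" "i \<in> box n" "j \<in> box n" for n n' i j
    by (rule is_green_sections_close[OF Gn Gn lb c C]) (use that e in auto)
  have lim0: "(\<lambda>n. ?B n i j) \<longlonglongrightarrow> 0" for i j :: int
  proof -
    have "(\<lambda>n. exp (-\<epsilon> * (real n - s))) \<longlonglongrightarrow> 0" for s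
    proof -
      have "(\<lambda>n. exp (\<epsilon> * s) * exp (-\<epsilon>) ^ n) \<longlonglongrightarrow> exp (\<epsilon> * s) * 0"
        by (intro tendsto_intros LIMSEQ_realpow_zero) (use e in auto)
      then show ?thesis by (simp add: exp_of_nat_mult[symmetric] exp_add[symmetric] algebra_simps)
    qed
    then have "(\<lambda>n. ?B n i j) \<longlonglongrightarrow> 2 * C\<^sup>2 * 0 * 0" by (intro tendsto_intros)
    then show ?thesis by simp
  qed
  have conv: "convergent (\<lambda>n. Gn n i j)" for i j
  proof (rule Cauchy_convergent, rule metric_CauchyI)
    fix r :: real assume "r > 0"
    then have "eventually (\<lambda>n. ?B n i j < r / 2) sequentially"
      by (intro order_tendstoD(2)[OF lim0]) simp
    then obtain n1 where n1: "\<And>n. n \<ge> n1 \<Longrightarrow> ?B n i j < r / 2" unfolding eventually_sequentially by blast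
    define m where "m = max (max n0 n1) (nat (max \<bar>i\<bar> \<bar>j\<bar>))"
    have m: "m \<ge> n0" "m \<ge> n1" "i \<in> box m" "j \<in> box m" by (auto simp: m_def box_def)
    have "norm (Gn n i j - Gn m i j) < r / 2" if "n \<ge> m" for n
      using close[OF m(1) that m(3,4)] n1[OF m(2)] by linarith
    then have "dist (Gn a i j) (Gn b i j) < r" if "a \<ge> m" "b \<ge> m" for a b
      using dist_triangle_half_l[of "Gn a i j" "Gn m i j" r "Gn b i j"] that by (simp add: dist_norm)
    then show "\<exists>M. \<forall>a\<ge>M. \<forall>b\<ge>M. dist (Gn a i j) (Gn b i j) < r" by blast
  qed
  define G where "G = (\<lambda>i j. lim (\<lambda>n. Gn n i j))"
  have lim: "(\<lambda>n. Gn n i j) \<longlonglongrightarrow> G i j" for i j using conv by (simp add: G_def convergent_LIMSEQ_iff)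
  have z: "G i j = 0" if "i \<notin> I \<or> j \<notin> I" for i j
  proof (rule LIMSEQ_unique[OF lim])
    show "(\<lambda>n. Gn n i j) \<longlonglongrightarrow> 0"
      by (rule tendsto_eventually, rule eventually_sequentiallyI[of n0])
        (use Gn that in \<open>auto simp: is_green_def\<close>)
  qed
  have eq: "schr_op v lam (\<lambda>i. G i j) i = (if i = j then 1 else 0)" if "i \<in> I" "j \<in> I" for i j
  proof (rule LIMSEQ_unique)
    show "(\<lambda>n. schr_op v lam (\<lambda>i. Gn n i j) i) \<longlonglongrightarrow> schr_op v lam (\<lambda>i. G i j) i"
      unfolding schr_op_def by (intro tendsto_intros lim)
    show "(\<lambda>n. schr_op v lam (\<lambda>i. Gn n i j) i) \<longlonglongrightarrow> (if i = j then 1 else 0)"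
    proof (rule tendsto_eventually, rule eventually_sequentiallyI[of "max n0 (nat (max \<bar>i\<bar> \<bar>j\<bar>))"])
      fix n assume "max n0 (nat (max \<bar>i\<bar> \<bar>j\<bar>)) \<le> n"
      then have "n \<ge> n0" "i \<in> I \<inter> box n" "j \<in> I \<inter> box n" using that by (auto simp: box_def)
      then show "schr_op v lam (\<lambda>i. Gn n i j) i = (if i = j then 1 else 0)"
        using Gn[of n] unfolding is_green_def by blast
    qed
  qed
  have bd: "norm (G i j) \<le> C * exp (-\<epsilon> * \<bar>real_of_int (i - j)\<bar>)" for i j
    by (rule LIMSEQ_le_const2[OF tendsto_norm[OF lim]], rule exI[of _ n0]) (use Gn in \<open>auto simp: is_green_def\<close>)
  show ?thesis
  proof (rule that[of G])
    show "is_green lam v I C \<epsilon> G" using z eq bd by (auto simp: is_green_def)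
    fix n i j assume "n \<ge> n0" "i \<in> box n" "j \<in> box n"
    then show "norm (G i j - Gn n i j) \<le> ?B n i j"
      by (intro LIMSEQ_le_const2[OF tendsto_norm[OF tendsto_diff[OF lim tendsto_const]]])
        (use close in blast)
  qed
qed

text \<open>The constants are fixed before \<open>v\<close>, and this uniformity is what bounds the
  inverses uniformly. For both choices of \<open>I\<close> the sections are intervals of length at
  least \<open>n\<close>.\<close>

lemma green_exists:
  assumes c: "c > 0"
  obtains \<epsilon> C n0 where "\<epsilon> > 0" "C > 0"
    "\<And>v I. \<lbrakk>\<And>a. lower_bound lam c v {a..}; \<And>b. lower_bound lam c v {..b}; I = UNIV \<or> I = {0..}\<rbrakk> \<Longrightarrow>
      \<exists>G Gn. is_green lam v I C \<epsilon> G \<and>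
        (\<forall>n\<ge>n0. is_green lam v (I \<inter> box n) C \<epsilon> (Gn n) \<and> lower_bound lam (c / 2) v (I \<inter> box n)) \<and>
        (\<forall>n\<ge>n0. \<forall>i\<in>box n. \<forall>j\<in>box n. norm (G i j - Gn n i j)
          \<le> 2 * C\<^sup>2 * exp (-\<epsilon> * (real n - \<bar>real_of_int i\<bar>)) * exp (-\<epsilon> * (real n - \<bar>real_of_int j\<bar>)))"
proof -
  \<comment> \<open>The sections only have the bound c/2; this rate meets the requirement of
    \<open>green_decay\<close> for c/2. Likewise \<open>n0\<close> is the length required by
    \<open>lower_bound_interval\<close>, and \<open>C\<close> is 2 divided by c/2.\<close>
  define \<epsilon> where "\<epsilon> = ln (1 + c / 8)"
  have e: "\<epsilon> > 0" "2 * (exp \<epsilon> - 1) \<le> (c / 2) / 2" using c by (auto simp: \<epsilon>_def)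
  define n0 where "n0 = nat \<lceil>8 / c\<rceil>"
  define C where "C = 2 / (c / 2)"
  have C: "C > 0" using c by (simp add: C_def)
  show ?thesis
  proof (rule that[OF e(1) C])
    fix v :: "int \<Rightarrow> real" and I :: "int set"
    assume l: "\<And>a. lower_bound lam c v {a..}" and r: "\<And>b. lower_bound lam c v {..b}"
      and I: "I = UNIV \<or> I = {0..}"
    have ivl: "\<exists>a b. I \<inter> box n = {a..b} \<and> a \<le> b \<and> real_of_int (b - a) \<ge> real n" for n
    proof (cases "I = UNIV")
      case True
      then show ?thesis by (intro exI[of _ "- int n"] exI[of _ "int n"]) (auto simp: box_def)
    next
      case False
      then show ?thesis using I by (intro exI[of _ 0] exI[of _ "int n"]) (auto simp: box_def)
    qed
    have sec: "lower_bound lam (c / 2) v (I \<inter> box n) \<and> (\<exists>G. is_green lam v (I \<inter> box n) C \<epsilon> G)" if "n \<ge> n0" for n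
    proof -
      obtain a b where ab: "I \<inter> box n = {a..b}" "a \<le> b" "real_of_int (b - a) \<ge> real n"
        using ivl by blast
      have "8 / c \<le> real n0" unfolding n0_def by (simp add: real_nat_ceiling_ge)
      then have "real_of_int (b - a) \<ge> 8 / c" using ab that by linarith
      then have "lower_bound lam (c / 2) v {a..b}" by (rule lower_bound_interval[OF l r c])
      moreover from this have "\<exists>G. is_green lam v {a..b} C \<epsilon> G"
        using is_green_interval[of lam "c/2" v a b \<epsilon>] ab e c unfolding C_def by (metis half_gt_zero less_eq_real_def)
      ultimately show ?thesis using ab by simp
    qed
    then obtain Gn where Gn: "\<And>n. n \<ge> n0 \<Longrightarrow> is_green lam v (I \<inter> box n) C \<epsilon> (Gn n)" by metis
    obtain G where "is_green lam v I C \<epsilon> G"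
      "\<And>n i j. \<lbrakk>n \<ge> n0; i \<in> box n; j \<in> box n\<rbrakk> \<Longrightarrow> norm (G i j - Gn n i j)
       \<le> 2 * C\<^sup>2 * exp (-\<epsilon> * (real n - \<bar>real_of_int i\<bar>)) * exp (-\<epsilon> * (real n - \<bar>real_of_int j\<bar>))"
      using is_green_limit[of n0 lam v I C \<epsilon> Gn "c/2"] Gn sec C c e by (metis half_gt_zero less_eq_real_def)
    then show "\<exists>G Gn. is_green lam v I C \<epsilon> G \<and>
        (\<forall>n\<ge>n0. is_green lam v (I \<inter> box n) C \<epsilon> (Gn n) \<and> lower_bound lam (c / 2) v (I \<inter> box n)) \<and>
        (\<forall>n\<ge>n0. \<forall>i\<in>box n. \<forall>j\<in>box n. norm (G i j - Gn n i j)
          \<le> 2 * C\<^sup>2 * exp (-\<epsilon> * (real n - \<bar>real_of_int i\<bar>)) * exp (-\<epsilon> * (real n - \<bar>real_of_int j\<bar>)))"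
      using Gn sec by blast
  qed
qed

section \<open>Lower bounds and invertibility\<close>

lemma cut_lp: "x \<in> lp p I \<Longrightarrow> cut I x = x"
  by (auto simp: cut_def lp_def)

text \<open>The value at \<open>n\<close> is controlled by the largest of three neighbouring
  entries; the factor \<open>exp 1\<close> pays for a distance of at most 1 in
  \<open>lp_exp_dominated\<close>.\<close>

lemma schr_op_lp:
  assumes p: "1 \<le> p" and v: "\<And>n. \<bar>v n\<bar> \<le> 1" and x: "x \<in> lp p UNIV"
  shows "schr_op v lam x \<in> lp p UNIV"
proof -
  obtain K where K: "\<And>C x y. \<lbrakk>C \<ge> 0; x \<in> lp p UNIV; \<And>n. \<exists>m. norm (y n) \<le> C * exp (-1 * \<bar>real_of_int (n - m)\<bar>) * norm (x m)\<rbrakk>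
       \<Longrightarrow> y \<in> lp p UNIV \<and> lpnorm p y \<le> C * K * lpnorm p x"
    using lp_exp_dominated[OF p, of 1] by (metis zero_less_one)
  have "\<exists>m. norm (schr_op v lam x n) \<le> ((2 + \<bar>lam\<bar>) * exp 1) * exp (-1 * \<bar>real_of_int (n - m)\<bar>) * norm (x m)" for n
  proof -
    obtain m where m: "m \<in> {n - 1, n, n + 1}" "norm (x (n + 1)) \<le> norm (x m)" "norm (x (n - 1)) \<le> norm (x m)" "norm (x n) \<le> norm (x m)"
    proof -
      have "\<exists>m\<in>S. \<forall>k\<in>S. norm (x k) \<le> norm (x m)" if "finite S" "S \<noteq> {}" for S
        using arg_min_if_finite[OF that, of "\<lambda>k. - norm (x k)"] by (meson linorder_not_le neg_less_iff_less)
      from this[of "{n - 1, n, n + 1}"] have "\<exists>m\<in>{n - 1, n, n + 1}. \<forall>k\<in>{n - 1, n, n + 1}. norm (x k) \<le> norm (x m)" by simp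
      then show ?thesis using that by auto
    qed
    have "norm (schr_op v lam x n) \<le> norm (x (n + 1)) + norm (x (n - 1)) + norm (complex_of_real (lam * v n) * x n)"
      unfolding schr_op_def by (intro norm_triangle_le add_mono) auto
    also have "norm (complex_of_real (lam * v n) * x n) \<le> \<bar>lam\<bar> * norm (x m)"
    proof -
      have "\<bar>lam\<bar> * \<bar>v n\<bar> * norm (x n) \<le> \<bar>lam\<bar> * 1 * norm (x m)" using v m by (intro mult_mono) auto
      then show ?thesis by (simp add: norm_mult abs_mult)
    qed
    finally have 1: "norm (schr_op v lam x n) \<le> (2 + \<bar>lam\<bar>) * norm (x m)" using m by (simp add: algebra_simps)
    have "1 \<le> exp 1 * exp (-1 * \<bar>real_of_int (n - m)\<bar>)" using m by (auto simp: exp_add[symmetric])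
    then have "(2 + \<bar>lam\<bar>) * norm (x m) * 1 \<le> (2 + \<bar>lam\<bar>) * norm (x m) * (exp 1 * exp (-1 * \<bar>real_of_int (n - m)\<bar>))"
      by (intro mult_left_mono) auto
    then have "norm (schr_op v lam x n) \<le> ((2 + \<bar>lam\<bar>) * exp 1) * exp (-1 * \<bar>real_of_int (n - m)\<bar>) * norm (x m)"
      using 1 by (simp add: ac_simps)
    then show ?thesis by blast
  qed
  then show ?thesis using K[of "(2 + \<bar>lam\<bar>) * exp 1" x "schr_op v lam x"] x by simp
qed

lemma lp_cut: "1 \<le> p \<Longrightarrow> x \<in> lp p UNIV \<Longrightarrow> cut I x \<in> lp p I \<and> lpnorm p (cut I x) \<le> lpnorm p x"
proof (cases rule: lp_exponent_cases[of p], assumption)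
  assume p: "1 \<le> p" and x: "x \<in> lp p UNIV"
  {
    assume inf: "p = \<infinity>"
    have "cut I x \<in> lp \<infinity> I \<and> lpnorm \<infinity> (cut I x) \<le> lpnorm p x"
      by (rule lpI_infinity) (use norm_le_lpnorm[OF p x] lpnorm_nonneg_lp[OF x] in \<open>auto simp: cut_def\<close>)
    then show ?thesis using inf by simp
  next
    fix r assume r: "p = ereal r" "r \<ge> 1"
    have s: "(\<lambda>n. norm (x n) powr r) summable_on UNIV" using x r by (auto simp: lp_def)
    have "(\<Sum>n\<in>F. norm (cut I x n) powr r) \<le> infsum (\<lambda>n. norm (x n) powr r) UNIV" if "finite F" for F
    proof -
      have "(\<Sum>n\<in>F. norm (cut I x n) powr r) \<le> (\<Sum>n\<in>F. norm (x n) powr r)"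
        by (rule sum_mono) (use r in \<open>auto simp: cut_def\<close>)
      also have "\<dots> \<le> infsum (\<lambda>n. norm (x n) powr r) UNIV"
        by (rule finite_sum_le_infsum[OF s that]) auto
      finally show ?thesis .
    qed
    then have "cut I x \<in> lp (ereal r) I \<and> lpnorm (ereal r) (cut I x) \<le> infsum (\<lambda>n. norm (x n) powr r) UNIV powr (1/r)"
      by (intro lpI_finite r) (auto simp: cut_def)
    then show ?thesis using r by (simp add: lpnorm_def)
  }
qed

lemma compress_lp:
  assumes "1 \<le> p" "\<And>n. \<bar>v n\<bar> \<le> 1" "x \<in> lp p I"
  shows "compress I (schr_op v lam) x \<in> lp p I"
  using lp_cut[OF assms(1) schr_op_lp[OF assms(1,2) lp_UNIV[OF assms(3)]]] assms(3)
  by (simp add: compress_def cut_lp)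

lemma compress_apply: "x \<in> lp p I \<Longrightarrow> compress I A x n = (if n \<in> I then A x n else 0)"
  by (simp add: compress_def cut_lp) (simp add: cut_def)

section \<open>Inverses and their norms\<close>

lemma inverse_unique:
  assumes "is_inverse_on p I A B" "is_inverse_on p I A B'" "x \<in> lp p I"
  shows "B x = B' x"
  using assms unfolding is_inverse_on_def by metis

lemma is_inverse_on_inverse_on: "invertible_on p I A \<Longrightarrow> is_inverse_on p I A (inverse_on p I A)"
  using someI_ex[of "is_inverse_on p I A"] by (simp add: invertible_on_def inverse_on_def)

lemma inverse_on_eq: "is_inverse_on p I A B \<Longrightarrow> x \<in> lp p I \<Longrightarrow> inverse_on p I A x = B x"
  using inverse_unique is_inverse_on_inverse_on invertible_on_def by metis

lemma inv_norm_le: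
  assumes "is_inverse_on p I A B" "D \<ge> 0" "\<And>x. x \<in> lp p I \<Longrightarrow> lpnorm p (B x) \<le> D * lpnorm p x"
  shows "inv_norm p I A \<le> ereal D"
proof -
  have inv: "invertible_on p I A" using assms(1) by (auto simp: invertible_on_def)
  have "lpnorm p (inverse_on p I A x) \<le> D" if "x \<in> lp p I" "lpnorm p x \<le> 1" for x
  proof -
    have "lpnorm p (inverse_on p I A x) \<le> D * lpnorm p x"
      using assms(3)[OF that(1)] inverse_on_eq[OF assms(1) that(1)] by simp
    also have "\<dots> \<le> D * 1" using assms(2) that by (intro mult_left_mono) auto
    finally show ?thesis by simp
  qed
  then show ?thesis using inv by (auto simp: inv_norm_def opnorm_def intro!: SUP_least)
qed

lemma compress_scale: "compress I (schr_op v lam) (\<lambda>n. c * x n) = (\<lambda>n. c * compress I (schr_op v lam) x n)"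
proof -
  have "cut I (\<lambda>n. c * x n) = (\<lambda>n. c * cut I x n)" for x by (auto simp: cut_def)
  moreover have "schr_op v lam (\<lambda>n. c * x n) = (\<lambda>n. c * schr_op v lam x n)" for x by (auto simp: schr_op_scale)
  ultimately show ?thesis by (simp add: compress_def)
qed

text \<open>\<open>is_inverse_on\<close> does not state linearity. Homogeneity of the inverse is
  recovered from that of the operator, which is enough to rescale to the unit ball.\<close>

lemma bound_of_inv_norm:
  assumes p: "1 \<le> p" and inv: "invertible_on p I (compress I (schr_op v lam))"
    and D: "inv_norm p I (compress I (schr_op v lam)) \<le> ereal D" and x: "x \<in> lp p I"
  shows "lpnorm p (inverse_on p I (compress I (schr_op v lam)) x) \<le> D * lpnorm p x"
proof -
  let ?A = "compress I (schr_op v lam)"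
  let ?B = "inverse_on p I ?A"
  have B: "is_inverse_on p I ?A ?B" by (rule is_inverse_on_inverse_on[OF inv])
  then have Bx: "?B x \<in> lp p I" "?A (?B x) = x" and BA: "\<And>y. y \<in> lp p I \<Longrightarrow> ?B (?A y) = y"
    using x by (auto simp: is_inverse_on_def)
  show ?thesis
  proof (cases "lpnorm p x = 0")
    \<comment> \<open>Rescaling is impossible here; the unspecified bound inside
      \<open>is_inverse_on\<close> forces the image to have norm 0.\<close>
    case True
    then obtain C where "lpnorm p (?B x) \<le> C * lpnorm p x" using B x unfolding is_inverse_on_def by blast
    then show ?thesis using True by simp
  next
    case False
    then have pos: "lpnorm p x > 0" using lpnorm_nonneg_lp[OF x] by simp
    define c where "c = complex_of_real (1 / lpnorm p x)"
    have nc: "norm c = 1 / lpnorm p x" using pos by (simp add: c_def norm_divide)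
    let ?y = "\<lambda>n. c * x n"
    have y: "?y \<in> lp p I" "lpnorm p ?y \<le> 1"
      using lp_scale[OF p x] lpnorm_scale[OF p x] nc pos by auto
    have "?B ?y = ?B (?A (\<lambda>n. c * ?B x n))" using Bx by (simp add: compress_scale)
    also have "\<dots> = (\<lambda>n. c * ?B x n)" by (rule BA) (rule lp_scale[OF p Bx(1)])
    finally have eq: "?B ?y = (\<lambda>n. c * ?B x n)" .
    have "ereal (lpnorm p (?B ?y)) \<le> opnorm p I ?B" unfolding opnorm_def by (rule SUP_upper) (use y in auto)
    also have "\<dots> \<le> ereal D" using D inv by (simp add: inv_norm_def)
    finally have "lpnorm p (?B ?y) \<le> D" by simp
    then have "lpnorm p (?B x) / lpnorm p x \<le> D" using lpnorm_scale[OF p Bx(1)] nc unfolding eq by simp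
    then show ?thesis using pos by (simp add: field_simps)
  qed
qed

text \<open>A weight decaying away from a maximiser \<open>k\<close> of \<open>x\<close> has a
  finite \<ell>^p norm independent of the support of \<open>x\<close>, and it leaves the value at
  \<open>k\<close> unchanged. The \<ell>^p bound for the weighted sequence thus controls the
  supremum of \<open>x\<close>.\<close>

lemma lower_bound_of_inverse:
  assumes p: "1 \<le> p"
  obtains c where "c > 0" "\<And>v I B. \<lbrakk>I \<noteq> {}; is_inverse_on p I (compress I (schr_op v lam)) B;
     \<And>x. x \<in> lp p I \<Longrightarrow> lpnorm p (B x) \<le> D * lpnorm p x\<rbrakk> \<Longrightarrow> lower_bound lam c v I"
proof -
  define D' where "D' = max 1 D"
  have D': "D' \<ge> 1" "D' \<ge> D" by (auto simp: D'_def)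
  obtain K1 where K1: "K1 > 0" "\<And>C x y. \<lbrakk>C \<ge> 0; x \<in> lp p UNIV; \<And>n. \<exists>m. norm (y n) \<le> C * exp (-1 * \<bar>real_of_int (n - m)\<bar>) * norm (x m)\<rbrakk>
       \<Longrightarrow> y \<in> lp p UNIV \<and> lpnorm p y \<le> C * K1 * lpnorm p x"
    using lp_exp_dominated[OF p, of 1] by (metis zero_less_one)
  \<comment> \<open>\<open>d\<close> makes the commutator contribution
    \<open>6 * D' * d * exp 1 * K1\<close> equal to 1/2, so that it is absorbed. \<open>K1\<close>
    is taken at rate 1, because \<open>\<epsilon>\<close> is only determined by
    \<open>d\<close>.\<close>
  define d where "d = 1 / (12 * D' * K1 * exp 1)"
  have d: "d > 0" using D' K1 by (simp add: d_def)
  define \<epsilon> where "\<epsilon> = ln (1 + d)"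
  have e: "\<epsilon> > 0" "exp \<epsilon> - 1 = d" using d by (auto simp: \<epsilon>_def)
  obtain K where K: "K > 0" "\<And>C x y. \<lbrakk>C \<ge> 0; x \<in> lp p UNIV; \<And>n. \<exists>m. norm (y n) \<le> C * exp (-\<epsilon> * \<bar>real_of_int (n - m)\<bar>) * norm (x m)\<rbrakk>
       \<Longrightarrow> y \<in> lp p UNIV \<and> lpnorm p y \<le> C * K * lpnorm p x"
    using lp_exp_dominated[OF p e(1)] by metis
  define c where "c = 1 / (12 * D' * K)"
  have c: "c > 0" using D' K by (simp add: c_def)
  show ?thesis
  proof (rule that[OF c])
    fix v I B
    assume I: "I \<noteq> {}" and B: "is_inverse_on p I (compress I (schr_op v lam)) B"
      and bd: "\<And>x. x \<in> lp p I \<Longrightarrow> lpnorm p (B x) \<le> D * lpnorm p x"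
    show "lower_bound lam c v I"
    proof (rule lower_boundI)
      fix x M n
      assume x: "finite {n. x n \<noteq> 0}" "\<And>n. n \<notin> I \<Longrightarrow> x n = 0"
        "\<And>n. n \<in> I \<Longrightarrow> norm (schr_op v lam x n) \<le> M"
      show "c * norm (x n) \<le> M"
      proof -
        \<comment> \<open>A site in \<open>I\<close> is needed here: without one nothing constrains
          \<open>M\<close>.\<close>
        have M: "M \<ge> 0" using I x(3) by (auto intro: order_trans[OF norm_ge_zero])
        obtain k where k: "\<And>n. norm (x n) \<le> norm (x k)" using finite_support_argmax[OF x(1)] by metis
        define w where "w = (\<lambda>n. (-1) * (\<epsilon> * \<bar>real_of_int (n - k)\<bar>))"
        have w: "\<bar>w (n + 1) - w n\<bar> \<le> \<epsilon>" for n
          unfolding w_def by (rule abs_weight_lipschitz) (use e in auto)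
        define y where "y = (\<lambda>n. of_real (exp (w n)) * x n)"
        have ny: "norm (y n) = exp (w n) * norm (x n)" for n by (simp add: norm_mult y_def)
        have y: "y \<in> lp p I" by (rule lp_finite_support[OF _ _ p]) (use x in \<open>auto simp: y_def\<close>)
        define z where "z = compress I (schr_op v lam) y"
        \<comment> \<open>\<open>a\<close> is the weighted residual and \<open>b\<close> the
          commutator. The factors 3 arise because a sum of three terms is at most three times its
          largest.\<close>
        define a where "a = (\<lambda>n. complex_of_real (3 * M * exp (w n)))"
        define b where "b = (\<lambda>n. complex_of_real (3 * d * max (norm (y (n + 1))) (norm (y (n - 1)))))"
        have zn: "norm (z n) \<le> norm (a n) \<or> norm (z n) \<le> norm (b n)" for n
        proof (cases "n \<in> I")
          case True
          have nb: "norm (b n) = 3 * d * max (norm (y (n + 1))) (norm (y (n - 1)))"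
            unfolding b_def norm_of_real using d by (simp add: abs_mult) (simp add: max_def)
          have na: "norm (a n) = 3 * M * exp (w n)" unfolding a_def norm_of_real using M by simp
          have "norm (z n) \<le> exp (w n) * norm (schr_op v lam x n)
              + (exp \<epsilon> - 1) * (exp (w (n + 1)) * norm (x (n + 1)))
              + (exp \<epsilon> - 1) * (exp (w (n - 1)) * norm (x (n - 1)))"
            using norm_schr_op_exp_weight[of \<epsilon> w v lam x n] w e True compress_apply[OF y] by (simp add: z_def y_def)
          also have "\<dots> = exp (w n) * norm (schr_op v lam x n) + d * norm (y (n + 1)) + d * norm (y (n - 1))"
            by (simp only: ny e(2))
          also have "\<dots> \<le> exp (w n) * M + d * max (norm (y (n + 1))) (norm (y (n - 1))) + d * max (norm (y (n + 1))) (norm (y (n - 1)))"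
            by (intro add_mono mult_left_mono x(3) True) (use d in auto)
          finally have "norm (z n) \<le> 3 * (exp (w n) * M) \<or> norm (z n) \<le> 3 * (d * max (norm (y (n + 1))) (norm (y (n - 1))))"
            by linarith
          then show ?thesis unfolding na nb by (simp add: ac_simps)
        qed (use compress_apply[OF y] in \<open>auto simp: z_def\<close>)
        have a: "a \<in> lp p UNIV \<and> lpnorm p a \<le> 3 * K * M"
        proof -
          \<comment> \<open>The weighted residual is dominated by a spike at \<open>k\<close>, whose
            norm is \<open>M\<close> for every \<open>p\<close>.\<close>
          have e1: "(\<lambda>n. if n = k then complex_of_real M else 0) \<in> lp p UNIV"
            by (rule lp_finite_support[OF _ _ p]) auto
          have "a \<in> lp p UNIV \<and> lpnorm p a \<le> 3 * K * lpnorm p (\<lambda>n. if n = k then complex_of_real M else 0)"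
          proof (rule K(2)[OF _ e1])
            fix n show "\<exists>m. norm (a n) \<le> 3 * exp (-\<epsilon> * \<bar>real_of_int (n - m)\<bar>) * norm (if m = k then complex_of_real M else 0)"
              unfolding a_def norm_of_real using M by (intro exI[of _ k]) (simp add: w_def)
          qed simp
          then show ?thesis using M by (simp add: lpnorm_indicator[OF p])
        qed
        have b: "b \<in> lp p UNIV \<and> lpnorm p b \<le> 3 * d * exp 1 * K1 * lpnorm p y"
        proof (rule K1(2)[OF _ lp_UNIV[OF y]])
          fix n
          obtain m where m: "m = n + 1 \<or> m = n - 1" "max (norm (y (n + 1))) (norm (y (n - 1))) = norm (y m)"
            by (metis max_def)
          have "exp 1 * exp (-1 * \<bar>real_of_int (n - m)\<bar>) = (1::real)" using m(1) by (auto simp: exp_add[symmetric])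
          then have "norm (b n) \<le> 3 * d * (exp 1 * exp (-1 * \<bar>real_of_int (n - m)\<bar>)) * norm (y m)"
            unfolding b_def m(2) norm_of_real using d by (simp add: abs_mult)
          then show "\<exists>m. norm (b n) \<le> 3 * d * exp 1 * exp (-1 * \<bar>real_of_int (n - m)\<bar>) * norm (y m)"
            by (auto simp: mult.assoc)
        qed (use d in auto)
        have z: "z \<in> lp p UNIV \<and> lpnorm p z \<le> 2 * (lpnorm p a + lpnorm p b)"
          by (rule lp_max_dominated[OF p]) (use a b zn in auto)
        have zI: "z \<in> lp p I" using z compress_apply[OF y] by (subst lp_iff) (auto simp: z_def)
        have "B z = y" using B y by (auto simp: is_inverse_on_def z_def)
        then have "lpnorm p y \<le> D * lpnorm p z" using bd[OF zI] by simp
        also have "\<dots> \<le> D' * (2 * (3 * K * M + 3 * d * exp 1 * K1 * lpnorm p y))"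
        proof (rule order_trans)
          show "D * lpnorm p z \<le> D' * lpnorm p z" using D' lpnorm_nonneg_lp[OF zI] by (intro mult_right_mono) auto
          show "D' * lpnorm p z \<le> D' * (2 * (3 * K * M + 3 * d * exp 1 * K1 * lpnorm p y))"
            using D' z a b by (intro mult_left_mono) auto
        qed
        also have "\<dots> = 6 * D' * K * M + lpnorm p y / 2"
          using D' K1 by (simp add: d_def field_simps)
        finally have "lpnorm p y \<le> 12 * D' * K * M" by simp
        moreover have "norm (x n) \<le> lpnorm p y"
          using k[of n] norm_le_lpnorm[OF p y, of k] by (simp add: ny w_def)
        ultimately show ?thesis using D' K by (simp add: c_def field_simps)
      qed
    qed
  qed
qed

section \<open>Green functions as bounded operators\<close>

definition green_op :: "(int \<Rightarrow> int \<Rightarrow> complex) \<Rightarrow> (int \<Rightarrow> complex) \<Rightarrow> int \<Rightarrow> complex" where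
  "green_op G y = (\<lambda>i. infsum (\<lambda>j. G i j * y j) UNIV)"

lemma green_op_abs_summable:
  fixes G :: "int \<Rightarrow> int \<Rightarrow> complex" and y :: "int \<Rightarrow> complex"
  assumes G: "\<And>j. norm (G i j) \<le> C * exp (-\<epsilon> * \<bar>real_of_int (i - j)\<bar>)" and e: "\<epsilon> > 0"
    and y: "\<And>j. norm (y j) \<le> Y"
  shows "(\<lambda>j. norm (G i j * y j)) summable_on UNIV" "(\<lambda>j. C * exp (-\<epsilon> * \<bar>real_of_int (i - j)\<bar>) * norm (y j)) summable_on UNIV"
proof -
  have C: "C \<ge> 0"
    using order_trans[OF norm_ge_zero G[of i]] by simp
  have "(\<lambda>j. (C * Y) * exp (-\<epsilon> * \<bar>real_of_int (i - j)\<bar>)) summable_on UNIV"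
    by (intro summable_on_cmult_right exp_abs_summable_on e)
  then show s: "(\<lambda>j. C * exp (-\<epsilon> * \<bar>real_of_int (i - j)\<bar>) * norm (y j)) summable_on UNIV"
  proof (rule summable_on_comparison_test)
    fix j
    have "C * exp (-\<epsilon> * \<bar>real_of_int (i - j)\<bar>) * norm (y j) \<le> C * exp (-\<epsilon> * \<bar>real_of_int (i - j)\<bar>) * Y"
      using C y by (intro mult_left_mono) auto
    then show "C * exp (-\<epsilon> * \<bar>real_of_int (i - j)\<bar>) * norm (y j) \<le> (C * Y) * exp (-\<epsilon> * \<bar>real_of_int (i - j)\<bar>)"
      by (simp add: ac_simps)
  qed (use C in auto)
  show "(\<lambda>j. norm (G i j * y j)) summable_on UNIV"
  proof (rule summable_on_comparison_test[OF s])
    show "norm (G i j * y j) \<le> C * exp (-\<epsilon> * \<bar>real_of_int (i - j)\<bar>) * norm (y j)" for j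
      unfolding norm_mult by (rule mult_right_mono[OF G]) simp
  qed auto
qed

lemma norm_green_op:
  assumes G: "\<And>j. norm (G i j) \<le> C * exp (-\<epsilon> * \<bar>real_of_int (i - j)\<bar>)" and e: "\<epsilon> > 0"
    and y: "\<And>j. norm (y j) \<le> Y"
  shows "norm (green_op G y i) \<le> infsum (\<lambda>j. C * exp (-\<epsilon> * \<bar>real_of_int (i - j)\<bar>) * norm (y j)) UNIV"
proof -
  have "norm (green_op G y i) \<le> infsum (\<lambda>j. norm (G i j * y j)) UNIV"
    unfolding green_op_def by (rule norm_infsum_bound) (rule green_op_abs_summable[where G=G and y=y, OF G e y])
  also have "\<dots> \<le> infsum (\<lambda>j. C * exp (-\<epsilon> * \<bar>real_of_int (i - j)\<bar>) * norm (y j)) UNIV"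
    by (rule infsum_mono) (use green_op_abs_summable[where G=G and y=y, OF G e y] G in \<open>auto simp: norm_mult intro!: mult_right_mono simp del: mult_minus_left\<close>)
  finally show ?thesis .
qed

text \<open>One constant serves all kernels of the given decay rate, with \<open>C\<close> entering
  linearly: small kernels are operators of small norm on \<ell>^p.\<close>

definition kernel_const :: "ereal \<Rightarrow> real \<Rightarrow> real \<Rightarrow> bool" where
  "kernel_const p \<epsilon> K \<longleftrightarrow> K > 0 \<and> (\<forall>C G y. C \<ge> 0 \<longrightarrow> y \<in> lp p UNIV \<longrightarrow>
     (\<forall>i j. norm (G i j) \<le> C * exp (-\<epsilon> * \<bar>real_of_int (i - j)\<bar>)) \<longrightarrow>
     green_op G y \<in> lp p UNIV \<and> lpnorm p (green_op G y) \<le> C * K * lpnorm p y)"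

lemma kernel_const_exists:
  assumes p: "1 \<le> p" and e: "\<epsilon> > 0"
  obtains K where "kernel_const p \<epsilon> K"
proof -
  obtain K where K: "K > 0"
    "\<And>C x y. \<lbrakk>C \<ge> 0; x \<in> lp p UNIV;
       \<And>n. norm (y n) \<le> infsum (\<lambda>m. C * exp (-\<epsilon> * \<bar>real_of_int (n - m)\<bar>) * norm (x m)) UNIV\<rbrakk>
       \<Longrightarrow> y \<in> lp p UNIV \<and> lpnorm p y \<le> C * K * lpnorm p x"
    by (rule lp_exp_kernel[OF p e]) (rule that; blast)
  have "green_op G y \<in> lp p UNIV \<and> lpnorm p (green_op G y) \<le> C * K * lpnorm p y"
    if "C \<ge> 0" "y \<in> lp p UNIV" "\<And>i j. norm (G i j) \<le> C * exp (-\<epsilon> * \<bar>real_of_int (i - j)\<bar>)" for C G y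
    by (rule K(2)[OF that(1,2)], rule norm_green_op[OF that(3) e norm_le_lpnorm[OF p that(2)]])
  then show ?thesis using K(1) by (intro that[of K]) (auto simp: kernel_const_def)
qed

lemma kernel_constD:
  "\<lbrakk>kernel_const p \<epsilon> K; C \<ge> 0; y \<in> lp p UNIV; \<And>i j. norm (G i j) \<le> C * exp (-\<epsilon> * \<bar>real_of_int (i - j)\<bar>)\<rbrakk>
   \<Longrightarrow> green_op G y \<in> lp p UNIV \<and> lpnorm p (green_op G y) \<le> C * K * lpnorm p y"
  unfolding kernel_const_def by blast

text \<open>The column equations give a right inverse. It is also a left inverse, since
  \<open>lower_bound_injective\<close> excludes bounded kernel elements and \<ell>^p sequences are
  bounded.\<close>

lemma is_inverse_green:
  assumes p: "1 \<le> p" and v: "\<And>n. \<bar>v n\<bar> \<le> 1" and G: "is_green lam v I C \<epsilon> G" and e: "\<epsilon> > 0" and C: "C \<ge> 0"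
    and K: "kernel_const p \<epsilon> K" and lb: "lower_bound lam c v I" "c > 0"
  shows "is_inverse_on p I (compress I (schr_op v lam)) (green_op G)"
    and "\<And>x. x \<in> lp p I \<Longrightarrow> lpnorm p (green_op G x) \<le> C * K * lpnorm p x"
proof -
  let ?A = "compress I (schr_op v lam)"
  have Gb: "\<And>i j. norm (G i j) \<le> C * exp (-\<epsilon> * \<bar>real_of_int (i - j)\<bar>)"
    and G0: "\<And>i j. i \<notin> I \<or> j \<notin> I \<Longrightarrow> G i j = 0"
    and Ge: "\<And>i j. \<lbrakk>i \<in> I; j \<in> I\<rbrakk> \<Longrightarrow> schr_op v lam (\<lambda>i. G i j) i = (if i = j then 1 else 0)"
    using G unfolding is_green_def by blast+
  have lp: "green_op G x \<in> lp p I \<and> lpnorm p (green_op G x) \<le> C * K * lpnorm p x" if x: "x \<in> lp p I" for x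
  proof -
    have "green_op G x i = 0" if "i \<notin> I" for i using G0 that by (simp add: green_op_def)
    then show ?thesis using kernel_constD[OF K C lp_UNIV[OF x] Gb] lp_iff[of _ p I] by blast
  qed
  then show "\<And>x. x \<in> lp p I \<Longrightarrow> lpnorm p (green_op G x) \<le> C * K * lpnorm p x" by blast
  have AB: "?A (green_op G x) = x" if x: "x \<in> lp p I" for x
  proof
    fix i
    show "?A (green_op G x) i = x i"
    proof (cases "i \<in> I")
      case False
      then show ?thesis using x lp[OF x] compress_apply[of _ p I] by (auto simp: lp_def)
    next
      case True
      obtain X where X: "\<And>n. norm (x n) \<le> X" using lp_bounded[OF p x] by blast
      have s: "(\<lambda>j. G i j * x j) summable_on UNIV" for i
        by (rule abs_summable_summable, rule green_op_abs_summable(1)[where G=G and y=x, OF Gb e X])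
      let ?\<kappa> = "complex_of_real (lam * v i)"
      have "schr_op v lam (green_op G x) i
          = infsum (\<lambda>j. G (i + 1) j * x j + G (i - 1) j * x j + ?\<kappa> * (G i j * x j)) UNIV"
        unfolding schr_op_def green_op_def
        by (simp add: infsum_add infsum_cmult_right s summable_on_add summable_on_cmult_right)
      also have "\<dots> = infsum (\<lambda>j. if j = i then x i else 0) UNIV"
      proof (rule infsum_cong)
        fix j
        show "G (i + 1) j * x j + G (i - 1) j * x j + ?\<kappa> * (G i j * x j) = (if j = i then x i else 0)"
        proof (cases "j \<in> I")
          case False
          then show ?thesis using x True by (auto simp: lp_def)
        next
          case j: True
          have "G (i + 1) j * x j + G (i - 1) j * x j + ?\<kappa> * (G i j * x j) = schr_op v lam (\<lambda>i. G i j) i * x j"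
            by (simp add: schr_op_def algebra_simps)
          then show ?thesis using Ge[OF True j] by auto
        qed
      qed
      also have "\<dots> = infsum (\<lambda>j. if j = i then x i else 0) {i}" by (rule infsum_cong_neutral) auto
      finally show ?thesis using True lp[OF x] compress_apply[of "green_op G x" p I] by simp
    qed
  qed
  have BA: "green_op G (?A x) = x" if x: "x \<in> lp p I" for x
  proof
    fix n
    have Ax: "?A x \<in> lp p I" by (rule compress_lp[OF p v x])
    let ?d = "\<lambda>n. green_op G (?A x) n - x n"
    obtain X where X: "\<And>n. norm (x n) \<le> X" using lp_bounded[OF p x] by blast
    obtain Y where Y: "\<And>n. norm (green_op G (?A x) n) \<le> Y" using lp_bounded[OF p] lp[OF Ax] by blast
    have "?d n = 0"
    proof (rule lower_bound_injective[OF lb, of ?d "Y + X"])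
      show "norm (?d n) \<le> Y + X" for n using norm_triangle_ineq4[of "green_op G (?A x) n" "x n"] X[of n] Y[of n] by linarith
      show "?d n = 0" if "n \<notin> I" for n using that x lp[OF Ax] by (auto simp: lp_def)
      fix n assume n: "n \<in> I"
      have "schr_op v lam (green_op G (?A x)) n = ?A (green_op G (?A x)) n"
        using compress_apply[of "green_op G (?A x)" p I] lp[OF Ax] n by simp
      also have "\<dots> = ?A x n" using AB[OF Ax] by simp
      also have "\<dots> = schr_op v lam x n" using compress_apply[OF x] n by simp
      finally show "schr_op v lam ?d n = 0" by (simp add: schr_op_diff)
    qed
    then show "green_op G (?A x) n = x n" by simp
  qed
  show "is_inverse_on p I ?A (green_op G)"
    unfolding is_inverse_on_def using lp AB BA by blast
qed

lemma half_line_invertible: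
  assumes p: "1 \<le> p" and c: "c > 0"
  obtains D where "D \<ge> 0" "\<And>v. \<lbrakk>\<And>n. \<bar>v n\<bar> \<le> 1; \<And>a. lower_bound lam c v {a..}; \<And>b. lower_bound lam c v {..b}\<rbrakk> \<Longrightarrow>
     invertible_on p {0..} (plus_part (schr_op v lam)) \<and> inv_norm p {0..} (plus_part (schr_op v lam)) \<le> ereal D"
proof -
  obtain \<epsilon> C n0 where e: "\<epsilon> > 0" and C: "C > 0" and ex:
    "\<And>v I. \<lbrakk>\<And>a. lower_bound lam c v {a..}; \<And>b. lower_bound lam c v {..b}; I = UNIV \<or> I = {0..}\<rbrakk> \<Longrightarrow>
      \<exists>G Gn. is_green lam v I C \<epsilon> G \<and>
        (\<forall>n\<ge>n0. is_green lam v (I \<inter> box n) C \<epsilon> (Gn n) \<and> lower_bound lam (c / 2) v (I \<inter> box n)) \<and>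
        (\<forall>n\<ge>n0. \<forall>i\<in>box n. \<forall>j\<in>box n. norm (G i j - Gn n i j)
          \<le> 2 * C\<^sup>2 * exp (-\<epsilon> * (real n - \<bar>real_of_int i\<bar>)) * exp (-\<epsilon> * (real n - \<bar>real_of_int j\<bar>)))"
    using green_exists[OF c, of lam] by blast
  obtain K where K: "kernel_const p \<epsilon> K" using kernel_const_exists[OF p e] by blast
  then have K0: "K > 0" by (simp add: kernel_const_def)
  show ?thesis
  proof (rule that[of "C * K"])
    show "0 \<le> C * K" using C K0 by simp
    fix v assume v: "\<And>n. \<bar>v n\<bar> \<le> 1" "\<And>a. lower_bound lam c v {a..}" "\<And>b. lower_bound lam c v {..b}"
    obtain G where G: "is_green lam v {0..} C \<epsilon> G" using ex[OF v(2,3), of "{0..}"] by blast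
    note inv = is_inverse_green[OF p v(1) G e less_imp_le[OF C] K v(2)[of 0] c]
    show "invertible_on p {0..} (plus_part (schr_op v lam)) \<and> inv_norm p {0..} (plus_part (schr_op v lam)) \<le> ereal (C * K)"
      using inv C K0 inv_norm_le[OF inv(1) _ inv(2)] unfolding plus_part_def invertible_on_def by auto
  qed
qed

text \<open>Combines two decay estimates at half the rate each: one measured off the diagonal, the
  other from the edge of the section.\<close>

lemma min_le_geometric_mean:
  fixes s t :: real
  assumes "X \<le> a * (s * s)" "X \<le> a * (t * t)" "s \<ge> 0" "t \<ge> 0" "a \<ge> 0"
  shows "X \<le> a * s * t"
proof (cases "s \<le> t")
  case True
  then have "s * s \<le> s * t" using assms by (intro mult_left_mono) auto
  then have "a * (s * s) \<le> a * (s * t)" by (rule mult_left_mono) (rule assms)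
  then show ?thesis using assms(1) unfolding mult.assoc by linarith
next
  case False
  then have "t * t \<le> s * t" using assms by (intro mult_right_mono) auto
  then have "a * (t * t) \<le> a * (s * t)" by (rule mult_left_mono) (rule assms)
  then show ?thesis using assms(2) unfolding mult.assoc by linarith
qed

text \<open>The kernel of the difference is small where one index stays in a fixed box, and it
  decays off the diagonal. Half of each estimate makes the corresponding rows and columns small in
  operator norm. This is the convergence for \<open>p = \<infinity>\<close>; for finite
  \<open>p\<close> the tail of \<open>y\<close> is handled by a uniform bound.\<close>

lemma fsm_applicable_of_lower_bounds:
  assumes p: "1 \<le> p" and c: "c > 0" and v: "\<And>n. \<bar>v n\<bar> \<le> 1"
    and l: "\<And>a. lower_bound lam c v {a..}" and r: "\<And>b. lower_bound lam c v {..b}"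
  shows "fsm_applicable p (schr_op v lam)"
proof -
  let ?A = "schr_op v lam"
  obtain \<epsilon> C n0 G Gn where e: "\<epsilon> > 0" and C: "C > 0" and G: "is_green lam v UNIV C \<epsilon> G"
    and Gn: "\<And>n. n \<ge> n0 \<Longrightarrow> is_green lam v (box n) C \<epsilon> (Gn n)"
    and lbn: "\<And>n. n \<ge> n0 \<Longrightarrow> lower_bound lam (c / 2) v (box n)"
    and close: "\<And>n i j. \<lbrakk>n \<ge> n0; i \<in> box n; j \<in> box n\<rbrakk> \<Longrightarrow> norm (G i j - Gn n i j)
          \<le> 2 * C\<^sup>2 * exp (-\<epsilon> * (real n - \<bar>real_of_int i\<bar>)) * exp (-\<epsilon> * (real n - \<bar>real_of_int j\<bar>))"
  proof -
    obtain \<epsilon> C n0 where e: "\<epsilon> > 0" and C: "C > 0" and ex: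
      "\<And>v I. \<lbrakk>\<And>a. lower_bound lam c v {a..}; \<And>b. lower_bound lam c v {..b}; I = UNIV \<or> I = {0..}\<rbrakk> \<Longrightarrow>
      \<exists>G Gn. is_green lam v I C \<epsilon> G \<and>
        (\<forall>n\<ge>n0. is_green lam v (I \<inter> box n) C \<epsilon> (Gn n) \<and> lower_bound lam (c / 2) v (I \<inter> box n)) \<and>
        (\<forall>n\<ge>n0. \<forall>i\<in>box n. \<forall>j\<in>box n. norm (G i j - Gn n i j)
          \<le> 2 * C\<^sup>2 * exp (-\<epsilon> * (real n - \<bar>real_of_int i\<bar>)) * exp (-\<epsilon> * (real n - \<bar>real_of_int j\<bar>)))"
      using green_exists[OF c, of lam] by blast
    obtain G Gn where g: "is_green lam v UNIV C \<epsilon> G"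
        "\<And>n. n \<ge> n0 \<Longrightarrow> is_green lam v (UNIV \<inter> box n) C \<epsilon> (Gn n) \<and> lower_bound lam (c / 2) v (UNIV \<inter> box n)"
        "\<And>n i j. \<lbrakk>n \<ge> n0; i \<in> box n; j \<in> box n\<rbrakk> \<Longrightarrow> norm (G i j - Gn n i j)
          \<le> 2 * C\<^sup>2 * exp (-\<epsilon> * (real n - \<bar>real_of_int i\<bar>)) * exp (-\<epsilon> * (real n - \<bar>real_of_int j\<bar>))"
      using ex[OF l r, of UNIV] by blast
    show ?thesis by (rule that[OF e C g(1), of n0 Gn]) (use g in auto)
  qed
  have e2: "\<epsilon>/2 > 0" using e by simp
  obtain K where K: "kernel_const p \<epsilon> K" using kernel_const_exists[OF p e] by blast
  obtain K2 where K2: "kernel_const p (\<epsilon>/2) K2" using kernel_const_exists[OF p e2] by blast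
  have K20: "K2 > 0" using K2 by (simp add: kernel_const_def)
  have cU: "compress UNIV ?A = ?A" by (auto simp: compress_def cut_def)
  have lbU: "lower_bound lam c v UNIV" by (rule lower_bound_UNIV[OF l])
  have invU: "is_inverse_on p UNIV ?A (green_op G)"
    using is_inverse_green(1)[OF p v G e less_imp_le[OF C] K lbU c] cU by simp
  have invn: "is_inverse_on p (box n) (compress (box n) ?A) (green_op (Gn n))" if "n \<ge> n0" for n
    using is_inverse_green(1)[OF p v Gn[OF that] e less_imp_le[OF C] K lbn[OF that]] c by simp
  define B where "B = (\<lambda>n. inverse_on p (box n) (compress (box n) ?A) \<circ> cut (box n))"
  define D where "D = (\<lambda>n i j. Gn n i j - G i j)"
  \<comment> \<open>The first summand is the constant of the comparison of sections, the second that
    of the triangle inequality; their sum serves for both.\<close>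
  define a where "a = 2 * C\<^sup>2 + 2 * C"
  have a: "a \<ge> 0" using C by (simp add: a_def)
  have Gb: "norm (G i j) \<le> C * exp (-\<epsilon> * \<bar>real_of_int (i - j)\<bar>)" for i j using G unfolding is_green_def by blast
  have Gnb: "norm (Gn n i j) \<le> C * exp (-\<epsilon> * \<bar>real_of_int (i - j)\<bar>)" if "n \<ge> n0" for n i j
    using Gn[OF that] unfolding is_green_def by blast
  define t where "t = (\<lambda>i j. exp (-(\<epsilon>/2) * \<bar>real_of_int (i - j)\<bar>))"
  have tt: "exp (-\<epsilon> * \<bar>real_of_int (i - j)\<bar>) = t i j * t i j" for i j by (simp add: t_def exp_add[symmetric])
  have t: "0 \<le> t i j" "t i j \<le> 1" for i j using e by (auto simp: t_def)
  have D1: "norm (D n i j) \<le> a * (t i j * t i j)" if "n \<ge> n0" for n i j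
  proof -
    have "norm (D n i j) \<le> 2 * C * (t i j * t i j)"
      using norm_triangle_ineq4[of "Gn n i j" "G i j"] Gb[of i j] Gnb[OF that, of i j] unfolding D_def tt by linarith
    also have "\<dots> \<le> a * (t i j * t i j)" using t by (intro mult_right_mono) (auto simp: a_def)
    finally show ?thesis .
  qed
  have D1': "norm (D n i j) \<le> a * t i j" if "n \<ge> n0" for n i j
  proof -
    have "a * (t i j * t i j) \<le> a * (t i j * 1)" using a t by (intro mult_left_mono) auto
    then show ?thesis using D1[OF that, of i j] by simp
  qed
  define s where "s = (\<lambda>k n. exp (-(\<epsilon>/2) * (real n - real k)))"
  have ss: "exp (-\<epsilon> * (real n - real k)) = s k n * s k n" for k n :: nat by (simp add: s_def exp_add[symmetric])
  have s0: "s k n \<ge> 0" for k n by (simp add: s_def)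
  have D2: "norm (D n i j) \<le> (a * s k n) * t i j" if n: "n \<ge> n0" "n \<ge> k" and ij: "i \<in> box k \<or> j \<in> box k" for n k i j
  proof (rule min_le_geometric_mean[OF _ D1[OF n(1)] s0 t(1) a])
    have ex: "exp (-\<epsilon> * x) \<le> exp (-\<epsilon> * y)" if "y \<le> x" for x y :: real using that e by (simp add: mult_left_mono)
    show "norm (D n i j) \<le> a * (s k n * s k n)"
    proof (cases "i \<in> box n \<and> j \<in> box n")
      case True
      have "norm (D n i j) \<le> 2 * C\<^sup>2 * (exp (-\<epsilon> * (real n - \<bar>real_of_int i\<bar>)) * exp (-\<epsilon> * (real n - \<bar>real_of_int j\<bar>)))"
        using close[OF n(1)] True by (simp add: D_def norm_minus_commute mult.assoc)
      also have "\<dots> = 2 * C\<^sup>2 * exp (-\<epsilon> * ((real n - \<bar>real_of_int i\<bar>) + (real n - \<bar>real_of_int j\<bar>)))"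
        by (simp add: exp_add[symmetric] algebra_simps)
      also have "\<dots> \<le> 2 * C\<^sup>2 * exp (-\<epsilon> * (real n - real k))"
        by (intro mult_left_mono ex) (use True ij in \<open>auto simp: box_def\<close>)
      also have "\<dots> \<le> a * (s k n * s k n)" unfolding ss using s0 C by (intro mult_right_mono) (auto simp: a_def)
      finally show ?thesis .
    next
      case False
      \<comment> \<open>One index lies in \<open>box k\<close> and the other outside
        \<open>box n\<close>, so the off-diagonal decay alone suffices.\<close>
      then have "\<bar>real_of_int (i - j)\<bar> \<ge> real n - real k" using ij n by (auto simp: box_def)
      then have "t i j * t i j \<le> s k n * s k n" unfolding tt[symmetric] ss[symmetric] by (rule ex)
      then show ?thesis using D1[OF n(1), of i j] mult_left_mono[OF _ a, of "t i j * t i j" "s k n * s k n"] by linarith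
    qed
  qed
  have diff: "B n y - inverse_on p UNIV ?A y = green_op (D n) y" if n: "n \<ge> n0" and y: "y \<in> lp p UNIV" for n y
  proof
    fix i
    obtain Y where Y: "\<And>n. norm (y n) \<le> Y" using lp_bounded[OF p y] by blast
    have cy: "cut (box n) y \<in> lp p (box n)" using lp_cut[OF p y] by blast
    \<comment> \<open>Vanishing columns outside the section make the cut of \<open>y\<close>
      invisible, so both inverses act on the same sequence.\<close>
    have z: "Gn n i j = 0" if "j \<notin> box n" for j using Gn[OF n] that unfolding is_green_def by blast
    have "(\<lambda>j. Gn n i j * cut (box n) y j) = (\<lambda>j. Gn n i j * y j)" using z by (auto simp: cut_def)
    then have "B n y i = infsum (\<lambda>j. Gn n i j * y j) UNIV"
      using inverse_on_eq[OF invn[OF n] cy] by (simp add: B_def green_op_def)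
    moreover have "inverse_on p UNIV ?A y i = infsum (\<lambda>j. G i j * y j) UNIV"
      using inverse_on_eq[OF invU y] by (simp add: green_op_def)
    moreover have "(\<lambda>j. Gn n i j * y j) summable_on UNIV" "(\<lambda>j. G i j * y j) summable_on UNIV"
      using abs_summable_summable[OF green_op_abs_summable(1)[where G="Gn n" and y=y, OF Gnb[OF n] e Y]]
        abs_summable_summable[OF green_op_abs_summable(1)[where G=G and y=y, OF Gb e Y]] by auto
    moreover have "infsum (\<lambda>j. Gn n i j * y j - G i j * y j) UNIV
        = infsum (\<lambda>j. Gn n i j * y j) UNIV - infsum (\<lambda>j. G i j * y j) UNIV"
      using calculation(3,4) infsum_add[of "\<lambda>j. Gn n i j * y j" UNIV "\<lambda>j. - (G i j * y j)"]
      by (simp add: infsum_uminus summable_on_uminus)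
    ultimately show "(B n y - inverse_on p UNIV ?A y) i = green_op (D n) y i"
      by (simp add: green_op_def D_def left_diff_distrib)
  qed
  have slim: "(\<lambda>n. M * s k n) \<longlonglongrightarrow> 0" for M k
  proof -
    have "(\<lambda>n. M * (exp (\<epsilon>/2 * real k) * exp (-(\<epsilon>/2)) ^ n)) \<longlonglongrightarrow> M * (exp (\<epsilon>/2 * real k) * 0)"
      by (intro tendsto_intros LIMSEQ_realpow_zero) (use e in auto)
    moreover have "s k n = exp (\<epsilon>/2 * real k) * exp (-(\<epsilon>/2)) ^ n" for n
      unfolding s_def exp_of_nat_mult[symmetric] exp_add[symmetric] by (simp add: field_simps)
    ultimately show ?thesis by simp
  qed
  have rowb: "cut (box k) (green_op (D n) y) \<in> lp p UNIV \<and> lpnorm p (cut (box k) (green_op (D n) y)) \<le> (a * s k n) * K2 * lpnorm p y"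
    if n: "n \<ge> n0" "n \<ge> k" and y: "y \<in> lp p UNIV" for n k y
  proof -
    let ?D = "\<lambda>i j. if i \<in> box k then D n i j else 0"
    have "green_op ?D y \<in> lp p UNIV \<and> lpnorm p (green_op ?D y) \<le> (a * s k n) * K2 * lpnorm p y"
      by (rule kernel_constD[OF K2 _ y]) (use D2[OF n, of _ _] a s0 in \<open>auto simp: t_def\<close>)
    moreover have "green_op ?D y = cut (box k) (green_op (D n) y)" by (auto simp: green_op_def cut_def)
    ultimately show ?thesis by simp
  qed
  have colb: "green_op (D n) (cut (box k) y) \<in> lp p UNIV \<and> lpnorm p (green_op (D n) (cut (box k) y)) \<le> (a * s k n) * K2 * lpnorm p y"
    if n: "n \<ge> n0" "n \<ge> k" and y: "y \<in> lp p UNIV" for n k y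
  proof -
    let ?D = "\<lambda>i j. if j \<in> box k then D n i j else 0"
    have "green_op ?D y \<in> lp p UNIV \<and> lpnorm p (green_op ?D y) \<le> (a * s k n) * K2 * lpnorm p y"
      by (rule kernel_constD[OF K2 _ y]) (use D2[OF n, of _ _] a s0 in \<open>auto simp: t_def\<close>)
    moreover have "(if j \<in> box k then D n i j else 0) * y j = D n i j * cut (box k) y j" for i j by (simp add: cut_def)
    then have "green_op ?D y = green_op (D n) (cut (box k) y)" by (simp add: green_op_def)
    ultimately show ?thesis by simp
  qed
  have genb: "green_op (D n) y \<in> lp p UNIV \<and> lpnorm p (green_op (D n) y) \<le> a * K2 * lpnorm p y"
    if "n \<ge> n0" "y \<in> lp p UNIV" for n y
    by (rule kernel_constD[OF K2 a that(2)]) (use D1'[OF that(1)] in \<open>simp add: t_def\<close>)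
  have op0: "(\<lambda>n. opnorm p UNIV (T n)) \<longlonglongrightarrow> 0"
    if T: "\<And>n y. \<lbrakk>n \<ge> n0; n \<ge> k; y \<in> lp p UNIV\<rbrakk> \<Longrightarrow> T n y \<in> lp p UNIV \<and> lpnorm p (T n y) \<le> (a * s k n) * K2 * lpnorm p y" for T k
  proof (rule tendsto_sandwich[of "\<lambda>_. 0" _ _ "\<lambda>n. ereal (a * K2 * s k n)"])
    have "(\<lambda>n. ereal (a * K2 * s k n)) \<longlonglongrightarrow> ereal 0" using slim[of "a * K2" k] by (intro tendsto_intros)
    then show "(\<lambda>n. ereal (a * K2 * s k n)) \<longlonglongrightarrow> 0" by (simp add: zero_ereal_def)
    show "\<forall>\<^sub>F n in sequentially. opnorm p UNIV (T n) \<le> ereal (a * K2 * s k n)"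
    proof (rule eventually_sequentiallyI[of "max n0 k"])
      fix n assume n: "max n0 k \<le> n"
      have "lpnorm p (T n y) \<le> a * K2 * s k n" if "y \<in> lp p UNIV" "lpnorm p y \<le> 1" for y
      proof -
        have "lpnorm p (T n y) \<le> (a * s k n) * K2 * lpnorm p y" using T n that by auto
        also have "\<dots> \<le> (a * s k n) * K2 * 1" using that a s0 K20 by (intro mult_left_mono) auto
        finally show ?thesis by (simp add: ac_simps)
      qed
      then show "opnorm p UNIV (T n) \<le> ereal (a * K2 * s k n)"
        unfolding opnorm_def by (intro SUP_least) auto
    qed
    show "\<forall>\<^sub>F n in sequentially. 0 \<le> opnorm p UNIV (T n)"
    proof (rule eventually_sequentiallyI[of "max n0 k"])
      fix n assume n: "max n0 k \<le> n"
      have z: "(\<lambda>_. 0) \<in> lp p UNIV" by (rule lp_finite_support[OF _ _ p]) auto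
      have "lpnorm p (\<lambda>_. 0) = 0" using lpnorm_scale[OF p z, of 0] by simp
      then have "ereal (lpnorm p (T n (\<lambda>_. 0))) \<le> opnorm p UNIV (T n)"
        unfolding opnorm_def using z by (intro SUP_upper) auto
      moreover have "0 \<le> lpnorm p (T n (\<lambda>_. 0))" using T[of n "\<lambda>_. 0"] n z lpnorm_nonneg_lp by auto
      ultimately show "0 \<le> opnorm p UNIV (T n)" by (metis order_trans ereal_less_eq(5))
    qed
  qed auto
  show ?thesis
    unfolding fsm_applicable_def Let_def B_def[symmetric]
  proof (intro conjI)
    show "invertible_on p UNIV ?A" using invU by (auto simp: invertible_on_def)
    show "\<exists>n0. \<forall>n\<ge>n0. invertible_on p (box n) (compress (box n) ?A)"
      using invn unfolding invertible_on_def by blast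
    show "if p = \<infinity> then
           (\<forall>k. (\<lambda>n. opnorm p UNIV (\<lambda>y. cut (box k) (B n y - inverse_on p UNIV ?A y))) \<longlonglongrightarrow> 0 \<and>
                (\<lambda>n. opnorm p UNIV (\<lambda>y. B n (cut (box k) y) - inverse_on p UNIV ?A (cut (box k) y))) \<longlonglongrightarrow> 0)
         else (\<forall>y \<in> lp p UNIV. (\<lambda>n. lpnorm p (B n y - inverse_on p UNIV ?A y)) \<longlonglongrightarrow> 0)"
    proof (cases "p = \<infinity>")
      case True
      have "(\<lambda>n. opnorm p UNIV (\<lambda>y. cut (box k) (B n y - inverse_on p UNIV ?A y))) \<longlonglongrightarrow> 0" for k
        by (rule op0[of k]) (use rowb diff in auto)
      moreover have "(\<lambda>n. opnorm p UNIV (\<lambda>y. B n (cut (box k) y) - inverse_on p UNIV ?A (cut (box k) y))) \<longlonglongrightarrow> 0" for k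
      proof (rule op0[of k])
        fix n y assume n: "n0 \<le> n" "k \<le> n" and y: "y \<in> lp p UNIV"
        have "cut (box k) y \<in> lp p UNIV" using lp_cut[OF p y] lp_UNIV by blast
        then show "B n (cut (box k) y) - inverse_on p UNIV ?A (cut (box k) y) \<in> lp p UNIV \<and>
            lpnorm p (B n (cut (box k) y) - inverse_on p UNIV ?A (cut (box k) y)) \<le> (a * s k n) * K2 * lpnorm p y"
          using colb[OF n y] diff[OF n(1)] by simp
      qed
      ultimately show ?thesis using True by auto
    next
      case False
      have "(\<lambda>n. lpnorm p (B n y - inverse_on p UNIV ?A y)) \<longlonglongrightarrow> 0" if y: "y \<in> lp p UNIV" for y
      proof (rule LIMSEQ_I)
        fix \<rho> :: real assume \<rho>: "\<rho> > 0"
        \<comment> \<open>With this choice the tail contributes at most \<rho>/8; the truncated part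
          gets less than \<rho>/8 for large \<open>n\<close>. The + 1 keeps the denominator
          positive.\<close>
        define q where "q = \<rho> / (8 * (a * K2 + 1))"
        have aK: "a * K2 \<ge> 0" using a K20 by simp
        have q: "q > 0" using \<rho> aK by (simp add: q_def)
        obtain k where k: "lpnorm p (\<lambda>n. y n - cut (box k) y n) < q" "(\<lambda>n. y n - cut (box k) y n) \<in> lp p UNIV"
          using lp_tail_small[OF p False y q] by blast
        let ?y2 = "\<lambda>n. y n - cut (box k) y n"
        have "\<forall>\<^sub>F n in sequentially. (a * K2 * lpnorm p y) * s k n < \<rho> / 8"
          using order_tendstoD(2)[OF slim[of "a * K2 * lpnorm p y" k], of "\<rho> / 8"] \<rho> by simp
        then obtain n1 where n1: "\<And>n. n \<ge> n1 \<Longrightarrow> (a * K2 * lpnorm p y) * s k n < \<rho> / 8"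
          unfolding eventually_sequentially by blast
        have "norm (lpnorm p (B n y - inverse_on p UNIV ?A y) - 0) < \<rho>" if n: "n \<ge> max n1 (max n0 k)" for n
        proof -
          have n': "n \<ge> n0" "n \<ge> k" using n by auto
          let ?u = "green_op (D n) (cut (box k) y)" and ?w = "green_op (D n) ?y2"
          have u: "?u \<in> lp p UNIV" "lpnorm p ?u \<le> (a * s k n) * K2 * lpnorm p y" using colb[OF n' y] by auto
          have w: "?w \<in> lp p UNIV" "lpnorm p ?w \<le> a * K2 * lpnorm p ?y2" using genb[OF n'(1) k(2)] by auto
          obtain Y where Y: "\<And>n. norm (y n) \<le> Y" using lp_bounded[OF p y] by blast
          have Y1: "norm (cut (box k) y j) \<le> Y" "norm (?y2 j) \<le> Y" for j
            using Y[of j] order_trans[OF norm_ge_zero Y] by (auto simp: cut_def)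
          have Db: "norm (D n i j) \<le> a * exp (-(\<epsilon>/2) * \<bar>real_of_int (i - j)\<bar>)" for i j
            using D1'[OF n'(1)] by (simp add: t_def)
          have split: "green_op (D n) y i = ?u i + ?w i" for i
          proof -
            have "(\<lambda>j. D n i j * cut (box k) y j) summable_on UNIV" "(\<lambda>j. D n i j * ?y2 j) summable_on UNIV"
              using abs_summable_summable[OF green_op_abs_summable(1)[where G="D n" and y="cut (box k) y", OF Db e2 Y1(1)]]
                abs_summable_summable[OF green_op_abs_summable(1)[where G="D n" and y="?y2", OF Db e2 Y1(2)]] by auto
            then show ?thesis by (simp add: green_op_def infsum_add[symmetric] algebra_simps)
          qed
          \<comment> \<open>A sum is at most twice its larger term, hence the doubled sequences;
            with the constant 2 of \<open>lp_max_dominated\<close> this gives the factor 4.\<close>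
          have "green_op (D n) y \<in> lp p UNIV \<and> lpnorm p (green_op (D n) y) \<le> 2 * (lpnorm p (\<lambda>n. 2 * ?u n) + lpnorm p (\<lambda>n. 2 * ?w n))"
          proof (rule lp_max_dominated[OF p lp_scale[OF p u(1)] lp_scale[OF p w(1)]])
            fix i
            show "norm (green_op (D n) y i) \<le> norm (2 * ?u i) \<or> norm (green_op (D n) y i) \<le> norm (2 * ?w i)"
              unfolding split norm_mult using norm_triangle_ineq[of "?u i" "?w i"] by (simp add: linorder_le_cases) linarith
          qed
          also have "2 * (lpnorm p (\<lambda>n. 2 * ?u n) + lpnorm p (\<lambda>n. 2 * ?w n)) = 4 * lpnorm p ?u + 4 * lpnorm p ?w"
            using lpnorm_scale[OF p u(1), of 2] lpnorm_scale[OF p w(1), of 2] by simp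
          finally have "lpnorm p (green_op (D n) y) \<le> 4 * lpnorm p ?u + 4 * lpnorm p ?w" and g: "green_op (D n) y \<in> lp p UNIV" by auto
          moreover have "lpnorm p ?u < \<rho> / 8" using u(2) n1[of n] n by (simp add: ac_simps)
          moreover have "lpnorm p ?w \<le> \<rho> / 8"
          proof -
            have "a * K2 * lpnorm p ?y2 \<le> (a * K2 + 1) * q" using k aK lpnorm_nonneg_lp[OF k(2)] by (intro mult_mono) auto
            also have "\<dots> = \<rho> / 8" using aK by (simp add: q_def field_simps)
            finally show ?thesis using w(2) by linarith
          qed
          ultimately have "lpnorm p (green_op (D n) y) < \<rho>" by linarith
          then show ?thesis using diff[OF n'(1) y] lpnorm_nonneg_lp[OF g] by simp
        qed
        then show "\<exists>no. \<forall>n\<ge>no. norm (lpnorm p (B n y - inverse_on p UNIV ?A y) - 0) < \<rho>" by blast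
      qed
      then show ?thesis using False by auto
    qed
  qed
qed

section \<open>Sequences coded by rotations\<close>

text \<open>The sequences coded by a rotation by \<open>\<beta>\<close>, in a form that does not mention the phase: the
  inequality says that some phase \<open>\<psi>\<close> fits \<open>N j \<approx> \<lfloor>j \<beta> + \<psi>\<rfloor>\<close> on every finite set of indices.\<close>
definition sturm :: "real \<Rightarrow> (int \<Rightarrow> real) \<Rightarrow> bool" where
  "sturm \<beta> v \<longleftrightarrow> (\<exists>N::int \<Rightarrow> int. (\<forall>j. v j = real_of_int (N (j + 1) - N j)) \<and>
     (\<forall>i j. real_of_int (N i - N j - 1) < real_of_int (i - j) * \<beta>))"

text \<open>Adding \<beta> carries the fractional part past 1 exactly when it lies in the arc of
  length \<beta> below 1: \<open>vpot\<close> is a lower mechanical word.\<close>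

lemma vpot_floor:
  assumes "0 \<le> \<beta>" "\<beta> \<le> 1"
  shows "vpot \<beta> \<psi> n = real_of_int (\<lfloor>real_of_int (n + 1) * \<beta> + \<psi>\<rfloor> - \<lfloor>real_of_int n * \<beta> + \<psi>\<rfloor>)"
proof -
  define x where "x = real_of_int n * \<beta> + \<psi>"
  have eq: "real_of_int (n + 1) * \<beta> + \<psi> = x + \<beta>" by (simp add: x_def algebra_simps)
  have f: "frac x = x - of_int \<lfloor>x\<rfloor>" "frac x < 1" using frac_lt_1[of x] by (simp_all only: frac_def)
  show ?thesis
  proof (cases "1 - \<beta> \<le> frac x")
    case True
    then have "\<lfloor>x + \<beta>\<rfloor> = \<lfloor>x\<rfloor> + 1" using assms f by (intro floor_unique) auto
    then show ?thesis using True f(2) unfolding eq x_def[symmetric] by (simp add: vpot_def x_def)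
  next
    case False
    then have "\<lfloor>x + \<beta>\<rfloor> = \<lfloor>x\<rfloor>" using assms f of_int_floor_le[of x] by (intro floor_unique) linarith+
    then show ?thesis using False unfolding eq x_def[symmetric] by (simp add: vpot_def x_def)
  qed
qed

text \<open>The upper mechanical word: at an integer the ceiling jumps at once, which accounts for
  the point 0 of the arc. For \<beta> = 0 that point would yield a 1 without any jump.\<close>

lemma vpot_tilde_ceiling:
  assumes "0 < \<beta>" "\<beta> \<le> 1"
  shows "vpot_tilde \<beta> \<psi> n = real_of_int (\<lceil>real_of_int (n + 1) * \<beta> + \<psi>\<rceil> - \<lceil>real_of_int n * \<beta> + \<psi>\<rceil>)"
proof -
  define x where "x = real_of_int n * \<beta> + \<psi>"
  have eq: "real_of_int (n + 1) * \<beta> + \<psi> = x + \<beta>" by (simp add: x_def algebra_simps)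
  have f: "frac x = x - of_int \<lfloor>x\<rfloor>" "frac x < 1" "frac x \<ge> 0"
    using frac_lt_1[of x] frac_ge_0[of x] by (simp_all only: frac_def)
  have v: "vpot_tilde \<beta> \<psi> n = indicator ({1 - \<beta> <.. 1} \<union> {0}) (frac x)" by (simp add: vpot_tilde_def x_def)
  consider "frac x = 0" | "frac x > 0" "1 - \<beta> < frac x" | "frac x > 0" "1 - \<beta> \<ge> frac x" using f by linarith
  then show ?thesis unfolding eq x_def[symmetric] v
  proof cases
    case 1
    then have "\<lceil>x\<rceil> = \<lfloor>x\<rfloor>" "\<lceil>x + \<beta>\<rceil> = \<lfloor>x\<rfloor> + 1" using assms f by (intro ceiling_unique; simp)+
    then show "indicator ({1 - \<beta> <.. 1} \<union> {0}) (frac x) = real_of_int (\<lceil>x + \<beta>\<rceil> - \<lceil>x\<rceil>)" using 1 by simp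
  next
    case 2
    then have "\<lceil>x\<rceil> = \<lfloor>x\<rfloor> + 1" "\<lceil>x + \<beta>\<rceil> = \<lfloor>x\<rfloor> + 2" using assms f by (intro ceiling_unique; simp)+
    then show "indicator ({1 - \<beta> <.. 1} \<union> {0}) (frac x) = real_of_int (\<lceil>x + \<beta>\<rceil> - \<lceil>x\<rceil>)" using 2 f by simp
  next
    case 3
    then have "\<lceil>x\<rceil> = \<lfloor>x\<rfloor> + 1" "\<lceil>x + \<beta>\<rceil> = \<lfloor>x\<rfloor> + 1" using assms f by (intro ceiling_unique; simp)+
    then show "indicator ({1 - \<beta> <.. 1} \<union> {0}) (frac x) = real_of_int (\<lceil>x + \<beta>\<rceil> - \<lceil>x\<rceil>)" using 3 by simp
  qed
qed

lemma sturm_vpot: "0 \<le> \<beta> \<Longrightarrow> \<beta> \<le> 1 \<Longrightarrow> sturm \<beta> (vpot \<beta> \<psi>)"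
  unfolding sturm_def
proof (intro exI[of _ "\<lambda>j. \<lfloor>real_of_int j * \<beta> + \<psi>\<rfloor>"] conjI allI)
  fix i j :: int
  show "real_of_int (\<lfloor>real_of_int i * \<beta> + \<psi>\<rfloor> - \<lfloor>real_of_int j * \<beta> + \<psi>\<rfloor> - 1) < real_of_int (i - j) * \<beta>"
    using of_int_floor_le[of "real_of_int i * \<beta> + \<psi>"] floor_correct[of "real_of_int j * \<beta> + \<psi>"]
    by (simp add: left_diff_distrib) linarith
qed (simp add: vpot_floor)

lemma sturm_vpot_tilde: "0 < \<beta> \<Longrightarrow> \<beta> \<le> 1 \<Longrightarrow> sturm \<beta> (vpot_tilde \<beta> \<psi>)"
  unfolding sturm_def
proof (intro exI[of _ "\<lambda>j. \<lceil>real_of_int j * \<beta> + \<psi>\<rceil>"] conjI allI)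
  fix i j :: int
  show "real_of_int (\<lceil>real_of_int i * \<beta> + \<psi>\<rceil> - \<lceil>real_of_int j * \<beta> + \<psi>\<rceil> - 1) < real_of_int (i - j) * \<beta>"
    using ceiling_correct[of "real_of_int i * \<beta> + \<psi>"] ceiling_correct[of "real_of_int j * \<beta> + \<psi>"]
    by (simp add: left_diff_distrib) linarith
qed (simp add: vpot_tilde_ceiling)

lemma sturm_shift: "sturm \<beta> v \<Longrightarrow> sturm \<beta> (\<lambda>n. v (n + s))"
proof -
  assume "sturm \<beta> v"
  then obtain N where N: "\<And>j. v j = real_of_int (N (j + 1) - N j)" "\<And>i j. real_of_int (N i - N j - 1) < real_of_int (i - j) * \<beta>"
    unfolding sturm_def by blast
  show ?thesis unfolding sturm_def
  proof (intro exI[of _ "\<lambda>j. N (j + s)"] conjI allI)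
    show "v (j + s) = real_of_int (N (j + 1 + s) - N (j + s))" for j using N(1)[of "j + s"] by (simp add: ac_simps)
    show "real_of_int (N (i + s) - N (j + s) - 1) < real_of_int (i - j) * \<beta>" for i j using N(2)[of "i + s" "j + s"] by simp
  qed
qed

lemma sturm_reflect: "sturm \<beta> v \<Longrightarrow> sturm \<beta> (\<lambda>n. v (- n))"
proof -
  assume "sturm \<beta> v"
  then obtain N where N: "\<And>j. v j = real_of_int (N (j + 1) - N j)" "\<And>i j. real_of_int (N i - N j - 1) < real_of_int (i - j) * \<beta>"
    unfolding sturm_def by blast
  show ?thesis unfolding sturm_def
  \<comment> \<open>\<open>v (- j)\<close> is the increment of \<open>N\<close> from -j to 1 - j,
    hence the reflection about 1/2.\<close>
  proof (intro exI[of _ "\<lambda>j. - N (1 - j)"] conjI allI)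
    show "v (- j) = real_of_int (- N (1 - (j + 1)) - - N (1 - j))" for j using N(1)[of "- j"] by (simp add: ac_simps)
    show "real_of_int (- N (1 - i) - - N (1 - j) - 1) < real_of_int (i - j) * \<beta>" for i j using N(2)[of "1 - j" "1 - i"] by simp
  qed
qed

lemma sturm_bounded:
  assumes "sturm \<beta> v" "0 \<le> \<beta>" "\<beta> \<le> 1"
  shows "\<bar>v n\<bar> \<le> 1"
proof -
  obtain N where N: "\<And>j. v j = real_of_int (N (j + 1) - N j)" "\<And>i j. real_of_int (N i - N j - 1) < real_of_int (i - j) * \<beta>"
    using assms unfolding sturm_def by blast
  have "N (n + 1) - N n \<le> 1" "N (n + 1) - N n \<ge> 0" using N(2)[of "n + 1" n] N(2)[of n "n + 1"] assms by auto
  then show ?thesis by (simp add: N(1))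
qed

section \<open>Phases, words and their occurrences\<close>

lemma vpot_shift: "vpot \<beta> \<psi> (j + k) = vpot \<beta> (\<psi> + of_int k * \<beta>) j"
  by (simp add: vpot_def algebra_simps)

lemma vpot_tilde_shift: "vpot_tilde \<beta> \<psi> (j + k) = vpot_tilde \<beta> (\<psi> + of_int k * \<beta>) j"
  by (simp add: vpot_tilde_def algebra_simps)

lemma frac_add_of_int: "frac (x + of_int r) = frac (x::real)"
  by (simp add: frac_def)

lemma vpot_add_of_int: "vpot \<beta> (\<psi> + of_int r) = vpot \<beta> \<psi>"
  using frac_add_of_int by (auto simp: vpot_def fun_eq_iff add.assoc[symmetric])

lemma vpot_tilde_add_of_int: "vpot_tilde \<beta> (\<psi> + of_int r) = vpot_tilde \<beta> \<psi>"
  using frac_add_of_int by (auto simp: vpot_tilde_def fun_eq_iff add.assoc[symmetric])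

lemma vpot_frac: "vpot \<beta> (frac \<psi>) = vpot \<beta> \<psi>"
  using vpot_add_of_int[of \<beta> \<psi> "- \<lfloor>\<psi>\<rfloor>"] by (simp add: frac_def)

lemma vpot_tilde_frac: "vpot_tilde \<beta> (frac \<psi>) = vpot_tilde \<beta> \<psi>"
  using vpot_tilde_add_of_int[of \<beta> \<psi> "- \<lfloor>\<psi>\<rfloor>"] by (simp add: frac_def)

text \<open>Each index confines the phase to a half-open interval of length 1, and pairwise
  compatibility makes the intersection nonempty. The indices of its two ends are returned because
  its length will be estimated by diophantine approximation at i - j.\<close>

lemma phase_interval:
  assumes n: "n \<ge> 0" and N: "\<And>i j. \<lbrakk>i \<in> {0..n}; j \<in> {0..n}\<rbrakk> \<Longrightarrow> real_of_int (N i - N j - 1) < real_of_int (i - j) * \<beta>"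
  obtains i j where "i \<in> {0..n}" "j \<in> {0..n}"
    "real_of_int (N i) - real_of_int i * \<beta> < real_of_int (N j) + 1 - real_of_int j * \<beta>"
    "\<And>\<psi> k. \<lbrakk>real_of_int (N i) - real_of_int i * \<beta> \<le> \<psi>; k \<in> {0..n}\<rbrakk> \<Longrightarrow> real_of_int (N k) \<le> real_of_int k * \<beta> + \<psi>"
    "\<And>\<psi> k. \<lbrakk>\<psi> < real_of_int (N j) + 1 - real_of_int j * \<beta>; k \<in> {0..n}\<rbrakk> \<Longrightarrow> real_of_int k * \<beta> + \<psi> < real_of_int (N k) + 1"
proof -
  let ?f = "\<lambda>k::int. real_of_int (N k) - real_of_int k * \<beta>"
  have ne: "{0..n} \<noteq> {}" using n by auto
  obtain i where i: "i \<in> {0..n}" "\<And>k. k \<in> {0..n} \<Longrightarrow> ?f k \<le> ?f i"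
  proof -
    have "Max (?f ` {0..n}) \<in> ?f ` {0..n}" by (rule Max_in) (use ne in auto)
    then obtain i where "i \<in> {0..n}" "?f i = Max (?f ` {0..n})" by auto
    then show ?thesis using that by auto
  qed
  obtain j where j: "j \<in> {0..n}" "\<And>k. k \<in> {0..n} \<Longrightarrow> ?f j \<le> ?f k"
  proof -
    have "Min (?f ` {0..n}) \<in> ?f ` {0..n}" by (rule Min_in) (use ne in auto)
    then obtain j where "j \<in> {0..n}" "?f j = Min (?f ` {0..n})" by auto
    then show ?thesis using that by auto
  qed
  show ?thesis
  proof (rule that[OF i(1) j(1)])
    show "?f i < real_of_int (N j) + 1 - real_of_int j * \<beta>"
      using N[OF i(1) j(1)] by (simp add: left_diff_distrib)
    show "real_of_int (N k) \<le> real_of_int k * \<beta> + \<psi>" if "?f i \<le> \<psi>" "k \<in> {0..n}" for \<psi> k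
      using i(2)[OF that(2)] that(1) by linarith
    show "real_of_int k * \<beta> + \<psi> < real_of_int (N k) + 1" if "\<psi> < real_of_int (N j) + 1 - real_of_int j * \<beta>" "k \<in> {0..n}" for \<psi> k
      using j(2)[OF that(2)] that(1) by linarith
  qed
qed

lemma irrational_mult_not_int:
  assumes "\<alpha> \<notin> \<rat>" "l \<noteq> 0"
  shows "real_of_int l * \<alpha> \<noteq> real_of_int r"
proof
  assume "real_of_int l * \<alpha> = real_of_int r"
  then have "\<alpha> = real_of_int r / real_of_int l" using assms by (simp add: field_simps)
  then show False using assms by (simp add: Rats_divide)
qed

text \<open>For l \<noteq> 0 the number l \<alpha> is strictly below its ceiling, and l \<beta>
  stays below it for \<beta> near \<alpha>; an integer below l \<beta> is then below l \<alpha>.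
  This transfers the inequality in \<open>sturm\<close> for bounded index differences.\<close>

lemma eventually_coherent:
  assumes "\<alpha> \<notin> \<rat>"
  shows "eventually (\<lambda>\<beta>. \<forall>l\<in>{-n..n}. \<forall>M::int. real_of_int M < real_of_int l * \<beta> \<longrightarrow> real_of_int M < real_of_int l * \<alpha>) (nhds \<alpha>)"
proof (rule eventually_ball_finite)
  show "\<forall>l\<in>{-n..n}. \<forall>\<^sub>F \<beta> in nhds \<alpha>. \<forall>M::int. real_of_int M < real_of_int l * \<beta> \<longrightarrow> real_of_int M < real_of_int l * \<alpha>"
  proof
    fix l assume "l \<in> {-n..n}"
    show "\<forall>\<^sub>F \<beta> in nhds \<alpha>. \<forall>M::int. real_of_int M < real_of_int l * \<beta> \<longrightarrow> real_of_int M < real_of_int l * \<alpha>"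
    proof (cases "l = 0")
      case False
      have lt: "real_of_int l * \<alpha> < real_of_int \<lceil>real_of_int l * \<alpha>\<rceil>"
        using irrational_mult_not_int[OF assms False] le_of_int_ceiling[of "real_of_int l * \<alpha>"] by (simp add: order_le_less)
      have "((\<lambda>\<beta>. real_of_int l * \<beta>) \<longlongrightarrow> real_of_int l * \<alpha>) (nhds \<alpha>)" by (intro tendsto_intros filterlim_ident)
      then have "\<forall>\<^sub>F \<beta> in nhds \<alpha>. real_of_int l * \<beta> < real_of_int \<lceil>real_of_int l * \<alpha>\<rceil>"
        by (rule order_tendstoD(2)) (rule lt)
      then show ?thesis
      proof (rule eventually_mono, intro allI impI)
        fix \<beta> M assume "real_of_int l * \<beta> < real_of_int \<lceil>real_of_int l * \<alpha>\<rceil>" "real_of_int M < real_of_int l * \<beta>"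
        then have "M < \<lceil>real_of_int l * \<alpha>\<rceil>" by linarith
        then show "real_of_int M < real_of_int l * \<alpha>" by (simp add: less_ceiling_iff)
      qed
    qed simp
  qed
qed simp

lemma irrational_orbit_dense:
  fixes \<alpha> a b \<theta> :: real and K :: int
  assumes "\<alpha> \<notin> \<rat>" "a < b"
  obtains k r :: int where "k > K" "a < \<theta> + of_int k * \<alpha> + of_int r" "\<theta> + of_int k * \<alpha> + of_int r < b"
proof -
  have "(b - a) / 2 > 0" using assms by simp
  then obtain h k where hk: "k > 0" "\<bar>of_int k * \<alpha> - of_int h - ((a + b) / 2 - \<theta> - of_int K * \<alpha>)\<bar> < (b - a) / 2"
    using sequence_of_fractional_parts_is_dense[OF assms(1)] by blast
  have "\<bar>(\<theta> + of_int (K + k) * \<alpha> + of_int (- h)) - (a + b) / 2\<bar> < (b - a) / 2"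
    using hk(2) by (simp add: algebra_simps)
  then have "a < \<theta> + of_int (K + k) * \<alpha> + of_int (- h)" "\<theta> + of_int (K + k) * \<alpha> + of_int (- h) < b"
    unfolding abs_less_iff by (simp_all add: field_simps)
  then show ?thesis using that[of "K + k" "- h"] hk(1) by auto
qed

text \<open>The open interval leaves room for a dense orbit to hit it and makes the inequalities
  strict on both sides, so that floor and ceiling coding agree. A letter involves \<open>N\<close>
  at j and j + 1, hence the range up to n + 1.\<close>

lemma eventually_sturm_phase:
  assumes \<alpha>: "\<alpha> \<notin> \<rat>" and n: "n \<ge> 0"
  shows "eventually (\<lambda>\<beta>. \<forall>v. sturm \<beta> v \<longrightarrow> (\<exists>N a b. a < b \<and> (\<forall>j\<in>{0..n}. v j = real_of_int (N (j + 1) - N j)) \<and>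
     (\<forall>\<psi>\<in>{a<..<b}. \<forall>j\<in>{0..n + 1}. real_of_int (N j) < real_of_int j * \<alpha> + \<psi> \<and> real_of_int j * \<alpha> + \<psi> < real_of_int (N j) + 1))) (nhds \<alpha>)"
proof (rule eventually_mono[OF eventually_coherent[OF \<alpha>, of "n + 1"]], intro allI impI)
  fix \<beta> v
  assume co: "\<forall>l\<in>{-(n + 1)..n + 1}. \<forall>M::int. real_of_int M < real_of_int l * \<beta> \<longrightarrow> real_of_int M < real_of_int l * \<alpha>"
    and "sturm \<beta> v"
  then obtain N where N: "\<And>j. v j = real_of_int (N (j + 1) - N j)" "\<And>i j. real_of_int (N i - N j - 1) < real_of_int (i - j) * \<beta>"
    unfolding sturm_def by blast
  have N\<alpha>: "real_of_int (N i - N j - 1) < real_of_int (i - j) * \<alpha>" if "i \<in> {0..n + 1}" "j \<in> {0..n + 1}" for i j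
    using co[rule_format, of "i - j" "N i - N j - 1"] N(2)[of i j] that by auto
  have n1: "n + 1 \<ge> 0" using n by simp
  obtain i j where ij: "i \<in> {0..n + 1}" "j \<in> {0..n + 1}"
    "real_of_int (N i) - real_of_int i * \<alpha> < real_of_int (N j) + 1 - real_of_int j * \<alpha>"
    "\<And>\<psi> k. \<lbrakk>real_of_int (N i) - real_of_int i * \<alpha> \<le> \<psi>; k \<in> {0..n + 1}\<rbrakk> \<Longrightarrow> real_of_int (N k) \<le> real_of_int k * \<alpha> + \<psi>"
    "\<And>\<psi> k. \<lbrakk>\<psi> < real_of_int (N j) + 1 - real_of_int j * \<alpha>; k \<in> {0..n + 1}\<rbrakk> \<Longrightarrow> real_of_int k * \<alpha> + \<psi> < real_of_int (N k) + 1"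
    using phase_interval[where N = N, OF n1 N\<alpha>] by metis
  show "\<exists>N a b. a < b \<and> (\<forall>j\<in>{0..n}. v j = real_of_int (N (j + 1) - N j)) \<and>
     (\<forall>\<psi>\<in>{a<..<b}. \<forall>j\<in>{0..n + 1}. real_of_int (N j) < real_of_int j * \<alpha> + \<psi> \<and> real_of_int j * \<alpha> + \<psi> < real_of_int (N j) + 1)"
  proof (intro exI conjI ballI)
    fix \<psi> k assume \<psi>: "\<psi> \<in> {real_of_int (N i) - real_of_int i * \<alpha> <..< real_of_int (N j) + 1 - real_of_int j * \<alpha>}" and k: "k \<in> {0..n + 1}"
    show "real_of_int (N k) < real_of_int k * \<alpha> + \<psi>"
      using ij(4)[OF order_refl k] \<psi> by auto
    show "real_of_int k * \<alpha> + \<psi> < real_of_int (N k) + 1" using ij(5)[OF _ k] \<psi> by auto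
  qed (use ij N in auto)
qed

lemma sturm_phase:
  assumes \<alpha>: "\<alpha> \<notin> \<rat>" and n: "n \<ge> 0" and v: "sturm \<alpha> v"
  obtains N a b where "a < b" "\<And>j. j \<in> {0..n} \<Longrightarrow> v j = real_of_int (N (j + 1) - N j)"
     "\<And>\<psi> j. \<lbrakk>a < \<psi>; \<psi> < b; j \<in> {0..n + 1}\<rbrakk> \<Longrightarrow> real_of_int (N j) < real_of_int j * \<alpha> + \<psi> \<and> real_of_int j * \<alpha> + \<psi> < real_of_int (N j) + 1"
  using eventually_nhds_x_imp_x[OF eventually_sturm_phase[OF \<alpha> n]] v that
  by (metis (no_types, lifting) greaterThanLessThan_iff)

lemma vpot_eq_of_floor:
  assumes "0 \<le> \<beta>" "\<beta> \<le> 1"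
    and "real_of_int N0 \<le> real_of_int j * \<beta> + \<psi>" "real_of_int j * \<beta> + \<psi> < real_of_int N0 + 1"
    and "real_of_int N1 \<le> real_of_int (j + 1) * \<beta> + \<psi>" "real_of_int (j + 1) * \<beta> + \<psi> < real_of_int N1 + 1"
  shows "vpot \<beta> \<psi> j = real_of_int (N1 - N0)"
proof -
  have "\<lfloor>real_of_int j * \<beta> + \<psi>\<rfloor> = N0" "\<lfloor>real_of_int (j + 1) * \<beta> + \<psi>\<rfloor> = N1"
    using assms by (auto intro!: floor_unique)
  then show ?thesis using vpot_floor[OF assms(1,2), of \<psi> j] by simp
qed

lemma vpot_tilde_eq_of_floor:
  assumes "0 < \<beta>" "\<beta> \<le> 1"
    and "real_of_int N0 < real_of_int j * \<beta> + \<psi>" "real_of_int j * \<beta> + \<psi> \<le> real_of_int N0 + 1"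
    and "real_of_int N1 < real_of_int (j + 1) * \<beta> + \<psi>" "real_of_int (j + 1) * \<beta> + \<psi> \<le> real_of_int N1 + 1"
  shows "vpot_tilde \<beta> \<psi> j = real_of_int (N1 - N0)"
proof -
  have "\<lceil>real_of_int j * \<beta> + \<psi>\<rceil> = N0 + 1" "\<lceil>real_of_int (j + 1) * \<beta> + \<psi>\<rceil> = N1 + 1"
    using assms by (auto intro!: ceiling_unique)
  then show ?thesis using vpot_tilde_ceiling[OF assms(1,2), of \<psi> j] by simp
qed

text \<open>The orbit of \<theta> is dense and hits the open interval of phases of the word, where
  both codings produce it at the same position. \<open>K\<close> pushes the occurrence inside a half
  line.\<close>

lemma sturm_word_occurs:
  assumes \<alpha>: "\<alpha> \<notin> \<rat>" "0 < \<alpha>" "\<alpha> < 1" and n: "n \<ge> 0" and v: "sturm \<alpha> v"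
  obtains k where "k > K" "\<And>j. j \<in> {0..n} \<Longrightarrow> v j = vpot \<alpha> \<theta> (j + k)" "\<And>j. j \<in> {0..n} \<Longrightarrow> v j = vpot_tilde \<alpha> \<theta> (j + k)"
proof -
  obtain N a b where ab: "a < b" and N: "\<And>j. j \<in> {0..n} \<Longrightarrow> v j = real_of_int (N (j + 1) - N j)"
     "\<And>\<psi> j. \<lbrakk>a < \<psi>; \<psi> < b; j \<in> {0..n + 1}\<rbrakk> \<Longrightarrow> real_of_int (N j) < real_of_int j * \<alpha> + \<psi> \<and> real_of_int j * \<alpha> + \<psi> < real_of_int (N j) + 1"
    using sturm_phase[OF \<alpha>(1) n v] by metis
  obtain k r :: int where k: "k > K" "a < \<theta> + of_int k * \<alpha> + of_int r" "\<theta> + of_int k * \<alpha> + of_int r < b"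
    using irrational_orbit_dense[OF \<alpha>(1) ab] by blast
  let ?\<psi> = "\<theta> + of_int k * \<alpha> + of_int r"
  have "v j = vpot \<alpha> \<theta> (j + k)" "v j = vpot_tilde \<alpha> \<theta> (j + k)" if j: "j \<in> {0..n}" for j
  proof -
    have j': "j \<in> {0..n + 1}" "j + 1 \<in> {0..n + 1}" using j by auto
    note b1 = N(2)[OF k(2,3) j'(1)] and b2 = N(2)[OF k(2,3) j'(2)]
    have "vpot \<alpha> ?\<psi> j = v j" unfolding N(1)[OF j] by (rule vpot_eq_of_floor) (use b1 b2 \<alpha> in auto)
    then show "v j = vpot \<alpha> \<theta> (j + k)" by (simp add: vpot_shift vpot_add_of_int)
    have "vpot_tilde \<alpha> ?\<psi> j = v j" unfolding N(1)[OF j] by (rule vpot_tilde_eq_of_floor) (use b1 b2 \<alpha> in auto)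
    then show "v j = vpot_tilde \<alpha> \<theta> (j + k)" by (simp add: vpot_tilde_shift vpot_tilde_add_of_int)
  qed
  then show ?thesis using that k(1) by blast
qed

text \<open>On a finite window the right limit in the phase is \<open>vpot\<close> and the left
  limit is \<open>vpot_tilde\<close>. Hence a neighbourhood of a single phase involves both
  half-line operators.\<close>

lemma vpot_near_phase:
  assumes \<alpha>: "0 < \<alpha>" "\<alpha> < 1" and n: "n \<ge> 0"
  obtains \<delta> where "\<delta> > 0"
    "\<And>\<psi>' j. \<lbrakk>\<psi> \<le> \<psi>'; \<psi>' < \<psi> + \<delta>; j \<in> {0..n}\<rbrakk> \<Longrightarrow> vpot \<alpha> \<psi>' j = vpot \<alpha> \<psi> j"
    "\<And>\<psi>' j. \<lbrakk>\<psi> - \<delta> < \<psi>'; \<psi>' < \<psi>; j \<in> {0..n}\<rbrakk> \<Longrightarrow> vpot \<alpha> \<psi>' j = vpot_tilde \<alpha> \<psi> j"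
proof -
  define x where "x = (\<lambda>j::int. real_of_int j * \<alpha> + \<psi>)"
  \<comment> \<open>Distances from x j to the next integer strictly above and strictly below it. The
    first limits moves to the right, the second moves to the left.\<close>
  define f where "f = (\<lambda>j. min (real_of_int \<lfloor>x j\<rfloor> + 1 - x j) (x j - real_of_int \<lceil>x j\<rceil> + 1))"
  define \<delta> where "\<delta> = Min (f ` {0..n + 1})"
  have fpos: "f j > 0" for j unfolding f_def using floor_correct[of "x j"] ceiling_correct[of "x j"] by auto
  have "\<delta> \<in> f ` {0..n + 1}" unfolding \<delta>_def using n by (intro Min_in) auto
  then have \<delta>: "\<delta> > 0" using fpos by auto
  have \<delta>le: "\<delta> \<le> f j" if "j \<in> {0..n + 1}" for j unfolding \<delta>_def using that by (intro Min_le) auto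
  show ?thesis
  proof (rule that[OF \<delta>])
    fix \<psi>' j assume h: "\<psi> \<le> \<psi>'" "\<psi>' < \<psi> + \<delta>" "j \<in> {0..n}"
    have fl: "real_of_int \<lfloor>x i\<rfloor> \<le> real_of_int i * \<alpha> + \<psi>' \<and> real_of_int i * \<alpha> + \<psi>' < real_of_int \<lfloor>x i\<rfloor> + 1" if "i \<in> {0..n + 1}" for i
    proof -
      have "\<delta> \<le> real_of_int \<lfloor>x i\<rfloor> + 1 - x i" using \<delta>le[OF that] by (simp add: f_def)
      moreover have "real_of_int i * \<alpha> + \<psi>' = x i + (\<psi>' - \<psi>)" by (simp add: x_def)
      ultimately show ?thesis using h of_int_floor_le[of "x i"] by linarith
    qed
    have j': "j \<in> {0..n + 1}" "j + 1 \<in> {0..n + 1}" using h by auto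
    have "vpot \<alpha> \<psi>' j = real_of_int (\<lfloor>x (j + 1)\<rfloor> - \<lfloor>x j\<rfloor>)"
      by (rule vpot_eq_of_floor) (use fl[OF j'(1)] fl[OF j'(2)] \<alpha> in auto)
    then show "vpot \<alpha> \<psi>' j = vpot \<alpha> \<psi> j" using vpot_floor[of \<alpha> \<psi> j] \<alpha> by (simp add: x_def)
  next
    fix \<psi>' j assume h: "\<psi> - \<delta> < \<psi>'" "\<psi>' < \<psi>" "j \<in> {0..n}"
    have fl: "real_of_int (\<lceil>x i\<rceil> - 1) \<le> real_of_int i * \<alpha> + \<psi>' \<and> real_of_int i * \<alpha> + \<psi>' < real_of_int (\<lceil>x i\<rceil> - 1) + 1" if "i \<in> {0..n + 1}" for i
    proof -
      have "\<delta> \<le> x i - real_of_int \<lceil>x i\<rceil> + 1" using \<delta>le[OF that] by (simp add: f_def)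
      moreover have "real_of_int i * \<alpha> + \<psi>' = x i + (\<psi>' - \<psi>)" by (simp add: x_def)
      moreover have "real_of_int (\<lceil>x i\<rceil> - 1) = real_of_int \<lceil>x i\<rceil> - 1" by simp
      ultimately show ?thesis using h(1,2) le_of_int_ceiling[of "x i"] by linarith
    qed
    have j': "j \<in> {0..n + 1}" "j + 1 \<in> {0..n + 1}" using h by auto
    have "vpot \<alpha> \<psi>' j = real_of_int ((\<lceil>x (j + 1)\<rceil> - 1) - (\<lceil>x j\<rceil> - 1))"
      by (rule vpot_eq_of_floor) (use fl[OF j'(1)] fl[OF j'(2)] \<alpha> in auto)
    then show "vpot \<alpha> \<psi>' j = vpot_tilde \<alpha> \<psi> j" using vpot_tilde_ceiling[of \<alpha> \<psi> j] \<alpha> by (simp add: x_def)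
  qed
qed

lemma lower_bound_of_words:
  assumes "\<And>n. n \<ge> 0 \<Longrightarrow> \<exists>w. lower_bound lam c w {0..} \<and> (\<forall>j\<in>{0..n}. v j = w j)"
  shows "lower_bound lam c v {0..}"
proof (rule lower_boundI)
  fix x M n
  assume x: "finite {n. x n \<noteq> 0}" "\<And>n. n \<notin> {0..} \<Longrightarrow> x n = 0"
    "\<And>n. n \<in> {0..} \<Longrightarrow> norm (schr_op v lam x n) \<le> M"
  obtain N where N: "\<And>d. d \<in> {n. x n \<noteq> 0} \<Longrightarrow> nat \<bar>d\<bar> \<le> N" using finite_int_bounded[OF x(1)] by metis
  obtain w where w: "lower_bound lam c w {0..}" "\<And>j. j \<in> {0..int N} \<Longrightarrow> v j = w j" using assms[of "int N"] by auto
  have "v m = w m" if "x m \<noteq> 0" for m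
  proof (rule w(2))
    have "m \<ge> 0" using x(2)[of m] that by force
    then show "m \<in> {0..int N}" using N[of m] that by auto
  qed
  then have "schr_op v lam x = schr_op w lam x" by (rule schr_op_cong)
  then show "c * norm (x n) \<le> M" using lower_boundD[OF w(1) x(1,2), of M n] x(3) by simp
qed

text \<open>The support of \<open>x\<close> fits into a window; its word is found in
  \<open>w\<close> inside \<open>I\<close>, where translation makes the bound available.\<close>

lemma lower_bound_UNIV_of_words:
  assumes lb: "lower_bound lam c w I"
    and words: "\<And>n s. n \<ge> 0 \<Longrightarrow> \<exists>k. {k..k + n} \<subseteq> I \<and> (\<forall>j\<in>{0..n}. v (j + s) = w (j + k))"
  shows "lower_bound lam c v UNIV"
proof (rule lower_boundI)
  fix x M n
  assume x: "finite {n. x n \<noteq> 0}" "\<And>n. n \<in> UNIV \<Longrightarrow> norm (schr_op v lam x n) \<le> M"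
  obtain N where N: "\<And>d. d \<in> {n. x n \<noteq> 0} \<Longrightarrow> nat \<bar>d\<bar> \<le> N" using finite_int_bounded[OF x(1)] by metis
  obtain k where kI: "{k..k + 2 * int N} \<subseteq> I" and k: "\<And>j. j \<in> {0..2 * int N} \<Longrightarrow> v (j + - int N) = w (j + k)"
    using words[of "2 * int N" "- int N"] by auto
  let ?s = "k + int N"
  have supp: "m + int N \<in> {0..2 * int N}" if "x m \<noteq> 0" for m using N[of m] that by auto
  have "v m = w (m + ?s)" if "x m \<noteq> 0" for m
    using k[OF supp[OF that]] by (simp add: ac_simps)
  then have eq: "schr_op v lam x = schr_op (\<lambda>m. w (m + ?s)) lam x" by (rule schr_op_cong)
  have lb': "lower_bound lam c (\<lambda>m. w (m + ?s)) {n. n - (- ?s) \<in> I}"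
    by (rule lower_bound_shift) (use lb in simp)
  show "c * norm (x n) \<le> M"
  proof (rule lower_boundD[OF lb' x(1)])
    fix m assume m: "m \<notin> {n. n - (- ?s) \<in> I}"
    show "x m = 0"
    proof (rule ccontr)
      assume "x m \<noteq> 0"
      then have "m - (- ?s) \<in> {k..k + 2 * int N}" using supp[of m] by auto
      then have "m - (- ?s) \<in> I" using kI by blast
      then show False using m by blast
    qed
  qed (use x(2) eq in auto)
qed

lemma sturm_lower_bounds:
  assumes lb: "\<And>v. sturm \<beta> v \<Longrightarrow> lower_bound lam c v {0..}" and v: "sturm \<beta> v"
  shows "lower_bound lam c v {a..}" "lower_bound lam c v {..b}"
proof -
  have *: "lower_bound lam c v {a..}" if "sturm \<beta> v" for v a
  proof -
    have "lower_bound lam c v {n. n - a \<in> {0..}}" by (rule lower_bound_shift[OF lb[OF sturm_shift[OF that]]])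
    moreover have "{n. n - a \<in> {0..}} = {a..}" by auto
    ultimately show ?thesis by simp
  qed
  show "lower_bound lam c v {a..}" by (rule *[OF v])
  have "lower_bound lam c v {n. - n \<in> {- b..}}" by (rule lower_bound_reflect[OF *[OF sturm_reflect[OF v]]])
  moreover have "{n. - n \<in> {- b..}} = {..b}" by auto
  ultimately show "lower_bound lam c v {..b}" by simp
qed

section \<open>Continued fractions\<close>

definition cf_err :: "real \<Rightarrow> nat \<Rightarrow> real" where
  "cf_err x n = real_of_int (cf_q x n) * x - real_of_int (cf_p x n)"

context
  fixes \<alpha> :: real
  assumes irr: "\<alpha> \<notin> \<rat>" and \<alpha>0: "0 < \<alpha>" and \<alpha>1: "\<alpha> < 1"
begin

lemma cf_rem_irrational: "cf_rem \<alpha> n \<notin> \<rat> \<and> 0 < cf_rem \<alpha> n \<and> cf_rem \<alpha> n < 1"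
proof (induction n)
  case 0
  then show ?case using irr \<alpha>0 \<alpha>1 by simp
next
  case (Suc n)
  have "1 / cf_rem \<alpha> n \<notin> \<rat>"
  proof
    assume "1 / cf_rem \<alpha> n \<in> \<rat>"
    then have "1 / (1 / cf_rem \<alpha> n) \<in> \<rat>" by (rule Rats_divide[OF Rats_1])
    then show False using Suc by simp
  qed
  then have ni: "frac (1 / cf_rem \<alpha> n) \<notin> \<rat>"
    unfolding frac_def by (metis Rats_add Rats_of_int diff_add_cancel)
  then have "frac (1 / cf_rem \<alpha> n) \<noteq> 0" by (metis Rats_0)
  then have "frac (1 / cf_rem \<alpha> n) > 0" using frac_ge_0[of "1 / cf_rem \<alpha> n"] by linarith
  then show ?case using ni frac_lt_1[of "1 / cf_rem \<alpha> n"] by simp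
qed

lemma cf_a_pos: "cf_a \<alpha> (Suc n) \<ge> 1"
  using cf_rem_irrational[of n] by (simp add: cf_a_def le_floor_iff)

lemma cf_rem_step: "1 / cf_rem \<alpha> n = real_of_int (cf_a \<alpha> (Suc n)) + cf_rem \<alpha> (Suc n)"
  by (simp add: cf_a_def frac_def)

text \<open>The guard on \<open>n\<close> avoids truncated subtraction, which at 0 would read q_{-1}
  = 0 as q_0 = 1.\<close>

lemma cf_q_ge: "cf_q \<alpha> n \<ge> 1 \<and> cf_q \<alpha> (Suc n) \<ge> cf_q \<alpha> n \<and> (n \<ge> 1 \<longrightarrow> cf_q \<alpha> (Suc n) \<ge> cf_q \<alpha> n + cf_q \<alpha> (n - 1))"
proof (induction n)
  case 0
  then show ?case using cf_a_pos[of 0] by simp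
next
  case (Suc n)
  have "cf_q \<alpha> (Suc (Suc n)) \<ge> 1 * cf_q \<alpha> (Suc n) + cf_q \<alpha> n"
    using mult_right_mono[OF cf_a_pos[of "Suc n"], of "cf_q \<alpha> (Suc n)"] Suc by simp
  then show ?case using Suc by (auto simp del: cf_q.simps)
qed

lemma cf_q_ge_index: "cf_q \<alpha> n \<ge> int n"
proof (induction n)
  case (Suc n)
  show ?case
  proof (cases n)
    case 0
    then show ?thesis using cf_q_ge[of 1] by simp
  next
    case (Suc m)
    then show ?thesis using Suc.IH cf_q_ge[of n] cf_q_ge[of m] by (auto simp del: cf_q.simps)
  qed
qed simp

text \<open>Induction along 1/r = a + r' for successive remainders. The sign makes the errors
  alternate and the factor below 1 makes them decrease; \<open>orbit_hits_interval\<close> uses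
  both.\<close>

lemma cf_err_Suc: "cf_err \<alpha> (Suc n) = - cf_rem \<alpha> (Suc n) * cf_err \<alpha> n"
proof (induction n)
  case 0
  have "\<alpha> * (1 / \<alpha>) = \<alpha> * (real_of_int (cf_a \<alpha> (Suc 0)) + cf_rem \<alpha> (Suc 0))" using cf_rem_step[of 0] by simp
  then show ?case using \<alpha>0 by (simp add: cf_err_def algebra_simps del: cf_rem.simps(2))
next
  case (Suc n)
  let ?r = "cf_rem \<alpha> (Suc n)"
  have r: "?r > 0" using cf_rem_irrational by blast
  have e: "cf_err \<alpha> n = - cf_err \<alpha> (Suc n) / ?r" using Suc r by (simp add: field_simps del: cf_rem.simps)
  have "cf_err \<alpha> (Suc (Suc n)) = real_of_int (cf_a \<alpha> (Suc (Suc n))) * cf_err \<alpha> (Suc n) + cf_err \<alpha> n"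
    by (simp add: cf_err_def algebra_simps)
  also have "\<dots> = - (1 / ?r - real_of_int (cf_a \<alpha> (Suc (Suc n)))) * cf_err \<alpha> (Suc n)"
    unfolding e by (simp add: algebra_simps del: cf_rem.simps)
  also have "1 / ?r - real_of_int (cf_a \<alpha> (Suc (Suc n))) = cf_rem \<alpha> (Suc (Suc n))"
    using cf_rem_step[of "Suc n"] by simp
  finally show ?case .
qed

lemma cf_err_bounds: "cf_err \<alpha> n \<noteq> 0" "\<bar>cf_err \<alpha> (Suc n)\<bar> < \<bar>cf_err \<alpha> n\<bar>" "\<bar>cf_err \<alpha> n\<bar> < 1"
proof -
  have *: "cf_err \<alpha> n \<noteq> 0 \<and> \<bar>cf_err \<alpha> n\<bar> < 1 \<and> \<bar>cf_err \<alpha> (Suc n)\<bar> < \<bar>cf_err \<alpha> n\<bar>" for n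
  proof (induction n)
    case 0
    have "\<bar>cf_rem \<alpha> (Suc 0)\<bar> * \<bar>\<alpha>\<bar> < 1 * \<bar>\<alpha>\<bar>"
      using cf_rem_irrational[of "Suc 0"] \<alpha>0 by (intro mult_strict_right_mono) (auto simp del: cf_rem.simps)
    then show ?case using \<alpha>0 \<alpha>1 cf_err_Suc[of 0] by (simp add: cf_err_def abs_mult del: cf_rem.simps)
  next
    case (Suc n)
    have z: "cf_err \<alpha> (Suc n) \<noteq> 0" using Suc cf_err_Suc[of n] cf_rem_irrational[of "Suc n"] by (auto simp del: cf_rem.simps)
    have "\<bar>cf_rem \<alpha> (Suc (Suc n))\<bar> * \<bar>cf_err \<alpha> (Suc n)\<bar> < 1 * \<bar>cf_err \<alpha> (Suc n)\<bar>"
      using cf_rem_irrational[of "Suc (Suc n)"] z by (intro mult_strict_right_mono) (auto simp del: cf_rem.simps)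
    then show ?case using Suc z cf_err_Suc[of "Suc n"] by (simp add: abs_mult del: cf_rem.simps)
  qed
  show "cf_err \<alpha> n \<noteq> 0" "\<bar>cf_err \<alpha> (Suc n)\<bar> < \<bar>cf_err \<alpha> n\<bar>" "\<bar>cf_err \<alpha> n\<bar> < 1" using * by blast+
qed

lemma cf_det: "cf_p \<alpha> (Suc n) * cf_q \<alpha> n - cf_p \<alpha> n * cf_q \<alpha> (Suc n) = (-1) ^ n"
  by (induction n) (simp_all add: algebra_simps)

lemma approximant_tendsto: "approximant \<alpha> \<longlonglongrightarrow> \<alpha>"
proof -
  have "(\<lambda>m. approximant \<alpha> m - \<alpha>) \<longlonglongrightarrow> 0"
  proof (rule Lim_null_comparison)
    show "\<forall>\<^sub>F m in sequentially. norm (approximant \<alpha> m - \<alpha>) \<le> 1 / real m"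
    proof (rule eventually_sequentiallyI[of 1])
      fix m :: nat assume m: "1 \<le> m"
      have q: "real_of_int (cf_q \<alpha> m) \<ge> real m" using cf_q_ge_index[of m] by linarith
      have "approximant \<alpha> m - \<alpha> = - cf_err \<alpha> m / real_of_int (cf_q \<alpha> m)"
        using q m by (simp add: approximant_def cf_err_def field_simps)
      then have "norm (approximant \<alpha> m - \<alpha>) = \<bar>cf_err \<alpha> m\<bar> / real_of_int (cf_q \<alpha> m)" using q m by simp
      also have "\<dots> \<le> 1 / real m" using q m cf_err_bounds(3)[of m] by (intro frac_le) auto
      finally show "norm (approximant \<alpha> m - \<alpha>) \<le> 1 / real m" .
    qed
    show "(\<lambda>m. 1 / real m) \<longlonglongrightarrow> 0" by (rule lim_1_over_n)
  qed
  then show ?thesis by (rule LIM_zero_cancel)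
qed

text \<open>Unimodularity of consecutive convergents writes (l, r) as x times (q, p) plus y times
  (q', p') with integers x, y. From 0 < |l| < q' it follows that x is nonzero and that x and y do
  not have the same sign. The two errors have opposite signs, so the contributions add up, and the
  first has at least the size of the error at \<open>k\<close>.\<close>

lemma cf_best_approximation:
  assumes l: "l \<noteq> 0" "\<bar>l\<bar> < cf_q \<alpha> (Suc k)"
  shows "\<bar>cf_err \<alpha> k\<bar> \<le> \<bar>real_of_int l * \<alpha> - real_of_int r\<bar>"
proof -
  let ?q = "cf_q \<alpha> k" and ?p = "cf_p \<alpha> k" and ?q' = "cf_q \<alpha> (Suc k)" and ?p' = "cf_p \<alpha> (Suc k)"
  define s :: int where "s = (-1) ^ k"
  have s: "s * s = 1" by (simp add: s_def flip: power_add)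
  have det: "?p' * ?q - ?p * ?q' = s" using cf_det[of k] by (simp add: s_def)
  define x where "x = s * (l * ?p' - r * ?q')"
  define y where "y = s * (r * ?q - l * ?p)"
  have "x * ?q + y * ?q' = s * l * (?p' * ?q - ?p * ?q')" by (simp add: x_def y_def algebra_simps)
  also have "\<dots> = l" unfolding det using s by (simp add: ac_simps)
  finally have xl: "x * ?q + y * ?q' = l" .
  have "x * ?p + y * ?p' = s * r * (?p' * ?q - ?p * ?q')" by (simp add: x_def y_def algebra_simps)
  also have "\<dots> = r" unfolding det using s by (simp add: ac_simps)
  finally have xr: "x * ?p + y * ?p' = r" .
  have q: "?q \<ge> 1" "?q' \<ge> 1" using cf_q_ge[of k] cf_q_ge[of "Suc k"] by auto
  have x0: "x \<noteq> 0"
  proof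
    assume "x = 0"
    then have "l = y * ?q'" using xl by simp
    moreover from this l have "\<bar>y\<bar> \<ge> 1" by auto
    then have "\<bar>y\<bar> * ?q' \<ge> 1 * ?q'" using q by (intro mult_right_mono) auto
    ultimately show False using l(2) q by (simp add: abs_mult)
  qed
  have xy: "\<not> (x > 0 \<and> y > 0)" "\<not> (x < 0 \<and> y < 0)"
  proof -
    show "\<not> (x > 0 \<and> y > 0)"
    proof
      assume "x > 0 \<and> y > 0"
      then have "x * ?q \<ge> 0" "y * ?q' \<ge> 1 * ?q'" using q by (auto intro!: mult_right_mono)
      then show False using xl l(2) by linarith
    qed
    show "\<not> (x < 0 \<and> y < 0)"
    proof
      assume "x < 0 \<and> y < 0"
      then have "(- x) * ?q \<ge> 0" "(- y) * ?q' \<ge> 1 * ?q'" using q by (intro mult_nonneg_nonneg mult_right_mono; simp)+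
      then show False using xl l(2) by linarith
    qed
  qed
  define \<rho> where "\<rho> = cf_rem \<alpha> (Suc k)"
  have \<rho>: "0 < \<rho>" using cf_rem_irrational unfolding \<rho>_def by blast
  have "real_of_int l * \<alpha> - real_of_int r = real_of_int x * cf_err \<alpha> k + real_of_int y * cf_err \<alpha> (Suc k)"
    unfolding xl[symmetric] xr[symmetric] by (simp add: cf_err_def algebra_simps del: cf_p.simps cf_q.simps)
  also have "\<dots> = (real_of_int x - \<rho> * real_of_int y) * cf_err \<alpha> k"
    unfolding cf_err_Suc \<rho>_def[symmetric] by (simp add: algebra_simps)
  finally have eq: "\<bar>real_of_int l * \<alpha> - real_of_int r\<bar> = \<bar>real_of_int x - \<rho> * real_of_int y\<bar> * \<bar>cf_err \<alpha> k\<bar>"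
    by (simp add: abs_mult)
  have "1 \<le> \<bar>real_of_int x - \<rho> * real_of_int y\<bar>"
  proof (cases "x > 0")
    case True
    then have "\<rho> * real_of_int y \<le> 0" using xy \<rho> by (auto simp: mult_le_0_iff)
    then show ?thesis using True by linarith
  next
    case False
    then have "x < 0" using x0 by simp
    then have "\<rho> * real_of_int y \<ge> 0" using xy \<rho> by (auto simp: zero_le_mult_iff)
    then show ?thesis using \<open>x < 0\<close> by linarith
  qed
  then show ?thesis unfolding eq using mult_right_mono[of 1 _ "\<bar>cf_err \<alpha> k\<bar>"] by simp
qed

text \<open>Compare the least admissible \<open>n\<close> with \<open>n - q'\<close> and \<open>n - q - q'\<close>, where \<open>q\<close> and \<open>q'\<close> are
  consecutive denominators: the corresponding points are displaced in opposite directions.\<close>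
lemma orbit_hits_interval:
  assumes len: "b - a \<ge> \<bar>cf_err \<alpha> k\<bar>"
  obtains n :: nat and r :: int where "n > N0" "int n \<le> int N0 + cf_q \<alpha> k + cf_q \<alpha> (Suc k)"
    "a \<le> \<theta> - of_nat n * \<alpha> + of_int r" "\<theta> - of_nat n * \<alpha> + of_int r < b"
proof -
  let ?q = "nat (cf_q \<alpha> k)" and ?q' = "nat (cf_q \<alpha> (Suc k))"
  define d where "d = \<bar>cf_err \<alpha> k\<bar>"
  define d' where "d' = \<bar>cf_err \<alpha> (Suc k)\<bar>"
  have d: "0 < d'" "d' < d" using cf_err_bounds[of k] cf_err_bounds[of "Suc k"] by (auto simp: d_def d'_def)
  have q: "int ?q = cf_q \<alpha> k" "int ?q' = cf_q \<alpha> (Suc k)" using cf_q_ge[of k] cf_q_ge[of "Suc k"] by auto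
  \<comment> \<open>The target is shrunk to length exactly \<open>d\<close>, the larger
    displacement, so that a point pushed out by d' is brought back inside by
    \<open>d\<close>.\<close>
  define P where "P = (\<lambda>n::nat. n > N0 \<and> (\<exists>r::int. a \<le> \<theta> - of_nat n * \<alpha> + of_int r \<and> \<theta> - of_nat n * \<alpha> + of_int r < a + d))"
  have "\<exists>n. P n"
  proof -
    have "- \<alpha> \<notin> \<rat>" using irr by simp
    moreover have "a < a + d" using d by simp
    ultimately obtain k r :: int where k: "k > int N0" "a < \<theta> + of_int k * (- \<alpha>) + of_int r" "\<theta> + of_int k * (- \<alpha>) + of_int r < a + d"
      by (rule irrational_orbit_dense)
    then have "P (nat k)" unfolding P_def by (intro conjI exI[of _ r]) auto
    then show ?thesis by blast
  qed
  define n where "n = (LEAST n. P n)"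
  have Pn: "P n" unfolding n_def using \<open>\<exists>n. P n\<close> by (rule LeastI_ex)
  have least: "\<not> P m" if "m < n" for m using not_less_Least that unfolding n_def by blast
  obtain r where nr: "n > N0" "a \<le> \<theta> - of_nat n * \<alpha> + of_int r" "\<theta> - of_nat n * \<alpha> + of_int r < a + d"
    using Pn unfolding P_def by blast
  have "n \<le> N0 + ?q + ?q'"
  proof (rule ccontr)
    assume "\<not> n \<le> N0 + ?q + ?q'"
    then have big: "n > N0 + ?q + ?q'" by simp
    define z where "z = \<theta> - of_nat n * \<alpha> + of_int r"
    have qp: "?q' > 0" "?q > 0" using cf_q_ge[of k] cf_q_ge[of "Suc k"] by auto
    have z1: "\<theta> - of_nat (n - ?q') * \<alpha> + of_int (r - cf_p \<alpha> (Suc k)) = z + cf_err \<alpha> (Suc k)"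
    proof -
      have "real (n - ?q') = real n - real_of_int (cf_q \<alpha> (Suc k))" using big q by (metis add_leE less_imp_le of_int_of_nat_eq of_nat_diff)
      then show ?thesis by (simp add: z_def cf_err_def algebra_simps del: cf_p.simps cf_q.simps)
    qed
    have z2: "\<theta> - of_nat (n - ?q' - ?q) * \<alpha> + of_int (r - cf_p \<alpha> (Suc k) - cf_p \<alpha> k) = z + cf_err \<alpha> (Suc k) + cf_err \<alpha> k"
    proof -
      have "real (n - ?q' - ?q) = real n - real_of_int (cf_q \<alpha> (Suc k)) - real_of_int (cf_q \<alpha> k)"
      proof -
        have "n - ?q' - ?q + ?q + ?q' = n" using big by simp
        then have "real (n - ?q' - ?q) + real ?q + real ?q' = real n" by (metis of_nat_add)
        moreover have "real ?q = real_of_int (cf_q \<alpha> k)" "real ?q' = real_of_int (cf_q \<alpha> (Suc k))" using q by (metis of_int_of_nat_eq)+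
        ultimately show ?thesis by linarith
      qed
      then show ?thesis unfolding z_def cf_err_def by (simp only: of_int_diff) (simp add: algebra_simps del: cf_p.simps cf_q.simps diff_diff_left)
    qed
    have n1: "\<not> (a \<le> z + cf_err \<alpha> (Suc k) \<and> z + cf_err \<alpha> (Suc k) < a + d)"
    proof
      assume "a \<le> z + cf_err \<alpha> (Suc k) \<and> z + cf_err \<alpha> (Suc k) < a + d"
      then have "P (n - ?q')" unfolding P_def z1[symmetric] using big by (intro conjI) (simp, blast)
      then show False using least[of "n - ?q'"] big qp by auto
    qed
    have n2: "\<not> (a \<le> z + cf_err \<alpha> (Suc k) + cf_err \<alpha> k \<and> z + cf_err \<alpha> (Suc k) + cf_err \<alpha> k < a + d)"
    proof
      assume "a \<le> z + cf_err \<alpha> (Suc k) + cf_err \<alpha> k \<and> z + cf_err \<alpha> (Suc k) + cf_err \<alpha> k < a + d"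
      then have "P (n - ?q' - ?q)" unfolding P_def z2[symmetric] using big by (intro conjI) (simp, blast)
      then show False using least[of "n - ?q' - ?q"] big qp by auto
    qed
    have z: "a \<le> z" "z < a + d" using nr by (auto simp: z_def)
    have \<rho>: "cf_rem \<alpha> (Suc k) > 0" using cf_rem_irrational by blast
    show False
    proof (cases "cf_err \<alpha> k > 0")
      case True
      then have "cf_err \<alpha> (Suc k) < 0" unfolding cf_err_Suc using \<rho> by (simp add: mult_pos_pos del: cf_rem.simps)
      then have e: "cf_err \<alpha> k = d" "cf_err \<alpha> (Suc k) = - d'" using True by (auto simp: d_def d'_def)
      \<comment> \<open>By \<open>n1\<close> the point z - d' lies below a. Then z - d' + d lies
        between a and a + d, against \<open>n2\<close>.\<close>
      show False using n1 n2 z d unfolding e by linarith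
    next
      case False
      then have "cf_err \<alpha> k < 0" using cf_err_bounds(1)[of k] by linarith
      moreover from this have "cf_err \<alpha> (Suc k) > 0" unfolding cf_err_Suc using \<rho> by (simp add: mult_pos_neg del: cf_rem.simps)
      ultimately have e: "cf_err \<alpha> k = - d" "cf_err \<alpha> (Suc k) = d'" by (auto simp: d_def d'_def)
      show False using n1 n2 z d unfolding e by linarith
    qed
  qed
  then have "int n \<le> int N0 + cf_q \<alpha> k + cf_q \<alpha> (Suc k)" using q by linarith
  moreover have "\<theta> - of_nat n * \<alpha> + of_int r < b" using nr len by (simp add: d_def)
  ultimately show ?thesis using that nr by blast
qed

text \<open>The phases of the word fill an interval whose length is 1 or of the form |l \<alpha> -
  r| with 0 < |l| < q'. By best approximation it is at least the error at \<open>k\<close>, as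
  \<open>orbit_hits_interval\<close> requires. Letters run to q' - 2 because \<open>N\<close> is
  controlled up to q' - 1.\<close>

lemma word_occurs_early:
  assumes w: "sturm \<alpha> w" and q: "cf_q \<alpha> (Suc k) \<ge> 2"
  obtains n :: nat where "n > N0" "int n \<le> int N0 + cf_q \<alpha> k + cf_q \<alpha> (Suc k)"
    "\<And>j. j \<in> {0..cf_q \<alpha> (Suc k) - 2} \<Longrightarrow> w j = vpot \<alpha> \<theta> (j - int n)"
proof -
  let ?q = "cf_q \<alpha> (Suc k)"
  obtain N where N: "\<And>j. w j = real_of_int (N (j + 1) - N j)" "\<And>i j. real_of_int (N i - N j - 1) < real_of_int (i - j) * \<alpha>"
    using w unfolding sturm_def by blast
  have q0: "?q - 1 \<ge> 0" using q by simp
  obtain i j where ij: "i \<in> {0..?q - 1}" "j \<in> {0..?q - 1}"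
    "real_of_int (N i) - real_of_int i * \<alpha> < real_of_int (N j) + 1 - real_of_int j * \<alpha>"
    "\<And>\<psi> k. \<lbrakk>real_of_int (N i) - real_of_int i * \<alpha> \<le> \<psi>; k \<in> {0..?q - 1}\<rbrakk> \<Longrightarrow> real_of_int (N k) \<le> real_of_int k * \<alpha> + \<psi>"
    "\<And>\<psi> k. \<lbrakk>\<psi> < real_of_int (N j) + 1 - real_of_int j * \<alpha>; k \<in> {0..?q - 1}\<rbrakk> \<Longrightarrow> real_of_int k * \<alpha> + \<psi> < real_of_int (N k) + 1"
    using phase_interval[where N = N, OF q0 N(2)] by metis
  let ?a = "real_of_int (N i) - real_of_int i * \<alpha>" and ?b = "real_of_int (N j) + 1 - real_of_int j * \<alpha>"
  have "?b - ?a \<ge> \<bar>cf_err \<alpha> k\<bar>"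
  proof (cases "i = j")
    case True then show ?thesis using cf_err_bounds(3)[of k] by simp
  next
    case False
    have eq: "?b - ?a = real_of_int (i - j) * \<alpha> - real_of_int (N i - N j - 1)" by (simp add: algebra_simps)
    have "\<bar>cf_err \<alpha> k\<bar> \<le> \<bar>real_of_int (i - j) * \<alpha> - real_of_int (N i - N j - 1)\<bar>"
      by (rule cf_best_approximation) (use False ij in auto)
    then show ?thesis using ij(3) unfolding eq[symmetric] by linarith
  qed
  then obtain n :: nat and r :: int where n: "n > N0" "int n \<le> int N0 + cf_q \<alpha> k + ?q"
    "?a \<le> \<theta> - of_nat n * \<alpha> + of_int r" "\<theta> - of_nat n * \<alpha> + of_int r < ?b"
    using orbit_hits_interval by metis
  have "w l = vpot \<alpha> \<theta> (l - int n)" if l: "l \<in> {0..?q - 2}" for l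
  proof -
    let ?\<psi> = "\<theta> - of_nat n * \<alpha> + of_int r"
    have l': "l \<in> {0..?q - 1}" "l + 1 \<in> {0..?q - 1}" using l by auto
    have "vpot \<alpha> ?\<psi> l = w l" unfolding N(1)[of l]
      by (rule vpot_eq_of_floor) (use ij(4)[OF n(3) l'(1)] ij(4)[OF n(3) l'(2)] ij(5)[OF n(4) l'(1)] ij(5)[OF n(4) l'(2)] \<alpha>0 \<alpha>1 in auto)
    then show ?thesis using vpot_shift[of \<alpha> \<theta> l "- int n"] by (simp add: vpot_add_of_int)
  qed
  then show ?thesis using that n by blast
qed

text \<open>Words of length q' - 1 do not distinguish \<alpha> from its convergent p'/q'. The
  rational rotation has period q' and, since p' is invertible modulo q', any two phases agree up to
  a time shift; both words are therefore read from one periodic sequence.\<close>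

lemma words_cyclic:
  assumes w1: "sturm \<alpha> w1" and w2: "sturm \<alpha> w2" and q: "cf_q \<alpha> (Suc k) \<ge> 2"
  obtains W t where "t \<in> {0..<cf_q \<alpha> (Suc k)}" "\<And>j. W (j + cf_q \<alpha> (Suc k)) = W j"
    "\<And>j. j \<in> {0..cf_q \<alpha> (Suc k) - 2} \<Longrightarrow> w1 j = W j" "\<And>j. j \<in> {0..cf_q \<alpha> (Suc k) - 2} \<Longrightarrow> w2 j = W (j + t)"
proof -
  let ?q = "cf_q \<alpha> (Suc k)" and ?p = "cf_p \<alpha> (Suc k)"
  define \<beta> where "\<beta> = real_of_int ?p / real_of_int ?q"
  \<comment> \<open>Replacing \<alpha> by \<beta> moves l \<alpha> by less than the error at
    \<open>k\<close>, which by best approximation is at most the distance of l \<alpha> to any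
    integer.\<close>
  have co: "real_of_int M < real_of_int l * \<beta>" if "\<bar>l\<bar> < ?q" "real_of_int M < real_of_int l * \<alpha>" for l M
  proof (cases "l = 0")
    case False
    have "\<bar>real_of_int l * \<beta> - real_of_int l * \<alpha>\<bar> = \<bar>real_of_int l\<bar> / real_of_int ?q * \<bar>cf_err \<alpha> (Suc k)\<bar>"
    proof -
      have "real_of_int l * \<beta> - real_of_int l * \<alpha> = - (real_of_int l / real_of_int ?q * cf_err \<alpha> (Suc k))"
        using q by (simp add: \<beta>_def cf_err_def field_simps del: cf_p.simps cf_q.simps)
      then show ?thesis using q by (simp add: abs_mult)
    qed
    also have "\<dots> \<le> 1 * \<bar>cf_err \<alpha> (Suc k)\<bar>" using that(1) q by (intro mult_right_mono) auto
    also have "\<dots> < \<bar>cf_err \<alpha> k\<bar>" using cf_err_bounds(2) by simp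
    also have "\<dots> \<le> \<bar>real_of_int l * \<alpha> - real_of_int M\<bar>" by (rule cf_best_approximation[OF False that(1)])
    finally show ?thesis using that(2) by linarith
  qed (use that in simp)
  have p: "0 \<le> \<beta>" "\<beta> \<le> 1"
  proof -
    have "real_of_int (-1) < real_of_int 1 * \<beta>" by (rule co) (use q \<alpha>0 in auto)
    moreover have "real_of_int (-2) < real_of_int (-1) * \<beta>" by (rule co) (use q \<alpha>1 in auto)
    moreover have "real_of_int 0 < real_of_int 1 * \<beta>" by (rule co) (use q \<alpha>0 in auto)
    moreover have "real_of_int (-1) < real_of_int (-1) * \<beta>" by (rule co) (use q \<alpha>1 in auto)
    ultimately show "0 \<le> \<beta>" "\<beta> \<le> 1" by auto
  qed
  have ph: "\<exists>\<psi>. \<forall>j\<in>{0..?q - 2}. w j = vpot \<beta> \<psi> j" if w: "sturm \<alpha> w" for w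
  proof -
    obtain N where N: "\<And>j. w j = real_of_int (N (j + 1) - N j)" "\<And>i j. real_of_int (N i - N j - 1) < real_of_int (i - j) * \<alpha>"
      using w unfolding sturm_def by blast
    have N\<beta>: "real_of_int (N i - N j - 1) < real_of_int (i - j) * \<beta>" if "i \<in> {0..?q - 1}" "j \<in> {0..?q - 1}" for i j
      by (rule co[OF _ N(2)]) (use that in auto)
    have q0: "?q - 1 \<ge> 0" using q by simp
    obtain i j where ij: "i \<in> {0..?q - 1}" "j \<in> {0..?q - 1}"
      "real_of_int (N i) - real_of_int i * \<beta> < real_of_int (N j) + 1 - real_of_int j * \<beta>"
      "\<And>\<psi> k. \<lbrakk>real_of_int (N i) - real_of_int i * \<beta> \<le> \<psi>; k \<in> {0..?q - 1}\<rbrakk> \<Longrightarrow> real_of_int (N k) \<le> real_of_int k * \<beta> + \<psi>"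
      "\<And>\<psi> k. \<lbrakk>\<psi> < real_of_int (N j) + 1 - real_of_int j * \<beta>; k \<in> {0..?q - 1}\<rbrakk> \<Longrightarrow> real_of_int k * \<beta> + \<psi> < real_of_int (N k) + 1"
      using phase_interval[where N = N, OF q0 N\<beta>] by metis
    let ?\<psi> = "real_of_int (N i) - real_of_int i * \<beta>"
    have "w l = vpot \<beta> ?\<psi> l" if l: "l \<in> {0..?q - 2}" for l
    proof -
      have l': "l \<in> {0..?q - 1}" "l + 1 \<in> {0..?q - 1}" using l by auto
      have "vpot \<beta> ?\<psi> l = w l" unfolding N(1)[of l]
        by (rule vpot_eq_of_floor) (use ij(4)[OF order_refl l'(1)] ij(4)[OF order_refl l'(2)] ij(5)[OF ij(3) l'(1)] ij(5)[OF ij(3) l'(2)] p in auto)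
      then show ?thesis by simp
    qed
    then show ?thesis by blast
  qed
  obtain \<psi>1 where \<psi>1: "\<And>j. j \<in> {0..?q - 2} \<Longrightarrow> w1 j = vpot \<beta> \<psi>1 j" using ph[OF w1] by blast
  obtain \<psi>2 where \<psi>2: "\<And>j. j \<in> {0..?q - 2} \<Longrightarrow> w2 j = vpot \<beta> \<psi>2 j" using ph[OF w2] by blast
  \<comment> \<open>A phase enters only through the integer part of q' \<psi>, so comparing phases
    becomes arithmetic modulo q'.\<close>
  have fl: "\<lfloor>real_of_int j * \<beta> + \<psi>\<rfloor> = (j * ?p + \<lfloor>real_of_int ?q * \<psi>\<rfloor>) div ?q" for j \<psi>
  proof -
    have "real_of_int j * \<beta> + \<psi> = (real_of_int (j * ?p) + real_of_int ?q * \<psi>) / real_of_int ?q"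
      using q by (simp add: \<beta>_def field_simps)
    then have "\<lfloor>real_of_int j * \<beta> + \<psi>\<rfloor> = \<lfloor>real_of_int ?q * \<psi> + real_of_int (j * ?p)\<rfloor> div ?q"
      using q by (simp only: floor_divide_real_eq_div add.commute)
    also have "\<lfloor>real_of_int ?q * \<psi> + real_of_int (j * ?p)\<rfloor> = j * ?p + \<lfloor>real_of_int ?q * \<psi>\<rfloor>"
      unfolding floor_add_int[symmetric] by (rule add.commute)
    finally show ?thesis .
  qed
  define r1 where "r1 = \<lfloor>real_of_int ?q * \<psi>1\<rfloor>"
  define r2 where "r2 = \<lfloor>real_of_int ?q * \<psi>2\<rfloor>"
  define s :: int where "s = (-1) ^ k"
  have s: "s * s = 1" by (simp add: s_def flip: power_add)
  have det: "?p * cf_q \<alpha> k = s + cf_p \<alpha> k * ?q" using cf_det[of k] by (simp add: s_def algebra_simps)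
  \<comment> \<open>By the determinant identity s q_k inverts p' modulo q'; thus t p' is congruent
    to r2 - r1.\<close>
  define t where "t = (s * cf_q \<alpha> k * (r2 - r1)) mod ?q"
  have t: "t \<in> {0..<?q}" using q by (simp add: t_def)
  have "t * ?p mod ?q = (r2 - r1) mod ?q"
  proof -
    have "t * ?p mod ?q = (s * cf_q \<alpha> k * (r2 - r1)) * ?p mod ?q" by (simp add: t_def mod_mult_left_eq)
    also have "(s * cf_q \<alpha> k * (r2 - r1)) * ?p = s * (r2 - r1) * (?p * cf_q \<alpha> k)" by simp
    also have "\<dots> = (r2 - r1) * (s * s) + (s * (r2 - r1) * cf_p \<alpha> k) * ?q" unfolding det by (simp add: algebra_simps)
    also have "\<dots> mod ?q = (r2 - r1) mod ?q" by (simp add: s)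
    finally show ?thesis .
  qed
  then have "?q dvd (t * ?p - (r2 - r1))" by (simp add: mod_eq_dvd_iff)
  then obtain m where m: "t * ?p - (r2 - r1) = ?q * m" by (rule dvdE)
  have sh: "\<lfloor>real_of_int (j + t) * \<beta> + \<psi>1\<rfloor> = \<lfloor>real_of_int j * \<beta> + \<psi>2\<rfloor> + m" for j
  proof -
    have "(j + t) * ?p + r1 = (j * ?p + r2) + ?q * m" using m by (simp add: algebra_simps)
    then show ?thesis unfolding fl r1_def[symmetric] r2_def[symmetric] using q by simp
  qed
  have per: "\<lfloor>real_of_int (j + ?q) * \<beta> + \<psi>1\<rfloor> = \<lfloor>real_of_int j * \<beta> + \<psi>1\<rfloor> + ?p" for j
  proof -
    have eq: "(j + ?q) * ?p + r1 = (j * ?p + r1) + ?q * ?p" by (simp add: algebra_simps)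
    show ?thesis unfolding fl r1_def[symmetric] eq using q by (subst div_mult_self2) auto
  qed
  show ?thesis
  proof (rule that[of t "vpot \<beta> \<psi>1"])
    show "vpot \<beta> \<psi>1 (j + ?q) = vpot \<beta> \<psi>1 j" for j
      using per[of j] per[of "j + 1"] vpot_floor[OF p, of \<psi>1 j] vpot_floor[OF p, of \<psi>1 "j + ?q"]
      by (simp add: ac_simps del: cf_p.simps cf_q.simps of_int_add)
    show "w2 j = vpot \<beta> \<psi>1 (j + t)" if "j \<in> {0..?q - 2}" for j
      using sh[of j] sh[of "j + 1"] vpot_floor[OF p, of \<psi>2 j] vpot_floor[OF p, of \<psi>1 "j + t"] \<psi>2[OF that]
      by (simp add: ac_simps del: of_int_add)
  qed (use t \<psi>1 in auto)
qed

end

section \<open>Uniform lower bounds\<close>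

text \<open>If the maximiser is at least 4/c0 away from the boundary, its tent does not reach the
  boundary and the bound on the line applies. Otherwise a tent of radius 4/c stays within the common
  word, where \<open>w\<close> can replace \<open>v\<close>.\<close>

lemma lower_bound_nearby:
  assumes U: "lower_bound lam c0 v UNIV" "c0 > 0" and w: "lower_bound lam c w {0..}" "c > 0"
    and eq: "\<And>j. j \<in> {0..n} \<Longrightarrow> v j = w j" and n: "real_of_int n \<ge> 4 / c0 + 4 / c"
  shows "lower_bound lam (min c0 c / 2) v {0..}"
proof (rule lower_boundI)
  fix x M m
  assume x: "finite {n. x n \<noteq> 0}" "\<And>n. n \<notin> {0..} \<Longrightarrow> x n = 0"
    "\<And>n. n \<in> {0..} \<Longrightarrow> norm (schr_op v lam x n) \<le> M"
  have M: "0 \<le> M" using x(3)[of 0] by (auto intro: order_trans[OF norm_ge_zero])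
  obtain k where k: "\<And>n. norm (x n) \<le> norm (x k)" using finite_support_argmax[OF x(1)] by metis
  have res: "norm (schr_op v lam (\<lambda>n. of_real (tent k R n) * x n) n) \<le> M + 2 * norm (x k) / R"
    if "R > 0" "n \<ge> 0 \<or> tent k R n = 0" for R n
  proof -
    have "tent k R n * norm (schr_op v lam x n) \<le> M"
    proof (cases "n \<ge> 0")
      case True
      then have "tent k R n * norm (schr_op v lam x n) \<le> 1 * M"
        using tent_bounds(1,2)[OF that(1)] x(3) M by (intro mult_mono) auto
      then show ?thesis by simp
    qed (use that M in auto)
    then show ?thesis using norm_schr_op_tent[where x = x, OF that(1) k, of v lam k n] by linarith
  qed
  have supp: "finite {n. of_real (tent k R n) * x n \<noteq> 0}" for R by (rule finite_subset[OF _ x(1)]) auto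
  have "min c0 c / 2 * norm (x k) \<le> M"
  proof (cases "real_of_int k \<ge> 4 / c0")
    case True
    define R where "R = 4 / c0"
    have R: "R > 0" "2 * norm (x k) / R = c0 / 2 * norm (x k)" using U by (auto simp: R_def)
    let ?y = "\<lambda>n. of_real (tent k R n) * x n"
    have "c0 * norm (?y k) \<le> M + 2 * norm (x k) / R"
    proof (rule lower_boundD[OF U(1) supp])
      fix n :: int
      have "tent k R n = 0" if "n < 0" by (rule tent_eq_0[OF R(1)]) (use that True in \<open>auto simp: R_def\<close>)
      then show "norm (schr_op v lam ?y n) \<le> M + 2 * norm (x k) / R" by (intro res R) linarith
    qed simp
    then have "c0 / 2 * norm (x k) \<le> M" using R by (simp add: tent_bounds)
    moreover have "min c0 c / 2 * norm (x k) \<le> c0 / 2 * norm (x k)" by (intro mult_right_mono) auto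
    ultimately show ?thesis by linarith
  next
    case False
    define R where "R = 4 / c"
    have R: "R > 0" "2 * norm (x k) / R = c / 2 * norm (x k)" using w by (auto simp: R_def)
    let ?y = "\<lambda>n. of_real (tent k R n) * x n"
    have "v j = w j" if "?y j \<noteq> 0" for j
    proof (rule eq)
      have "j \<ge> 0" using that x(2)[of j] by force
      moreover have "\<not> R \<le> \<bar>real_of_int (j - k)\<bar>" using that tent_eq_0[OF R(1)] by auto
      then have "real_of_int j \<le> real_of_int n" using n False by (simp add: R_def)
      ultimately show "j \<in> {0..n}" by simp
    qed
    then have eq': "schr_op v lam ?y = schr_op w lam ?y" by (rule schr_op_cong)
    have "c * norm (?y k) \<le> M + 2 * norm (x k) / R"
      by (rule lower_boundD[OF w(1) supp]) (use x(2) res[OF R(1)] eq' in \<open>auto simp: fun_eq_iff\<close>)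
    then have "c / 2 * norm (x k) \<le> M" using R by (simp add: tent_bounds)
    moreover have "min c0 c / 2 * norm (x k) \<le> c / 2 * norm (x k)" by (intro mult_right_mono) auto
    ultimately show ?thesis by linarith
  qed
  moreover have "min c0 c / 2 * norm (x m) \<le> min c0 c / 2 * norm (x k)" using k U w by (intro mult_left_mono) auto
  ultimately show "min c0 c / 2 * norm (x m) \<le> M" by linarith
qed

text \<open>Phases slightly to the right share a long word with \<open>vpot\<close>, phases slightly
  to the left with \<open>vpot_tilde\<close>; the bound on the line takes care of the sites beyond
  that word. The resulting neighbourhoods have a finite subcover.\<close>

lemma uniform_lower_bound:
  assumes \<alpha>: "\<alpha> \<notin> \<rat>" "0 < \<alpha>" "\<alpha> < 1"
    and U: "\<And>v. sturm \<alpha> v \<Longrightarrow> lower_bound lam c0 v UNIV" "c0 > 0"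
    and pw: "\<And>\<psi>. \<exists>c>0. lower_bound lam c (vpot \<alpha> \<psi>) {0..}" "\<And>\<psi>. \<exists>c>0. lower_bound lam c (vpot_tilde \<alpha> \<psi>) {0..}"
  shows "\<exists>c>0. \<forall>v. sturm \<alpha> v \<longrightarrow> lower_bound lam c v {0..}"
proof -
  have "\<exists>\<delta>>0. \<exists>c>0. \<forall>\<psi>'. \<psi> - \<delta> < \<psi>' \<and> \<psi>' < \<psi> + \<delta> \<longrightarrow> lower_bound lam c (vpot \<alpha> \<psi>') {0..}" for \<psi>
  proof -
    obtain c1 c2 where c: "c1 > 0" "lower_bound lam c1 (vpot \<alpha> \<psi>) {0..}" "c2 > 0" "lower_bound lam c2 (vpot_tilde \<alpha> \<psi>) {0..}"
      using pw by blast
    define n where "n = \<lceil>4 / c0 + 4 / c1 + 4 / c2\<rceil>"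
    have nn: "real_of_int n \<ge> 4 / c0 + 4 / c1 + 4 / c2" unfolding n_def by (rule le_of_int_ceiling)
    have pos: "4 / c0 > 0" "4 / c1 > 0" "4 / c2 > 0" using c U(2) by auto
    have n: "real_of_int n \<ge> 4 / c0 + 4 / c1" "real_of_int n \<ge> 4 / c0 + 4 / c2" "n \<ge> 0"
      using nn pos by linarith+
    obtain \<delta> where \<delta>: "\<delta> > 0"
      "\<And>\<psi>' j. \<lbrakk>\<psi> \<le> \<psi>'; \<psi>' < \<psi> + \<delta>; j \<in> {0..n}\<rbrakk> \<Longrightarrow> vpot \<alpha> \<psi>' j = vpot \<alpha> \<psi> j"
      "\<And>\<psi>' j. \<lbrakk>\<psi> - \<delta> < \<psi>'; \<psi>' < \<psi>; j \<in> {0..n}\<rbrakk> \<Longrightarrow> vpot \<alpha> \<psi>' j = vpot_tilde \<alpha> \<psi> j"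
      by (rule vpot_near_phase[OF \<alpha>(2,3) n(3), of \<psi>]) (rule that; blast)
    define c where "c = min c0 (min c1 c2) / 2"
    have cp: "c > 0" using c U(2) by (simp add: c_def)
    have "lower_bound lam c (vpot \<alpha> \<psi>') {0..}" if h: "\<psi> - \<delta> < \<psi>'" "\<psi>' < \<psi> + \<delta>" for \<psi>'
    proof -
      have st: "sturm \<alpha> (vpot \<alpha> \<psi>')" using \<alpha> by (intro sturm_vpot) auto
      show ?thesis
      proof (cases "\<psi> \<le> \<psi>'")
        case True
        have "lower_bound lam (min c0 c1 / 2) (vpot \<alpha> \<psi>') {0..}"
          by (rule lower_bound_nearby[OF U(1)[OF st] U(2) c(2,1) _ n(1)]) (use \<delta>(2)[OF True] h in auto)
        then show ?thesis by (rule lower_bound_mono) (simp add: c_def)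
      next
        case False
        have "lower_bound lam (min c0 c2 / 2) (vpot \<alpha> \<psi>') {0..}"
          by (rule lower_bound_nearby[OF U(1)[OF st] U(2) c(4,3) _ n(2)]) (use \<delta>(3)[OF h(1)] False in auto)
        then show ?thesis by (rule lower_bound_mono) (simp add: c_def)
      qed
    qed
    then show ?thesis using \<delta>(1) cp by blast
  qed
  then obtain \<delta> c where \<delta>: "\<And>\<psi>. \<delta> \<psi> > 0" "\<And>\<psi>. c \<psi> > 0"
    "\<And>\<psi> \<psi>'. \<psi> - \<delta> \<psi> < \<psi>' \<and> \<psi>' < \<psi> + \<delta> \<psi> \<Longrightarrow> lower_bound lam (c \<psi>) (vpot \<alpha> \<psi>') {0..}" by metis
  have "compact {0..1::real}" by simp
  then obtain D where D: "D \<subseteq> {0..1}" "finite D" "{0..1} \<subseteq> (\<Union>\<psi>\<in>D. {\<psi> - \<delta> \<psi> <..< \<psi> + \<delta> \<psi>})"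
  proof (rule compactE_image[of "{0..1}" "{0..1}" "\<lambda>\<psi>. {\<psi> - \<delta> \<psi> <..< \<psi> + \<delta> \<psi>}"])
    show "{0..1} \<subseteq> (\<Union>\<psi>\<in>{0..1}. {\<psi> - \<delta> \<psi> <..< \<psi> + \<delta> \<psi>})"
    proof
      fix t :: real assume "t \<in> {0..1}"
      then show "t \<in> (\<Union>\<psi>\<in>{0..1}. {\<psi> - \<delta> \<psi> <..< \<psi> + \<delta> \<psi>})"
        using \<delta>(1)[of t] by (intro UN_I[of t]) simp_all
    qed
  qed auto
  have "D \<noteq> {}" using D(3) by fastforce
  define c' where "c' = Min (c ` D)"
  have c': "c' > 0" unfolding c'_def using D \<open>D \<noteq> {}\<close> \<delta>(2) by simp
  have u: "lower_bound lam c' (vpot \<alpha> \<psi>) {0..}" if \<psi>: "\<psi> \<in> {0..1}" for \<psi>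
  proof -
    have "\<psi> \<in> (\<Union>\<psi>\<in>D. {\<psi> - \<delta> \<psi> <..< \<psi> + \<delta> \<psi>})" using D(3) \<psi> by blast
    then obtain \<psi>0 where \<psi>0: "\<psi>0 \<in> D" "\<psi>0 - \<delta> \<psi>0 < \<psi>" "\<psi> < \<psi>0 + \<delta> \<psi>0" by auto
    have "lower_bound lam (c \<psi>0) (vpot \<alpha> \<psi>) {0..}" using \<delta>(3) \<psi>0 by blast
    moreover have "c' \<le> c \<psi>0" unfolding c'_def using D \<psi>0 by (intro Min_le) auto
    ultimately show ?thesis by (rule lower_bound_mono)
  qed
  \<comment> \<open>Every word of a coded sequence occurs in the orbit of phase 0, so the bound for
    all phases in [0,1] is enough.\<close>
  have "lower_bound lam c' v {0..}" if v: "sturm \<alpha> v" for v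
  proof (rule lower_bound_of_words)
    fix n :: int assume n: "n \<ge> 0"
    obtain k where k: "\<And>j. j \<in> {0..n} \<Longrightarrow> v j = vpot \<alpha> 0 (j + k)"
      using sturm_word_occurs[OF \<alpha> n v] by metis
    have "vpot \<alpha> 0 (j + k) = vpot \<alpha> (frac (of_int k * \<alpha>)) j" for j by (simp add: vpot_shift vpot_frac)
    then show "\<exists>w. lower_bound lam c' w {0..} \<and> (\<forall>j\<in>{0..n}. v j = w j)"
      using k u[of "frac (of_int k * \<alpha>)"] frac_lt_1[of "of_int k * \<alpha>"] by (intro exI[of _ "vpot \<alpha> (frac (of_int k * \<alpha>))"]) auto
  qed
  then show ?thesis using c' by blast
qed

text \<open>Words can be found at positions k > 0, where a half line looks like the whole
  line.\<close>

lemma half_line_to_UNIV: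
  assumes \<alpha>: "\<alpha> \<notin> \<rat>" "0 < \<alpha>" "\<alpha> < 1" and lb: "lower_bound lam c (vpot \<alpha> \<theta>) I" and I: "{0..} \<subseteq> I" and v: "sturm \<alpha> v"
  shows "lower_bound lam c v UNIV"
proof (rule lower_bound_UNIV_of_words[OF lb])
  fix n s :: int assume n: "n \<ge> 0"
  obtain k where k: "k > 0" "\<And>j. j \<in> {0..n} \<Longrightarrow> v (j + s) = vpot \<alpha> \<theta> (j + k)"
    using sturm_word_occurs[OF \<alpha> n sturm_shift[OF v, of s]] by metis
  then show "\<exists>k. {k..k + n} \<subseteq> I \<and> (\<forall>j\<in>{0..n}. v (j + s) = vpot \<alpha> \<theta> (j + k))"
    using I by (intro exI[of _ k]) auto
qed

section \<open>Boundedness and decay of Dirichlet solutions\<close>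

definition dir_sol :: "real \<Rightarrow> (int \<Rightarrow> real) \<Rightarrow> nat \<Rightarrow> real" where
  "dir_sol lam w = shoot (\<lambda>n. lam * w (int n)) (\<lambda>_. 0) 1"

lemma dir_sol_simps: "dir_sol lam w 0 = 0" "dir_sol lam w (Suc 0) = 1"
  "dir_sol lam w (Suc (Suc n)) = - dir_sol lam w n - lam * w (int n) * dir_sol lam w (Suc n)"
  by (simp_all add: dir_sol_def)

text \<open>Index n of \<open>dir_sol\<close> stands for the site n - 1, so index 0 carries the
  condition at -1. The deviation of \<open>x\<close> from a multiple of this solution obeys the same
  recurrence with forcing at most \<open>M\<close>, so its bound grows by a factor 2 + |lam| per
  step.\<close>

lemma near_dirichlet:
  assumes w: "\<And>n. \<bar>w n\<bar> \<le> 1" and x: "x (-1) = 0" "\<And>n. n \<ge> 0 \<Longrightarrow> norm (schr_op w lam x n) \<le> M" and M: "M \<ge> 0"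
  shows "norm (x (int n - 1) - x 0 * of_real (dir_sol lam w n)) \<le> (2 + \<bar>lam\<bar>) ^ n * M"
proof (induction n rule: induct_nat_012)
  case 0
  then show ?case using x M by (simp add: dir_sol_simps)
next
  case 1
  then show ?case using M by (simp add: dir_sol_simps)
next
  case (ge2 n)
  let ?L = "2 + \<bar>lam\<bar>"
  let ?e = "\<lambda>n. x (int n - 1) - x 0 * of_real (dir_sol lam w n)"
  have "schr_op w lam x (int n) = x (int n + 1) + x (int n - 1) + of_real (lam * w (int n)) * x (int n)"
    by (simp add: schr_op_def)
  then have eq: "?e (Suc (Suc n)) = schr_op w lam x (int n) - ?e n - of_real (lam * w (int n)) * ?e (Suc n)"
    by (simp add: dir_sol_simps algebra_simps)
  have "norm (?e (Suc (Suc n))) \<le> norm (schr_op w lam x (int n)) + norm (?e n) + norm (of_real (lam * w (int n)) * ?e (Suc n))"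
    unfolding eq by (rule order_trans[OF norm_triangle_ineq4 add_right_mono[OF norm_triangle_ineq4]])
  also have "\<dots> \<le> ?L ^ Suc n * M + ?L ^ Suc n * M + \<bar>lam\<bar> * (?L ^ Suc n * M)"
  proof (intro add_mono)
    have "1 * M \<le> ?L ^ Suc n * M" using M by (intro mult_right_mono one_le_power) auto
    then show "norm (schr_op w lam x (int n)) \<le> ?L ^ Suc n * M" using x(2)[of "int n"] by simp
    have "?L ^ n * M \<le> ?L ^ Suc n * M" using M by (intro mult_right_mono power_increasing) auto
    then show "norm (?e n) \<le> ?L ^ Suc n * M" using ge2(1) by linarith
    have "norm (of_real (lam * w (int n)) * ?e (Suc n)) = \<bar>lam\<bar> * \<bar>w (int n)\<bar> * norm (?e (Suc n))"
      by (simp add: norm_mult abs_mult)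
    also have "\<dots> \<le> \<bar>lam\<bar> * 1 * (?L ^ Suc n * M)" using ge2(2) w by (intro mult_mono) auto
    finally show "norm (of_real (lam * w (int n)) * ?e (Suc n)) \<le> \<bar>lam\<bar> * (?L ^ Suc n * M)" by simp
  qed
  also have "\<dots> = ?L ^ Suc (Suc n) * M" by (simp add: algebra_simps)
  finally show ?case .
qed

text \<open>An unbounded solution would yield a lower bound. A maximiser far from 0 is treated on
  the line. Near 0, \<open>x\<close> follows \<open>x 0\<close> times the solution; as some |s J|
  exceeds twice all early values, the maximality of \<open>x k\<close> forces
  \<open>norm (x 0) * S\<close> below half of it, up to the residual.\<close>

lemma dir_sol_bounded:
  assumes w: "\<And>n. \<bar>w n\<bar> \<le> 1" and U: "lower_bound lam c0 w UNIV" "c0 > 0"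
    and no: "\<And>c. c > 0 \<Longrightarrow> \<not> lower_bound lam c w {0..}"
  shows "\<exists>B. \<forall>n. \<bar>dir_sol lam w n\<bar> \<le> B"
proof (rule ccontr)
  assume unb: "\<nexists>B. \<forall>n. \<bar>dir_sol lam w n\<bar> \<le> B"
  let ?s = "dir_sol lam w" and ?L = "2 + \<bar>lam\<bar>"
  define r where "r = nat \<lceil>4 / c0\<rceil>"
  define S where "S = (\<Sum>i\<le>r + 1. \<bar>?s i\<bar>) + 1"
  have S: "S \<ge> 1" by (simp add: S_def sum_nonneg)
  have Si: "\<bar>?s i\<bar> \<le> S" if "i \<le> r + 1" for i
    using member_le_sum[of i "{..r + 1}" "\<lambda>i. \<bar>?s i\<bar>"] that by (simp add: S_def)
  obtain J where J: "\<bar>?s J\<bar> > 2 * S" using unb by (metis not_le)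
  \<comment> \<open>The first two terms come from maximisers near the boundary, after absorbing half
    of the maximum; 2/c0 comes from those treated on the line.\<close>
  define K where "K = ?L ^ J + 2 * ?L ^ (r + 1) + 2 / c0"
  have K: "K > 0" unfolding K_def using U by (intro add_pos_pos) auto
  have "lower_bound lam (1 / K) w {0..}"
  proof (rule lower_boundI)
    fix x M m
    assume x: "finite {n. x n \<noteq> 0}" "\<And>n. n \<notin> {0..} \<Longrightarrow> x n = 0"
      "\<And>n. n \<in> {0..} \<Longrightarrow> norm (schr_op w lam x n) \<le> M"
    have M: "0 \<le> M" using x(3)[of 0] by (auto intro: order_trans[OF norm_ge_zero])
    obtain k where k: "\<And>n. norm (x n) \<le> norm (x k)" using finite_support_argmax[OF x(1)] by metis
    have "norm (x k) \<le> K * M"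
    proof (cases "real_of_int k \<ge> 4 / c0")
      case True
      define R where "R = 4 / c0"
      have R: "R > 0" "2 * norm (x k) / R = c0 / 2 * norm (x k)" using U by (auto simp: R_def)
      let ?y = "\<lambda>n. of_real (tent k R n) * x n"
      have "c0 * norm (?y k) \<le> M + c0 / 2 * norm (x k)"
      proof (rule lower_boundD[OF U(1), where x = ?y])
        show "finite {n. ?y n \<noteq> 0}" by (rule finite_subset[OF _ x(1)]) auto
        fix n :: int
        have "tent k R n * norm (schr_op w lam x n) \<le> M"
        proof (cases "n \<ge> 0")
          case n: True
          have "tent k R n * norm (schr_op w lam x n) \<le> 1 * M"
            using tent_bounds(1,2)[OF R(1)] x(3) M n by (intro mult_mono) auto
          then show ?thesis by simp
        next
          case False
          then have "tent k R n = 0" by (intro tent_eq_0[OF R(1)]) (use True in \<open>auto simp: R_def\<close>)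
          then show ?thesis using M by simp
        qed
        then show "norm (schr_op w lam ?y n) \<le> M + c0 / 2 * norm (x k)"
          using norm_schr_op_tent[where x = x, OF R(1) k, of w lam k n] R by linarith
      qed simp
      then have "norm (x k) \<le> 2 / c0 * M" using U by (simp add: tent_bounds field_simps)
      also have "\<dots> \<le> K * M" using M by (intro mult_right_mono) (auto simp: K_def)
      finally show ?thesis .
    next
      case False
      have x1: "x (-1) = 0" using x(2) by simp
      have near': "norm (x (int n - 1) - x 0 * of_real (?s n)) \<le> ?L ^ n * M" for n
        by (rule near_dirichlet) (use w x1 M x(3) in auto)
      show ?thesis
      proof (cases "k \<ge> 0")
        case neg: False
        then have "norm (x k) = 0" using x(2) by simp
        then show ?thesis using K M by simp
      next
        case k0: True
        define i where "i = nat k + 1"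
        have i: "int i - 1 = k" "i \<le> r + 1" using k0 False by (auto simp: i_def r_def) linarith
        have "norm (x k) \<le> norm (x 0) * \<bar>?s i\<bar> + ?L ^ i * M"
          using near'[of i] norm_triangle_sub[of "x k" "x 0 * of_real (?s i)"] unfolding i(1) by (simp add: norm_mult)
        also have "\<dots> \<le> norm (x 0) * S + ?L ^ (r + 1) * M"
          using Si[OF i(2)] i(2) M by (intro add_mono mult_left_mono mult_right_mono power_increasing) auto
        finally have 1: "norm (x k) \<le> norm (x 0) * S + ?L ^ (r + 1) * M" .
        have "norm (x 0) * \<bar>?s J\<bar> \<le> norm (x (int J - 1)) + ?L ^ J * M"
          using near'[of J] norm_triangle_sub[of "x 0 * of_real (?s J)" "x (int J - 1)"] by (simp add: norm_mult norm_minus_commute)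
        then have "norm (x 0) * \<bar>?s J\<bar> \<le> norm (x k) + ?L ^ J * M" using k[of "int J - 1"] by linarith
        moreover have "norm (x 0) * (2 * S) \<le> norm (x 0) * \<bar>?s J\<bar>" using J by (intro mult_left_mono) auto
        ultimately have "norm (x k) \<le> (?L ^ J + 2 * ?L ^ (r + 1)) * M" using 1 by (simp add: algebra_simps)
        also have "\<dots> \<le> K * M" using M U by (intro mult_right_mono) (auto simp: K_def)
        finally show ?thesis .
      qed
    qed
    then have "norm (x m) \<le> K * M" using k[of m] by linarith
    then show "1 / K * norm (x m) \<le> M" using K by (simp add: field_simps)
  qed
  then show False using no[of "1 / K"] K by simp
qed

text \<open>The solution is cut to the sites m..R and weighted with a peak at \<open>l\<close>. The
  residual at the left cut carries the factor exp (-\<epsilon> (l - m)); that at the right cut is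
  bounded by \<open>B\<close> and its weight vanishes as R tends to infinity.\<close>

lemma dir_sol_decay:
  assumes U: "lower_bound lam c0 w UNIV" "c0 > 0" and B: "\<And>n. \<bar>dir_sol lam w n\<bar> \<le> B"
    and e: "\<epsilon> > 0" "2 * (exp \<epsilon> - 1) \<le> c0 / 2" and ml: "m \<le> l"
  shows "\<bar>dir_sol lam w (Suc l)\<bar> \<le> 2 / c0 * (exp (-\<epsilon> * (real l - real m)) * (\<bar>dir_sol lam w m\<bar> + \<bar>dir_sol lam w (Suc m)\<bar>))"
proof -
  let ?s = "dir_sol lam w"
  define P where "P = exp (-\<epsilon> * (real l - real m)) * (\<bar>?s m\<bar> + \<bar>?s (Suc m)\<bar>)"
  have B0: "B \<ge> 0" using B[of 0] by linarith
  have "c0 / 2 * \<bar>?s (Suc l)\<bar> \<le> P + B * exp (-\<epsilon> * real i)" for i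
  proof -
    define R where "R = l + i + 1"
    define z where "z = (\<lambda>n::int. if int m \<le> n \<and> n \<le> int R then complex_of_real (?s (nat (n + 1))) else 0)"
    define wt where "wt = (\<lambda>n::int. (-1) * (\<epsilon> * \<bar>real_of_int (n - int l)\<bar>))"
    have wt: "\<bar>wt (n + 1) - wt n\<bar> \<le> \<epsilon>" for n unfolding wt_def by (rule abs_weight_lipschitz) (use e in auto)
    define y where "y = (\<lambda>n. of_real (exp (wt n)) * z n)"
    have ny: "norm (y n) = exp (wt n) * norm (z n)" for n by (simp add: norm_mult y_def)
    have fin: "finite {n. y n \<noteq> 0}" by (rule finite_subset[of _ "{int m..int R}"]) (auto simp: y_def z_def)
    obtain k where k: "\<And>n. norm (y n) \<le> norm (y k)" using finite_support_argmax[OF fin] by metis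
    have rec: "?s (Suc (Suc j)) = - ?s j - lam * w (int j) * ?s (Suc j)" for j by (rule dir_sol_simps)
    \<comment> \<open>Each cut leaves a residual at two sites, m - 1 and m on the left, R and R + 1
      on the right; elsewhere the recurrence cancels it.\<close>
    have Az: "exp (wt n) * norm (schr_op w lam z n) \<le> P + B * exp (-\<epsilon> * real i)" for n
    proof -
      have P0: "P \<ge> 0" by (simp add: P_def)
      have BE: "B * exp (-\<epsilon> * real i) \<ge> 0" using B0 by simp
      consider "n < int m - 1 \<or> n > int R + 1" | "n = int m - 1" | "n = int m" | "int m < n" "n < int R" | "n = int R" | "n = int R + 1"
        by linarith
      then show ?thesis
      proof cases
        case 1
        then have "schr_op w lam z n = 0" by (auto simp: schr_op_def z_def)
        then show ?thesis using P0 BE by simp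
      next
        case 2
        then have "schr_op w lam z n = of_real (?s (Suc m))" using ml by (auto simp: schr_op_def z_def R_def nat_add_distrib)
        then have "exp (wt n) * norm (schr_op w lam z n) \<le> exp (-\<epsilon> * (real l - real m)) * \<bar>?s (Suc m)\<bar>"
          using 2 e ml by (simp add: wt_def mult_left_mono mult_right_mono)
        also have "\<dots> \<le> P" unfolding P_def by (intro mult_left_mono) auto
        finally show ?thesis using BE by linarith
      next
        case 3
        have "nat (int m + 1 + 1) = Suc (Suc m)" "nat (int m + 1) = Suc m" by auto
        then have "schr_op w lam z n = of_real (?s (Suc (Suc m))) + of_real (lam * w (int m)) * of_real (?s (Suc m))"
          using 3 ml by (simp add: schr_op_def z_def R_def)
        also have "\<dots> = of_real (- ?s m)" unfolding rec by (simp add: algebra_simps)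
        finally have "norm (schr_op w lam z n) = \<bar>?s m\<bar>" by simp
        then have "exp (wt n) * norm (schr_op w lam z n) = exp (-\<epsilon> * (real l - real m)) * \<bar>?s m\<bar>"
          using 3 e ml by (simp add: wt_def)
        also have "\<dots> \<le> P" unfolding P_def by (intro mult_left_mono) auto
        finally show ?thesis using BE by linarith
      next
        case 4
        define j where "j = nat n"
        have j: "n = int j" "m < j" "j < R" using 4 by (auto simp: j_def)
        have "nat (int j + 1 + 1) = Suc (Suc j)" "nat (int j + 1) = Suc j" "nat (int j - 1 + 1) = j" by auto
        then have "schr_op w lam z n = of_real (?s (Suc (Suc j))) + of_real (?s j) + of_real (lam * w (int j)) * of_real (?s (Suc j))"
          using j by (simp add: schr_op_def z_def)
        also have "\<dots> = 0" unfolding rec by (simp add: algebra_simps)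
        finally show ?thesis using P0 BE by simp
      next
        case 5
        have nt: "nat (int R - 1 + 1) = R" "nat (int R + 1) = Suc R" by auto
        then have "schr_op w lam z n = of_real (?s R) + of_real (lam * w (int R)) * of_real (?s (Suc R))"
          using 5 ml by (simp add: schr_op_def z_def R_def)
        also have "\<dots> = of_real (- ?s (Suc (Suc R)))" unfolding rec by (simp add: algebra_simps)
        finally have "norm (schr_op w lam z n) = \<bar>?s (Suc (Suc R))\<bar>" by (simp only: norm_of_real abs_minus_cancel)
        then have "exp (wt n) * norm (schr_op w lam z n) \<le> exp (-\<epsilon> * real i) * B"
          using 5 e B[of "Suc (Suc R)"] by (intro mult_mono) (auto simp: wt_def R_def)
        then show ?thesis using P0 by (simp add: mult.commute)
      next
        case 6
        then have "schr_op w lam z n = of_real (?s (Suc R))" using ml by (simp add: schr_op_def z_def R_def nat_add_distrib)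
        then have "norm (schr_op w lam z n) = \<bar>?s (Suc R)\<bar>" by simp
        then have "exp (wt n) * norm (schr_op w lam z n) \<le> exp (-\<epsilon> * real i) * B"
          using 6 e B[of "Suc R"] by (intro mult_mono) (auto simp: wt_def R_def)
        then show ?thesis using P0 by (simp add: mult.commute)
      qed
    qed
    have "c0 * norm (y k) \<le> P + B * exp (-\<epsilon> * real i) + c0 / 2 * norm (y k)"
    proof (rule lower_boundD[OF U(1) fin])
      fix n
      have 2: "(exp \<epsilon> - 1) * (exp (wt j) * norm (z j)) \<le> (exp \<epsilon> - 1) * norm (y k)" for j
        using k[of j] e unfolding ny by (intro mult_left_mono) auto
      have "2 * (exp \<epsilon> - 1) * norm (y k) \<le> c0 / 2 * norm (y k)" by (rule mult_right_mono[OF e(2)]) simp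
      then show "norm (schr_op w lam y n) \<le> P + B * exp (-\<epsilon> * real i) + c0 / 2 * norm (y k)"
        using norm_schr_op_exp_weight[where w = wt, OF less_imp_le[OF e(1)] wt, of w lam z n] Az[of n] 2[of "n + 1"] 2[of "n - 1"]
        unfolding y_def[symmetric] by linarith
    qed simp
    moreover have "\<bar>?s (Suc l)\<bar> \<le> norm (y k)"
    proof -
      have "norm (y (int l)) = \<bar>?s (Suc l)\<bar>" using ml by (simp add: ny wt_def z_def R_def nat_add_distrib)
      then show ?thesis using k[of "int l"] by simp
    qed
    ultimately show ?thesis using U(2) mult_left_mono[of "\<bar>?s (Suc l)\<bar>" "norm (y k)" "c0 / 2"] by linarith
  qed
  \<comment> \<open>Sends the right cut to infinity; only here is boundedness of the whole solution
    turned into decay.\<close>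
  moreover have "(\<lambda>i. P + B * exp (-\<epsilon> * real i)) \<longlonglongrightarrow> P + B * 0"
  proof (intro tendsto_intros)
    have "(\<lambda>i. exp (-\<epsilon>) ^ i) \<longlonglongrightarrow> 0" by (rule LIMSEQ_realpow_zero) (use e in auto)
    then show "(\<lambda>i. exp (-\<epsilon> * real i)) \<longlonglongrightarrow> 0" by (simp add: exp_of_nat_mult[symmetric] mult.commute)
  qed
  ultimately have "c0 / 2 * \<bar>?s (Suc l)\<bar> \<le> P + B * 0" by (intro LIMSEQ_le_const) auto
  then show ?thesis using U(2) by (simp add: P_def field_simps)
qed

section \<open>Decaying solutions and resonances\<close>

text \<open>Euclidean length of two consecutive values; this norm fits the orthogonal frame of
  \<open>reduction_of_order\<close>.\<close>

definition vnorm :: "(nat \<Rightarrow> real) \<Rightarrow> nat \<Rightarrow> real" where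
  "vnorm s n = sqrt ((s n)\<^sup>2 + (s (Suc n))\<^sup>2)"

lemma vnorm_ge: "\<bar>s n\<bar> \<le> vnorm s n" "\<bar>s (Suc n)\<bar> \<le> vnorm s n"
  unfolding vnorm_def by (rule real_le_rsqrt; simp)+

lemma vnorm_le: "vnorm s n \<le> \<bar>s n\<bar> + \<bar>s (Suc n)\<bar>"
  unfolding vnorm_def by (rule sqrt_sum_squares_le_sum_abs)

lemma vnorm_square: "(vnorm s n)\<^sup>2 = (s n)\<^sup>2 + (s (Suc n))\<^sup>2"
  by (simp add: vnorm_def)

lemma vnorm_nonneg: "0 \<le> vnorm s n"
  by (simp add: vnorm_def)

lemma dir_sol_vnorm_pos: "vnorm (dir_sol lam w) n > 0"
proof -
  have "dir_sol lam w n \<noteq> 0 \<or> dir_sol lam w (Suc n) \<noteq> 0"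
    by (induction n) (auto simp: dir_sol_simps)
  then show ?thesis by (auto simp: vnorm_def sum_power2_gt_zero_iff)
qed

text \<open>The component at \<open>l\<close> is estimated from l - 1, which costs exp \<epsilon>.
  The summand 1 in the constant covers m = l.\<close>

lemma dir_sol_vnorm_decay:
  assumes U: "lower_bound lam c0 w UNIV" "c0 > 0" and B: "\<And>n. \<bar>dir_sol lam w n\<bar> \<le> B"
    and e: "\<epsilon> > 0" "2 * (exp \<epsilon> - 1) \<le> c0 / 2" and ml: "m \<le> l"
  shows "vnorm (dir_sol lam w) l \<le> (1 + 4 / c0 * (1 + exp \<epsilon>)) * exp (-\<epsilon> * (real l - real m)) * vnorm (dir_sol lam w) m"
proof -
  let ?s = "dir_sol lam w"
  define \<nu> where "\<nu> = vnorm ?s m"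
  define E where "E = exp (-\<epsilon> * (real l - real m))"
  have \<nu>: "\<nu> \<ge> 0" by (simp add: \<nu>_def vnorm_nonneg)
  have E: "E > 0" by (simp add: E_def)
  have dm: "\<bar>?s m\<bar> + \<bar>?s (Suc m)\<bar> \<le> 2 * \<nu>" using vnorm_ge[of ?s m] by (simp add: \<nu>_def)
  have 1: "\<bar>?s (Suc l)\<bar> \<le> 4 / c0 * (E * \<nu>)"
  proof -
    have "\<bar>?s (Suc l)\<bar> \<le> 2 / c0 * (E * (\<bar>?s m\<bar> + \<bar>?s (Suc m)\<bar>))"
      unfolding E_def by (rule dir_sol_decay[OF U B e ml])
    also have "\<dots> \<le> 2 / c0 * (E * (2 * \<nu>))" using dm E U by (intro mult_left_mono) auto
    finally show ?thesis by simp
  qed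
  show ?thesis
  proof (cases "m = l")
    case True
    have "1 * \<nu> \<le> (1 + 4 / c0 * (1 + exp \<epsilon>)) * \<nu>" using \<nu> U by (intro mult_right_mono) auto
    then show ?thesis using True by (simp add: \<nu>_def)
  next
    case False
    then obtain l' where l': "l = Suc l'" "m \<le> l'" using ml by (metis Suc_le_D Suc_le_mono le_SucE le_neq_implies_less less_eq_Suc_le)
    have "\<bar>?s l\<bar> \<le> 2 / c0 * (exp (-\<epsilon> * (real l' - real m)) * (\<bar>?s m\<bar> + \<bar>?s (Suc m)\<bar>))"
      unfolding l'(1) by (rule dir_sol_decay[OF U B e l'(2)])
    also have "exp (-\<epsilon> * (real l' - real m)) = exp \<epsilon> * E"
      unfolding E_def exp_add[symmetric] l'(1) by (simp add: algebra_simps)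
    also have "2 / c0 * (exp \<epsilon> * E * (\<bar>?s m\<bar> + \<bar>?s (Suc m)\<bar>)) \<le> 2 / c0 * (exp \<epsilon> * E * (2 * \<nu>))"
      using dm E U by (intro mult_left_mono) auto
    finally have 2: "\<bar>?s l\<bar> \<le> 4 / c0 * (exp \<epsilon> * E * \<nu>)" by simp
    have "vnorm ?s l \<le> 4 / c0 * (E * \<nu>) + 4 / c0 * (exp \<epsilon> * E * \<nu>)" using vnorm_le[of ?s l] 1 2 by linarith
    also have "\<dots> = 4 / c0 * (1 + exp \<epsilon>) * (E * \<nu>)" using U by (simp add: field_simps)
    also have "\<dots> \<le> (1 + 4 / c0 * (1 + exp \<epsilon>)) * (E * \<nu>)" using E \<nu> by (intro mult_right_mono) auto
    finally show ?thesis by (simp add: E_def \<nu>_def mult.assoc)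
  qed
qed

text \<open>Reduction of order: in the frame given by the decaying solution \<open>s\<close> and the direction
  orthogonal to it, the transversal component of a second solution \<open>g\<close> is governed by the
  Wronskian and the component along \<open>s\<close> by a geometric series.\<close>
lemma reduction_of_order:
  fixes s \<kappa> :: "nat \<Rightarrow> real" and g :: "nat \<Rightarrow> complex"
  assumes s: "\<And>n. s (Suc (Suc n)) = - s n - \<kappa> n * s (Suc n)" and pos: "\<And>n. vnorm s n > 0"
    and decay: "\<And>m l. m \<le> l \<Longrightarrow> vnorm s l \<le> C * exp (-\<epsilon> * (real l - real m)) * vnorm s m"
    and C: "C \<ge> 1" and e: "\<epsilon> > 0" and \<kappa>: "\<And>n. \<bar>\<kappa> n\<bar> \<le> \<Lambda>"
    and g: "\<And>j. j \<in> {a..<b} \<Longrightarrow> g (Suc (Suc j)) = - g j - of_real (\<kappa> j) * g (Suc j)" and ab: "a \<le> b"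
  shows "norm (g a) + norm (g (Suc a))
    \<le> (2 * (1 + (2 + \<Lambda>) * C\<^sup>2 / (1 - exp (-\<epsilon>))) + 2 * C\<^sup>2) * (norm (g b) + norm (g (Suc b))) * (vnorm s a / vnorm s b)"
proof -
  let ?\<nu> = "vnorm s"
  define \<gamma> where "\<gamma> = (\<lambda>j. norm (g j) + norm (g (Suc j)))"
  \<comment> \<open>Frame coordinates of (g j, g (Suc j)): \<open>A\<close> belongs to (s j, s (Suc
    j)), and \<open>W\<close>, divided by the squared length, to (s (Suc j), - s j).
    \<open>d\<close> is the increment of \<open>A\<close> per unit of the Wronskian and depends on
    \<open>s\<close> alone.\<close>
  define A where "A = (\<lambda>j. (of_real (s j) * g j + of_real (s (Suc j)) * g (Suc j)) / of_real ((?\<nu> j)\<^sup>2))"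
  define W where "W = (\<lambda>j. of_real (s (Suc j)) * g j - of_real (s j) * g (Suc j))"
  define d where "d = (\<lambda>j. (- s j * s (Suc j) + s (Suc (Suc j)) * (\<kappa> j * s j - s (Suc j))) / ((?\<nu> j)\<^sup>2 * (?\<nu> (Suc j))\<^sup>2))"
  have \<Lambda>: "\<Lambda> \<ge> 0" using \<kappa>[of 0] by linarith
  have Wstep: "W (Suc j) = W j" if "j \<in> {a..<b}" for j
    unfolding W_def g[OF that] s by (simp add: algebra_simps)
  have Wc: "W j = W b" if "j \<in> {a..b}" for j
  proof -
    have "j \<le> b" using that by simp
    then show ?thesis
    proof (induction rule: inc_induct)
      case base then show ?case by simp
    next
      case (step n)
      then show ?case using Wstep[of n] that by auto
    qed
  qed
  have Astep: "A (Suc j) - A j = W j * of_real (d j)" if j: "j \<in> {a..<b}" for j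
  proof -
    define S T K where "S = complex_of_real (s j)" and "T = complex_of_real (s (Suc j))" and "K = complex_of_real (\<kappa> j)"
    have nz: "of_real ((?\<nu> j)\<^sup>2) \<noteq> (0::complex)" "of_real ((?\<nu> (Suc j))\<^sup>2) \<noteq> (0::complex)"
      using pos[of j] pos[of "Suc j"] by simp_all
    have N: "of_real ((?\<nu> j)\<^sup>2) = S\<^sup>2 + T\<^sup>2" "of_real ((?\<nu> (Suc j))\<^sup>2) = T\<^sup>2 + (- S - K * T)\<^sup>2"
      unfolding vnorm_square s by (simp_all add: S_def T_def K_def)
    have sr: "complex_of_real (s (Suc (Suc j))) = - S - K * T" unfolding s by (simp add: S_def T_def K_def)
    have "(T * g (Suc j) + (- S - K * T) * (- g j - K * g (Suc j))) * (S\<^sup>2 + T\<^sup>2) - (S * g j + T * g (Suc j)) * (T\<^sup>2 + (- S - K * T)\<^sup>2)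
       = (T * g j - S * g (Suc j)) * (- S * T + (- S - K * T) * (K * S - T))"
      by (simp add: power2_eq_square algebra_simps)
    moreover have "A (Suc j) - A j = ((T * g (Suc j) + (- S - K * T) * (- g j - K * g (Suc j))) * (S\<^sup>2 + T\<^sup>2) - (S * g j + T * g (Suc j)) * (T\<^sup>2 + (- S - K * T)\<^sup>2))
        / ((S\<^sup>2 + T\<^sup>2) * (T\<^sup>2 + (- S - K * T)\<^sup>2))"
      unfolding A_def sr g[OF j] N S_def[symmetric] T_def[symmetric] K_def[symmetric]
      using nz unfolding N by (simp add: diff_frac_eq mult.commute)
    moreover have "W j * of_real (d j) = (T * g j - S * g (Suc j)) * (- S * T + (- S - K * T) * (K * S - T)) / ((S\<^sup>2 + T\<^sup>2) * (T\<^sup>2 + (- S - K * T)\<^sup>2))"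
    proof -
      have "complex_of_real (d j) = (- S * T + (- S - K * T) * (K * S - T)) / ((S\<^sup>2 + T\<^sup>2) * (T\<^sup>2 + (- S - K * T)\<^sup>2))"
        unfolding d_def of_real_divide of_real_mult[of "(?\<nu> j)\<^sup>2"] N
        by (simp add: sr S_def T_def K_def)
      then show ?thesis by (simp add: W_def S_def T_def)
    qed
    ultimately show ?thesis by simp
  qed
  have dbound: "\<bar>d j\<bar> \<le> (2 + \<Lambda>) / (?\<nu> j * ?\<nu> (Suc j))" for j
  proof -
    have "\<bar>- s j * s (Suc j) + s (Suc (Suc j)) * (\<kappa> j * s j - s (Suc j))\<bar>
        \<le> \<bar>s j\<bar> * \<bar>s (Suc j)\<bar> + \<bar>\<kappa> j\<bar> * (\<bar>s j\<bar> * \<bar>s (Suc (Suc j))\<bar>) + \<bar>s (Suc j)\<bar> * \<bar>s (Suc (Suc j))\<bar>"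
    proof -
      have "- s j * s (Suc j) + s (Suc (Suc j)) * (\<kappa> j * s j - s (Suc j))
          = - (s j * s (Suc j)) + \<kappa> j * (s j * s (Suc (Suc j))) - s (Suc j) * s (Suc (Suc j))" by (simp add: algebra_simps)
      then show ?thesis by (simp only: abs_mult[symmetric])
    qed
    also have "\<dots> \<le> ?\<nu> j * ?\<nu> (Suc j) + \<Lambda> * (?\<nu> j * ?\<nu> (Suc j)) + ?\<nu> j * ?\<nu> (Suc j)"
      by (intro add_mono mult_mono vnorm_ge \<kappa>) (auto simp: \<Lambda> vnorm_nonneg)
    also have "\<dots> = (2 + \<Lambda>) * (?\<nu> j * ?\<nu> (Suc j))" by (simp add: algebra_simps)
    finally have "\<bar>d j\<bar> \<le> (2 + \<Lambda>) * (?\<nu> j * ?\<nu> (Suc j)) / ((?\<nu> j)\<^sup>2 * (?\<nu> (Suc j))\<^sup>2)"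
      unfolding d_def abs_divide by (simp add: divide_right_mono abs_mult)
    also have "\<dots> = (2 + \<Lambda>) / (?\<nu> j * ?\<nu> (Suc j))"
      using pos[of j] pos[of "Suc j"] by (simp add: power2_eq_square field_simps)
    finally show ?thesis .
  qed
  define r where "r = exp (-\<epsilon>)"
  have r: "0 < r" "r < 1" using e by (auto simp: r_def)
  \<comment> \<open>The decay is read backwards from \<open>b\<close>: the increments of
    \<open>A\<close> are then geometric with the largest terms near \<open>b\<close>, so their sum
    does not depend on the length.\<close>
  have inv: "1 / ?\<nu> j \<le> C * r ^ (b - j) / ?\<nu> b" if "j \<le> b" for j
  proof -
    have "exp (-\<epsilon> * (real b - real j)) = r ^ (b - j)"
      unfolding r_def exp_of_nat_mult[symmetric] using that by (simp add: of_nat_diff algebra_simps)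
    then have "?\<nu> b \<le> C * r ^ (b - j) * ?\<nu> j" using decay[OF that] by simp
    then show ?thesis using pos[of j] pos[of b] by (simp add: field_simps)
  qed
  have db: "\<bar>d j\<bar> \<le> (2 + \<Lambda>) * C\<^sup>2 / (?\<nu> b)\<^sup>2 * r ^ (b - Suc j)" if "j \<in> {a..<b}" for j
  proof -
    have jb: "j \<le> b" "Suc j \<le> b" using that by auto
    have "1 / ?\<nu> j \<le> C * 1 / ?\<nu> b"
    proof -
      have "C * r ^ (b - j) / ?\<nu> b \<le> C * 1 / ?\<nu> b" using C r pos[of b] by (intro divide_right_mono mult_left_mono power_le_one) auto
      then show ?thesis using inv[OF jb(1)] by linarith
    qed
    then have "(1 / ?\<nu> j) * (1 / ?\<nu> (Suc j)) \<le> (C * 1 / ?\<nu> b) * (C * r ^ (b - Suc j) / ?\<nu> b)"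
      using inv[OF jb(2)] pos[of j] pos[of "Suc j"] pos[of b] C by (intro mult_mono) (auto simp: less_imp_le)
    then have "(2 + \<Lambda>) * ((1 / ?\<nu> j) * (1 / ?\<nu> (Suc j))) \<le> (2 + \<Lambda>) * ((C * 1 / ?\<nu> b) * (C * r ^ (b - Suc j) / ?\<nu> b))"
      using \<Lambda> by (intro mult_left_mono) auto
    then show ?thesis using dbound[of j] by (simp add: power2_eq_square ac_simps)
  qed
  have geo: "(\<Sum>j\<in>{a..<b}. r ^ (b - Suc j)) \<le> 1 / (1 - r)"
  proof -
    have "(\<Sum>j\<in>{a..<b}. r ^ (b - Suc j)) \<le> (\<Sum>j<b. r ^ (b - Suc j))" by (rule sum_mono2) (use r in auto)
    also have "\<dots> = (\<Sum>i<b. r ^ i)" by (rule sum.nat_diff_reindex)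
    also have "\<dots> \<le> (\<Sum>i. r ^ i)" using r by (intro sum_le_suminf summable_geometric) auto
    also have "\<dots> = 1 / (1 - r)" using r by (simp add: suminf_geometric)
    finally show ?thesis .
  qed
  have Wb: "norm (W b) \<le> ?\<nu> b * \<gamma> b"
  proof -
    have "norm (W b) \<le> \<bar>s (Suc b)\<bar> * norm (g b) + \<bar>s b\<bar> * norm (g (Suc b))"
      unfolding W_def by (rule norm_triangle_le_diff) (simp add: norm_mult)
    also have "\<dots> \<le> ?\<nu> b * norm (g b) + ?\<nu> b * norm (g (Suc b))" by (intro add_mono mult_right_mono vnorm_ge) auto
    finally show ?thesis by (simp add: \<gamma>_def algebra_simps)
  qed
  have Ab: "norm (A b) \<le> \<gamma> b / ?\<nu> b"
  proof -
    have "norm (of_real (s b) * g b + of_real (s (Suc b)) * g (Suc b)) \<le> \<bar>s b\<bar> * norm (g b) + \<bar>s (Suc b)\<bar> * norm (g (Suc b))"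
      by (rule norm_triangle_le) (simp add: norm_mult)
    also have "\<dots> \<le> ?\<nu> b * norm (g b) + ?\<nu> b * norm (g (Suc b))" by (intro add_mono mult_right_mono vnorm_ge) auto
    finally have "norm (A b) \<le> (?\<nu> b * \<gamma> b) / (?\<nu> b)\<^sup>2"
      unfolding A_def norm_divide norm_of_real by (simp add: \<gamma>_def divide_right_mono distrib_left)
    then show ?thesis using pos[of b] by (simp add: power2_eq_square)
  qed
  define Z where "Z = (2 + \<Lambda>) * C\<^sup>2 / (1 - r)"
  have Z: "Z \<ge> 0" using \<Lambda> r by (simp add: Z_def)
  have \<gamma>0: "\<gamma> j \<ge> 0" for j by (simp add: \<gamma>_def)
  have "A b - A a = (\<Sum>j\<in>{a..<b}. A (Suc j) - A j)" using ab by (simp add: sum_Suc_diff')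
  then have "norm (A b - A a) \<le> (\<Sum>j\<in>{a..<b}. norm (A (Suc j) - A j))" by (simp add: norm_sum)
  also have "\<dots> \<le> (\<Sum>j\<in>{a..<b}. norm (W b) * ((2 + \<Lambda>) * C\<^sup>2 / (?\<nu> b)\<^sup>2 * r ^ (b - Suc j)))"
  proof (rule sum_mono)
    fix j assume j: "j \<in> {a..<b}"
    have "norm (A (Suc j) - A j) = norm (W b) * \<bar>d j\<bar>" using Astep[OF j] Wc[of j] j by (simp add: norm_mult)
    also have "\<dots> \<le> norm (W b) * ((2 + \<Lambda>) * C\<^sup>2 / (?\<nu> b)\<^sup>2 * r ^ (b - Suc j))" by (intro mult_left_mono db[OF j]) auto
    finally show "norm (A (Suc j) - A j) \<le> norm (W b) * ((2 + \<Lambda>) * C\<^sup>2 / (?\<nu> b)\<^sup>2 * r ^ (b - Suc j))" .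
  qed
  also have "\<dots> = norm (W b) * ((2 + \<Lambda>) * C\<^sup>2 / (?\<nu> b)\<^sup>2) * (\<Sum>j\<in>{a..<b}. r ^ (b - Suc j))"
    by (simp add: sum_distrib_left mult.assoc)
  also have "\<dots> \<le> (?\<nu> b * \<gamma> b) * ((2 + \<Lambda>) * C\<^sup>2 / (?\<nu> b)\<^sup>2) * (1 / (1 - r))"
    using \<Lambda> \<gamma>0 by (intro mult_mono geo Wb) (auto intro!: sum_nonneg simp: r(1) less_imp_le vnorm_nonneg)
  also have "\<dots> = \<gamma> b / ?\<nu> b * Z" using pos[of b] by (simp add: Z_def power2_eq_square)
  finally have "norm (A b - A a) \<le> \<gamma> b / ?\<nu> b * Z" .
  then have Aa: "norm (A a) \<le> \<gamma> b / ?\<nu> b * (1 + Z)"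
    using norm_triangle_ineq3[of "A b" "A a"] Ab by (simp add: distrib_left)
  have ga: "g a = A a * of_real (s a) + W a * of_real (s (Suc a)) / of_real ((?\<nu> a)\<^sup>2)"
    "g (Suc a) = A a * of_real (s (Suc a)) - W a * of_real (s a) / of_real ((?\<nu> a)\<^sup>2)"
  proof -
    define S T D where "S = complex_of_real (s a)" and "T = complex_of_real (s (Suc a))" and "D = complex_of_real ((?\<nu> a)\<^sup>2)"
    have "D \<noteq> 0" using pos[of a] by (simp add: D_def)
    moreover have "D = S * S + T * T" unfolding D_def vnorm_square by (simp add: S_def T_def power2_eq_square)
    ultimately have D: "D \<noteq> 0" "D = S * S + T * T" by auto
    have AW: "A a = (S * g a + T * g (Suc a)) / D" "W a = T * g a - S * g (Suc a)"
      by (simp_all add: A_def W_def S_def T_def D_def)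
    have cf1: "x / D * S + y * T / D = (x * S + y * T) / D" and cf2: "x / D * T - y * S / D = (x * T - y * S) / D" for x y
      by (simp_all add: add_divide_distrib diff_divide_distrib)
    have "A a * S + W a * T / D = ((S * g a + T * g (Suc a)) * S + (T * g a - S * g (Suc a)) * T) / D"
      unfolding AW by (rule cf1)
    also have "(S * g a + T * g (Suc a)) * S + (T * g a - S * g (Suc a)) * T = g a * D"
      unfolding D(2) by (simp add: algebra_simps)
    finally show "g a = A a * of_real (s a) + W a * of_real (s (Suc a)) / of_real ((?\<nu> a)\<^sup>2)"
      using D(1) unfolding S_def[symmetric] T_def[symmetric] D_def[symmetric] by simp
    have "A a * T - W a * S / D = ((S * g a + T * g (Suc a)) * T - (T * g a - S * g (Suc a)) * S) / D"
      unfolding AW by (rule cf2)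
    also have "(S * g a + T * g (Suc a)) * T - (T * g a - S * g (Suc a)) * S = g (Suc a) * D"
      unfolding D(2) by (simp add: algebra_simps)
    finally show "g (Suc a) = A a * of_real (s (Suc a)) - W a * of_real (s a) / of_real ((?\<nu> a)\<^sup>2)"
      using D(1) unfolding S_def[symmetric] T_def[symmetric] D_def[symmetric] by simp
  qed
  have Wa: "W a = W b" by (rule Wc) (use ab in simp)
  have part: "\<bar>t\<bar> \<le> ?\<nu> a \<Longrightarrow> norm (W a * of_real t / of_real ((?\<nu> a)\<^sup>2)) \<le> norm (W b) / ?\<nu> a" for t
  proof -
    assume t: "\<bar>t\<bar> \<le> ?\<nu> a"
    have "norm (W a * of_real t / of_real ((?\<nu> a)\<^sup>2)) = norm (W b) * \<bar>t\<bar> / (?\<nu> a)\<^sup>2" unfolding Wa norm_mult norm_divide norm_of_real by simp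
    also have "\<dots> \<le> norm (W b) * ?\<nu> a / (?\<nu> a)\<^sup>2" using t by (intro divide_right_mono mult_left_mono) auto
    also have "\<dots> = norm (W b) / ?\<nu> a" using pos[of a] by (simp add: power2_eq_square)
    finally show ?thesis .
  qed
  have part2: "\<bar>t\<bar> \<le> ?\<nu> a \<Longrightarrow> norm (A a * of_real t) \<le> norm (A a) * ?\<nu> a" for t
    by (simp add: norm_mult mult_left_mono)
  have "\<gamma> a \<le> 2 * (norm (A a) * ?\<nu> a) + 2 * (norm (W b) / ?\<nu> a)"
  proof -
    have "norm (g a) \<le> norm (A a) * ?\<nu> a + norm (W b) / ?\<nu> a"
      by (subst ga(1), rule norm_triangle_le, rule add_mono[OF part2[OF vnorm_ge(1)] part[OF vnorm_ge(2)]])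
    moreover have "norm (g (Suc a)) \<le> norm (A a) * ?\<nu> a + norm (W b) / ?\<nu> a"
      by (subst ga(2), rule norm_triangle_le_diff, rule add_mono[OF part2[OF vnorm_ge(2)] part[OF vnorm_ge(1)]])
    ultimately show ?thesis by (simp add: \<gamma>_def)
  qed
  also have "\<dots> \<le> 2 * (\<gamma> b / ?\<nu> b * (1 + Z) * ?\<nu> a) + 2 * (?\<nu> b * \<gamma> b / ?\<nu> a)"
    using Aa Wb pos[of a] by (intro add_mono mult_left_mono mult_right_mono divide_right_mono) auto
  \<comment> \<open>The decay also bounds \<nu> b by C times \<nu> a, which brings the transversal
    part under the same ratio as the part along \<open>s\<close>.\<close>
  also have "?\<nu> b * \<gamma> b / ?\<nu> a \<le> C\<^sup>2 * \<gamma> b * (?\<nu> a / ?\<nu> b)"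
  proof -
    have "1 / ?\<nu> a \<le> C * 1 / ?\<nu> b"
    proof -
      have "C * r ^ (b - a) / ?\<nu> b \<le> C * 1 / ?\<nu> b" using C r pos[of b] by (intro divide_right_mono mult_left_mono power_le_one) auto
      then show ?thesis using inv[OF ab] by linarith
    qed
    then have "?\<nu> b \<le> C * ?\<nu> a" using pos[of a] pos[of b] by (simp add: field_simps)
    then have "?\<nu> b * ?\<nu> b \<le> (C * ?\<nu> a) * (C * ?\<nu> a)" using pos[of b] by (intro mult_mono) auto
    then have "\<gamma> b * (?\<nu> b * ?\<nu> b) \<le> \<gamma> b * ((C * ?\<nu> a) * (C * ?\<nu> a))" using \<gamma>0 by (intro mult_left_mono) auto
    then show ?thesis using pos[of a] pos[of b] by (simp add: field_simps power2_eq_square)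
  qed
  finally have "\<gamma> a \<le> 2 * (\<gamma> b / ?\<nu> b * (1 + Z) * ?\<nu> a) + 2 * (C\<^sup>2 * \<gamma> b * (?\<nu> a / ?\<nu> b))" by simp
  also have "\<dots> = (2 * (1 + Z) + 2 * C\<^sup>2) * \<gamma> b * (?\<nu> a / ?\<nu> b)" using pos[of b] by (simp add: field_simps)
  finally show ?thesis unfolding \<gamma>_def Z_def r_def .
qed

text \<open>Summation by parts; the zero values outside remove the boundary terms. It exchanges rows
  and columns of the inverse of a section.\<close>

lemma schr_op_symmetric:
  assumes x: "\<And>n. n \<notin> {a..b} \<Longrightarrow> x n = 0" and y: "\<And>n. n \<notin> {a..b} \<Longrightarrow> y n = 0"
  shows "(\<Sum>i\<in>{a..b::int}. x i * schr_op v lam y i) = (\<Sum>i\<in>{a..b}. y i * schr_op v lam x i)"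
proof -
  have sh: "(\<Sum>i\<in>{a..b}. x i * y (i + 1)) = (\<Sum>i\<in>{a..b}. x (i - 1) * y i)"
    if x: "\<And>n. n \<notin> {a..b} \<Longrightarrow> x n = 0" and y: "\<And>n. n \<notin> {a..b} \<Longrightarrow> y n = 0" for x y :: "int \<Rightarrow> complex"
  proof -
    have "(\<Sum>i\<in>{a..b}. x i * y (i + 1)) = (\<Sum>i\<in>{a + 1..b + 1}. x (i - 1) * y i)"
      by (rule sum.reindex_bij_witness[of _ "\<lambda>i. i - 1" "\<lambda>i. i + 1"]) auto
    also have "\<dots> = (\<Sum>i\<in>{a..b + 1}. x (i - 1) * y i)"
      by (rule sum.mono_neutral_left) (use x in auto)
    also have "\<dots> = (\<Sum>i\<in>{a..b}. x (i - 1) * y i)"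
      by (rule sum.mono_neutral_right) (use y in auto)
    finally show ?thesis .
  qed
  show ?thesis
    unfolding schr_op_def distrib_left sum.distrib
    using sh[where x=x and y=y, OF x y] sh[where x=y and y=x, OF y x] by (simp add: ac_simps)
qed

text \<open>Three cases: the origin lies within the copied prefix; the remaining word is a factor of
  the prefix; or it wraps around the cyclic word once. In each, the bound at the origin contradicts
  the growth forced by the Wronskian.\<close>

lemma resonance:
  assumes \<alpha>: "\<alpha> \<notin> \<rat>" "0 < \<alpha>" "\<alpha> < 1" and w: "sturm \<alpha> w"
    and U: "lower_bound lam c0 w UNIV" "c0 > 0" and no: "\<And>c. c > 0 \<Longrightarrow> \<not> lower_bound lam c w {0..}"
    and col: "\<And>n. n \<ge> n0 \<Longrightarrow> \<exists>g. (\<forall>i. i \<notin> box n \<longrightarrow> g i = 0) \<and>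
       (\<forall>i\<in>box n. schr_op (vpot \<alpha> \<theta>) lam g i = (if i = - int n then 1 else 0)) \<and> norm (g 0) \<le> Q \<and> norm (g 1) \<le> Q"
  shows False
proof -
  have wb: "\<bar>w n\<bar> \<le> 1" for n by (rule sturm_bounded[OF w]) (use \<alpha> in auto)
  obtain B where B: "\<And>n. \<bar>dir_sol lam w n\<bar> \<le> B" using dir_sol_bounded[where w = w, OF wb U no] by blast
  define \<epsilon> where "\<epsilon> = ln (1 + c0 / 4)"
  have e: "\<epsilon> > 0" "2 * (exp \<epsilon> - 1) \<le> c0 / 2" using U by (auto simp: \<epsilon>_def)
  define C where "C = 1 + 4 / c0 * (1 + exp \<epsilon>)"
  have C: "C \<ge> 1" using U by (simp add: C_def)
  define s where "s = dir_sol lam w"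
  define \<nu> where "\<nu> = vnorm s"
  define \<kappa> where "\<kappa> = (\<lambda>n. lam * w (int n))"
  have srec: "s (Suc (Suc n)) = - s n - \<kappa> n * s (Suc n)" for n by (simp add: s_def \<kappa>_def dir_sol_simps)
  have pos: "\<nu> n > 0" for n unfolding \<nu>_def s_def by (rule dir_sol_vnorm_pos)
  have decay: "\<nu> l \<le> C * exp (-\<epsilon> * (real l - real m)) * \<nu> m" if "m \<le> l" for m l
    unfolding \<nu>_def s_def C_def by (rule dir_sol_vnorm_decay[OF U B e that])
  have \<nu>0: "\<nu> 0 = 1" by (simp add: \<nu>_def s_def vnorm_def dir_sol_simps)
  define \<Lambda> where "\<Lambda> = \<bar>lam\<bar>"
  have \<kappa>b: "\<bar>\<kappa> n\<bar> \<le> \<Lambda>" for n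
    using mult_left_mono[OF wb[of "int n"], of "\<bar>lam\<bar>"] by (simp add: \<kappa>_def \<Lambda>_def abs_mult)
  have \<Lambda>: "\<Lambda> \<ge> 0" by (simp add: \<Lambda>_def)
  define C3 where "C3 = 2 * (1 + (2 + \<Lambda>) * C\<^sup>2 / (1 - exp (-\<epsilon>))) + 2 * C\<^sup>2"
  have C3: "C3 \<ge> 1"
  proof -
    have "(2 + \<Lambda>) * C\<^sup>2 / (1 - exp (-\<epsilon>)) \<ge> 0" using \<Lambda> e by (intro divide_nonneg_nonneg mult_nonneg_nonneg) auto
    moreover have "C\<^sup>2 \<ge> 0" by simp
    moreover have "1 \<le> 2 * (1 + x) + 2 * y" if "0 \<le> x" "0 \<le> y" for x y :: real using that by auto
    ultimately show ?thesis unfolding C3_def by blast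
  qed
  have red: "norm (g a) + norm (g (Suc a)) \<le> C3 * (norm (g b) + norm (g (Suc b))) * (\<nu> a / \<nu> b)"
    if "\<And>j. j \<in> {a..<b} \<Longrightarrow> g (Suc (Suc j)) = - g j - of_real (\<kappa> j) * g (Suc j)" "a \<le> b" for g :: "nat \<Rightarrow> complex" and a b
    unfolding C3_def \<nu>_def
    by (rule reduction_of_order[where s = s and \<kappa> = \<kappa> and g = g, OF srec pos[unfolded \<nu>_def] decay[unfolded \<nu>_def] C e(1) \<kappa>b that])
  \<comment> \<open>Exceeds the prefactors of all three cases, so that a single choice of
    \<open>N0\<close> contradicts each of them.\<close>
  define Z where "Z = 2 * \<bar>Q\<bar> * C3\<^sup>2 * C\<^sup>2 * (1 + \<Lambda>) + 1"
  have Z: "Z \<ge> 1" using C3 C \<Lambda> by (simp add: Z_def)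
  obtain N0 :: nat where N0: "N0 \<ge> n0" "N0 \<ge> 1" "Z * exp (-\<epsilon> * real N0) < 1"
  proof -
    have "(\<lambda>i. Z * exp (-\<epsilon>) ^ i) \<longlonglongrightarrow> Z * 0" by (intro tendsto_intros LIMSEQ_realpow_zero) (use e in auto)
    then have "\<forall>\<^sub>F i in sequentially. Z * exp (-\<epsilon>) ^ i < 1" by (intro order_tendstoD(2)[of _ "Z * 0"]) auto
    then obtain N where N: "\<And>i. i \<ge> N \<Longrightarrow> Z * exp (-\<epsilon>) ^ i < 1" unfolding eventually_sequentially by blast
    have "exp (-\<epsilon>) ^ i = exp (-\<epsilon> * real i)" for i by (simp add: exp_of_nat_mult[symmetric] mult.commute)
    then show ?thesis using that[of "max N (max n0 1)"] N[of "max N (max n0 1)"] by simp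
  qed
  have small: "Z * exp (-\<epsilon> * t) < 1" if "t \<ge> real N0" for t
  proof -
    have "exp (-\<epsilon> * t) \<le> exp (-\<epsilon> * real N0)" using that e by simp
    then have "Z * exp (-\<epsilon> * t) \<le> Z * exp (-\<epsilon> * real N0)" using Z by (intro mult_left_mono) auto
    then show ?thesis using N0(3) by linarith
  qed
  \<comment> \<open>Makes q_{k-1} at least 2 N0 + 4, the surplus of q_{k+1} over q_k needed for
    \<open>lq2\<close>.\<close>
  define k where "k = 2 * N0 + 5"
  have k1: "k \<ge> 1" by (simp add: k_def)
  define q where "q = nat (cf_q \<alpha> (Suc k))"
  have qk: "cf_q \<alpha> (Suc k) \<ge> cf_q \<alpha> k + cf_q \<alpha> (k - 1)" "cf_q \<alpha> (k - 1) \<ge> 2 * int N0 + 4" "cf_q \<alpha> k \<ge> 1"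
    using cf_q_ge[OF \<alpha>, of k] cf_q_ge_index[OF \<alpha>, of "k - 1"] k1 by (auto simp: k_def)
  have q: "int q = cf_q \<alpha> (Suc k)" using qk by (simp add: q_def)
  have q2: "cf_q \<alpha> (Suc k) \<ge> 2" using qk by linarith
  obtain n where n: "n > N0" "int n \<le> int N0 + cf_q \<alpha> k + cf_q \<alpha> (Suc k)"
    "\<And>j. j \<in> {0..cf_q \<alpha> (Suc k) - 2} \<Longrightarrow> w j = vpot \<alpha> \<theta> (j - int n)"
    using word_occurs_early[OF \<alpha> w q2] by metis
  obtain g0 where g0: "\<And>i. i \<notin> box n \<Longrightarrow> g0 i = 0"
    "\<And>i. i \<in> box n \<Longrightarrow> schr_op (vpot \<alpha> \<theta>) lam g0 i = (if i = - int n then 1 else 0)" "norm (g0 0) \<le> Q" "norm (g0 1) \<le> Q"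
    using col[of n] n(1) N0(1) by auto
  \<comment> \<open>Index j is the site j - 1 - n: index 0 lies just outside the section, the source
    acts at j = 0 in the recurrence, and indices n + 1 and n + 2 are the sites 0 and 1.\<close>
  define g where "g = (\<lambda>j::nat. g0 (int j - 1 - int n))"
  define \<kappa>' where "\<kappa>' = (\<lambda>j::nat. lam * vpot \<alpha> \<theta> (int j - int n))"
  have g00: "g 0 = 0" unfolding g_def by (rule g0(1)) (auto simp: box_def)
  have grec: "g (Suc (Suc j)) = (if j = 0 then 1 else 0) - g j - of_real (\<kappa>' j) * g (Suc j)" if "j \<le> 2 * n" for j
  proof -
    have "schr_op (vpot \<alpha> \<theta>) lam g0 (int j - int n) = (if int j - int n = - int n then 1 else 0)"
      by (rule g0(2)) (use that in \<open>auto simp: box_def\<close>)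
    then show ?thesis unfolding schr_op_def g_def \<kappa>'_def by (simp add: algebra_simps)
  qed
  have keq: "\<kappa>' j = \<kappa> j" if "j + 2 \<le> q" for j
    using n(3)[of "int j"] that q by (simp add: \<kappa>_def \<kappa>'_def)
  define \<gamma> where "\<gamma> = (\<lambda>j. norm (g j) + norm (g (Suc j)))"
  have \<gamma>n: "\<gamma> (n + 1) \<le> 2 * \<bar>Q\<bar>" using g0(3,4) by (simp add: \<gamma>_def g_def)
  \<comment> \<open>The Wronskian of the decaying solution and the column. Both vanish at index 0
    and the unit source sets it to -1; it stays constant as long as the two potentials agree. Hence
    the product of the two Cauchy data is at least 1.\<close>
  define Om where "Om = (\<lambda>j. of_real (s (Suc j)) * g j - of_real (s j) * g (Suc j))"
  have Om: "Om (Suc j) = -1" if "j + 2 \<le> q" "j \<le> 2 * n" for j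
    using that
  proof (induction j)
    case 0
    then show ?case using grec[of 0] keq[of 0] srec[of 0] g00 by (simp add: Om_def s_def dir_sol_simps(1,2) algebra_simps)
  next
    case (Suc j)
    have eq: "g (Suc (Suc (Suc j))) = - g (Suc j) - of_real (\<kappa> (Suc j)) * g (Suc (Suc j))"
      using grec[of "Suc j"] keq[of "Suc j"] Suc.prems by simp
    have "Om (Suc (Suc j)) = Om (Suc j)"
      unfolding Om_def srec[of "Suc j"] eq by (simp add: algebra_simps)
    then show ?case using Suc by simp
  qed
  have res: "1 \<le> \<nu> j * \<gamma> j" if "1 \<le> j" "j + 1 \<le> q" "j \<le> 2 * n" for j
  proof -
    have i: "j = Suc (j - 1)" using that by simp
    have "1 = norm (Om j)" using Om[of "j - 1"] that i by simp
    also have "\<dots> \<le> \<bar>s (Suc j)\<bar> * norm (g j) + \<bar>s j\<bar> * norm (g (Suc j))"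
      unfolding Om_def by (rule norm_triangle_le_diff) (simp add: norm_mult)
    also have "\<dots> \<le> \<nu> j * norm (g j) + \<nu> j * norm (g (Suc j))"
      unfolding \<nu>_def by (intro add_mono mult_right_mono vnorm_ge) auto
    finally show ?thesis by (simp add: \<gamma>_def algebra_simps)
  qed
  have fin: False if le: "1 \<le> 2 * \<bar>Q\<bar> * (C3\<^sup>2 * C\<^sup>2 * (1 + \<Lambda>)) * exp (-\<epsilon> * t)" and t: "t \<ge> real N0" for t
  proof -
    have "2 * \<bar>Q\<bar> * (C3\<^sup>2 * C\<^sup>2 * (1 + \<Lambda>)) * exp (-\<epsilon> * t) \<le> Z * exp (-\<epsilon> * t)"
      by (intro mult_right_mono) (auto simp: Z_def)
    then show False using le small[OF t] by linarith
  qed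
  have CC: "C \<le> C3\<^sup>2 * C\<^sup>2 * (1 + \<Lambda>)" "C3 * C\<^sup>2 \<le> C3\<^sup>2 * C\<^sup>2 * (1 + \<Lambda>)" "C3\<^sup>2 * (1 + \<Lambda>) * C \<le> C3\<^sup>2 * C\<^sup>2 * (1 + \<Lambda>)"
  proof -
    have a: "1 \<le> C3\<^sup>2" "1 \<le> 1 + \<Lambda>" "C \<le> C\<^sup>2" "C3 \<le> C3\<^sup>2" using C C3 \<Lambda> by (simp_all add: self_le_power)
    have "1 * C * 1 \<le> C3\<^sup>2 * C\<^sup>2 * (1 + \<Lambda>)" using a C by (intro mult_mono) auto
    then show "C \<le> C3\<^sup>2 * C\<^sup>2 * (1 + \<Lambda>)" by simp
    have "C3 * C\<^sup>2 * 1 \<le> C3\<^sup>2 * C\<^sup>2 * (1 + \<Lambda>)" using a C C3 by (intro mult_mono) auto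
    then show "C3 * C\<^sup>2 \<le> C3\<^sup>2 * C\<^sup>2 * (1 + \<Lambda>)" by simp
    have "C3\<^sup>2 * C * (1 + \<Lambda>) \<le> C3\<^sup>2 * C\<^sup>2 * (1 + \<Lambda>)" using a \<Lambda> C by (intro mult_mono) auto
    then show "C3\<^sup>2 * (1 + \<Lambda>) * C \<le> C3\<^sup>2 * C\<^sup>2 * (1 + \<Lambda>)" by (simp add: ac_simps)
  qed
  have up: "x * y \<le> 2 * \<bar>Q\<bar> * (C3\<^sup>2 * C\<^sup>2 * (1 + \<Lambda>)) * exp (-\<epsilon> * t)"
    if "x \<le> D * exp (-\<epsilon> * t)" "y \<le> 2 * \<bar>Q\<bar>" "D \<le> C3\<^sup>2 * C\<^sup>2 * (1 + \<Lambda>)" "x \<ge> 0" "y \<ge> 0" for x y D t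
  proof -
    have "x \<le> (C3\<^sup>2 * C\<^sup>2 * (1 + \<Lambda>)) * exp (-\<epsilon> * t)"
      by (rule order_trans[OF that(1) mult_right_mono[OF that(3)]]) simp
    then have "x * y \<le> (C3\<^sup>2 * C\<^sup>2 * (1 + \<Lambda>)) * exp (-\<epsilon> * t) * (2 * \<bar>Q\<bar>)" using that by (intro mult_mono) auto
    then show ?thesis by (simp add: ac_simps)
  qed
  have \<gamma>0: "\<gamma> j \<ge> 0" for j by (simp add: \<gamma>_def)
  show False
  proof (cases "n + 2 \<le> q")
    case True
    have "\<nu> (n + 1) \<le> C * exp (-\<epsilon> * real (n + 1))" using decay[of 0 "n + 1"] \<nu>0 by simp
    then have "\<nu> (n + 1) * \<gamma> (n + 1) \<le> 2 * \<bar>Q\<bar> * (C3\<^sup>2 * C\<^sup>2 * (1 + \<Lambda>)) * exp (-\<epsilon> * real (n + 1))"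
      by (rule up[OF _ \<gamma>n CC(1)]) (use pos[of "n + 1"] \<gamma>0 in auto)
    moreover have "1 \<le> \<nu> (n + 1) * \<gamma> (n + 1)" by (rule res) (use True n(1) N0(2) in auto)
    ultimately show False using fin[of "real (n + 1)"] n(1) by linarith
  next
    case False
    define len where "len = n + 2 - q"
    have l: "len + q = n + 2" using False by (simp add: len_def)
    have lq: "int len \<le> int N0 + cf_q \<alpha> k + 2" using l n(2) q by linarith
    \<comment> \<open>The remaining stretch is shorter than the prefix by a margin that grows with
      \<open>N0\<close>; this decides the final estimates.\<close>
    have lq2: "len + N0 + 2 \<le> q" using lq qk q by linarith
    \<comment> \<open>The potential from the end of the prefix onwards, again a coded sequence, so
      that its initial word can be placed in the cyclic word.\<close>
    define y where "y = (\<lambda>i::int. vpot \<alpha> \<theta> (i + (int q - 1 - int n)))"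
    have y: "sturm \<alpha> y" unfolding y_def by (rule sturm_shift, rule sturm_vpot) (use \<alpha> in auto)
    obtain W t where t: "t \<in> {0..<cf_q \<alpha> (Suc k)}" and per: "\<And>j. W (j + cf_q \<alpha> (Suc k)) = W j"
      and W1: "\<And>j. j \<in> {0..cf_q \<alpha> (Suc k) - 2} \<Longrightarrow> w j = W j" and W2: "\<And>j. j \<in> {0..cf_q \<alpha> (Suc k) - 2} \<Longrightarrow> y j = W (j + t)"
    proof (rule words_cyclic[OF \<alpha> w y q2])
      fix W t
      assume a: "t \<in> {0..<cf_q \<alpha> (Suc k)}" "\<And>j. W (j + cf_q \<alpha> (Suc k)) = W j"
        "\<And>j. j \<in> {0..cf_q \<alpha> (Suc k) - 2} \<Longrightarrow> w j = W j" "\<And>j. j \<in> {0..cf_q \<alpha> (Suc k) - 2} \<Longrightarrow> y j = W (j + t)"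
      show thesis by (rule that[of t W, OF a])
    qed
    define \<tau> where "\<tau> = nat t"
    have \<tau>: "int \<tau> = t" "\<tau> < q" using t q by (auto simp: \<tau>_def)
    have ky: "\<kappa>' (q - 1 + i) = lam * W (int i + t)" if "i < len" for i
    proof -
      have "y (int i) = W (int i + t)" by (rule W2) (use that lq2 q in auto)
      moreover have "int (q - 1 + i) - int n = int i + (int q - 1 - int n)" using lq2 by simp
      ultimately show ?thesis unfolding \<kappa>'_def y_def by (simp only:)
    qed
    have n_large: "q - 1 + i \<le> 2 * n \<and> q - 1 + i \<noteq> 0" if "i < len" for i using that l lq2 by linarith
    have gs: "g (Suc (Suc (q - 1 + i))) = - g (q - 1 + i) - of_real (\<kappa>' (q - 1 + i)) * g (Suc (q - 1 + i))" if "i < len" for i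
      using grec[of "q - 1 + i"] n_large[OF that] by simp
    have end_eq: "q - 1 + len = n + 1" using l lq2 by simp
    have r1: "1 \<le> \<nu> (q - 1) * \<gamma> (q - 1)" by (rule res) (use lq2 l False in auto)
    have \<kappa>W: "\<kappa> j = lam * W (int j)" if "j + 2 \<le> q" for j
      using W1[of "int j"] that q by (simp add: \<kappa>_def)
    show False
    proof (cases "\<tau> + len + 1 \<le> q")
      case True
      have "norm (g (q - 1 + (\<tau> - \<tau>))) + norm (g (q - 1 + (Suc \<tau> - \<tau>)))
          \<le> C3 * (norm (g (q - 1 + (\<tau> + len - \<tau>))) + norm (g (q - 1 + (Suc (\<tau> + len) - \<tau>)))) * (\<nu> \<tau> / \<nu> (\<tau> + len))"
      proof (rule red[where g = "\<lambda>j. g (q - 1 + (j - \<tau>))"])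
        fix j assume j: "j \<in> {\<tau>..<\<tau> + len}"
        define i where "i = j - \<tau>"
        have i: "j = i + \<tau>" "i < len" using j by (auto simp: i_def)
        have "\<kappa>' (q - 1 + i) = \<kappa> j" using ky[OF i(2)] \<kappa>W[of j] True i \<tau> by simp
        then show "g (q - 1 + (Suc (Suc j) - \<tau>)) = - g (q - 1 + (j - \<tau>)) - of_real (\<kappa> j) * g (q - 1 + (Suc j - \<tau>))"
          using gs[OF i(2)] i by simp
      qed simp
      then have "\<gamma> (q - 1) \<le> C3 * \<gamma> (n + 1) * (\<nu> \<tau> / \<nu> (\<tau> + len))" using end_eq by (simp add: \<gamma>_def)
      then have "\<nu> (q - 1) * \<gamma> (q - 1) \<le> \<nu> (q - 1) * (C3 * \<gamma> (n + 1) * (\<nu> \<tau> / \<nu> (\<tau> + len)))" using pos[of "q - 1"] by (intro mult_left_mono) auto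
      also have "\<dots> = (C3 * (\<nu> (q - 1) / \<nu> (\<tau> + len)) * \<nu> \<tau>) * \<gamma> (n + 1)" by simp
      also have "\<dots> \<le> 2 * \<bar>Q\<bar> * (C3\<^sup>2 * C\<^sup>2 * (1 + \<Lambda>)) * exp (-\<epsilon> * (real (q - 1) - real len))"
      proof (rule up[OF _ \<gamma>n CC(2)])
        \<comment> \<open>Decay before \<tau> and after \<tau> + len together covers q - 1 - len
          steps; only the remaining stretch itself is lost.\<close>
        have "\<nu> (q - 1) \<le> C * exp (-\<epsilon> * (real (q - 1) - real (\<tau> + len))) * \<nu> (\<tau> + len)" by (rule decay) (use True in simp)
        then have a: "\<nu> (q - 1) / \<nu> (\<tau> + len) \<le> C * exp (-\<epsilon> * (real (q - 1) - real (\<tau> + len)))"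
          using pos[of "\<tau> + len"] by (simp add: pos_divide_le_eq)
        have b: "\<nu> \<tau> \<le> C * exp (-\<epsilon> * real \<tau>)" using decay[of 0 \<tau>] \<nu>0 by simp
        have "(\<nu> (q - 1) / \<nu> (\<tau> + len)) * \<nu> \<tau> \<le> (C * exp (-\<epsilon> * (real (q - 1) - real (\<tau> + len)))) * (C * exp (-\<epsilon> * real \<tau>))"
          using a b C pos[of \<tau>] by (intro mult_mono) auto
        also have "\<dots> = C\<^sup>2 * exp (-\<epsilon> * (real (q - 1) - real len))"
          by (simp add: power2_eq_square exp_add[symmetric] algebra_simps)
        finally have "C3 * ((\<nu> (q - 1) / \<nu> (\<tau> + len)) * \<nu> \<tau>) \<le> C3 * (C\<^sup>2 * exp (-\<epsilon> * (real (q - 1) - real len)))"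
          using C3 by (intro mult_left_mono) auto
        then show "C3 * (\<nu> (q - 1) / \<nu> (\<tau> + len)) * \<nu> \<tau> \<le> C3 * C\<^sup>2 * exp (-\<epsilon> * (real (q - 1) - real len))" by (simp only: mult.assoc)
        show "0 \<le> C3 * (\<nu> (q - 1) / \<nu> (\<tau> + len)) * \<nu> \<tau>"
          using C3 pos[of "q - 1"] pos[of "\<tau> + len"] pos[of \<tau>] by (intro mult_nonneg_nonneg divide_nonneg_nonneg) auto
      qed (rule \<gamma>0)
      finally have "1 \<le> 2 * \<bar>Q\<bar> * (C3\<^sup>2 * C\<^sup>2 * (1 + \<Lambda>)) * exp (-\<epsilon> * (real (q - 1) - real len))" using r1 by linarith
      then show False by (rule fin) (use lq2 in linarith)
    next
      case False
      \<comment> \<open>Steps until the cyclic word reaches position q - 1, whose letter need not be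
        that of \<open>w\<close>. One crude step \<open>M\<close> crosses it; afterwards the word
        starts again at 0.\<close>
      define i1 where "i1 = q - 1 - \<tau>"
      have i1: "\<tau> + i1 = q - 1" "i1 < len" using \<tau> False by (auto simp: i1_def)
      define e where "e = len - 1 - i1"
      have ee: "i1 + 1 + e = len" using i1 by (simp add: e_def)
      have A: "\<gamma> (q - 1) \<le> C3 * \<gamma> (q - 1 + i1) * (\<nu> \<tau> / \<nu> (q - 1))"
      proof -
        have "norm (g (q - 1 + (\<tau> - \<tau>))) + norm (g (q - 1 + (Suc \<tau> - \<tau>)))
          \<le> C3 * (norm (g (q - 1 + (\<tau> + i1 - \<tau>))) + norm (g (q - 1 + (Suc (\<tau> + i1) - \<tau>)))) * (\<nu> \<tau> / \<nu> (\<tau> + i1))"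
        proof (rule red[where g = "\<lambda>j. g (q - 1 + (j - \<tau>))"])
          fix j assume j: "j \<in> {\<tau>..<\<tau> + i1}"
          define i where "i = j - \<tau>"
          have i: "j = i + \<tau>" "i < i1" "i < len" using j i1 by (auto simp: i_def)
          have "\<kappa>' (q - 1 + i) = \<kappa> j" using ky[OF i(3)] \<kappa>W[of j] i1 i \<tau> by simp
          then show "g (q - 1 + (Suc (Suc j) - \<tau>)) = - g (q - 1 + (j - \<tau>)) - of_real (\<kappa> j) * g (q - 1 + (Suc j - \<tau>))"
            using gs[OF i(3)] i by simp
        qed simp
        then have "\<gamma> (q - 1) \<le> C3 * \<gamma> (q - 1 + i1) * (\<nu> \<tau> / \<nu> (\<tau> + i1))" by (simp add: \<gamma>_def)
        then show ?thesis unfolding i1(1) .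
      qed
      have M: "\<gamma> (q - 1 + i1) \<le> (1 + \<Lambda>) * \<gamma> (Suc (q - 1 + i1))"
      proof -
        let ?j = "q - 1 + i1"
        have "\<bar>\<kappa>' ?j\<bar> \<le> \<Lambda>"
        proof -
          have "\<bar>vpot \<alpha> \<theta> (int ?j - int n)\<bar> \<le> 1" by (rule sturm_bounded[OF sturm_vpot]) (use \<alpha> in auto)
          then show ?thesis using mult_left_mono[of _ 1 "\<bar>lam\<bar>"] by (simp add: \<kappa>'_def \<Lambda>_def abs_mult)
        qed
        then have km: "\<bar>\<kappa>' ?j\<bar> * norm (g (Suc ?j)) \<le> \<Lambda> * norm (g (Suc ?j))" by (intro mult_right_mono) auto
        have "g ?j = - g (Suc (Suc ?j)) - of_real (\<kappa>' ?j) * g (Suc ?j)" using gs[OF i1(2)] by simp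
        then have "norm (g ?j) \<le> norm (g (Suc (Suc ?j))) + norm (of_real (\<kappa>' ?j) * g (Suc ?j))"
          by (metis norm_minus_cancel norm_triangle_ineq4)
        then have "norm (g ?j) \<le> norm (g (Suc (Suc ?j))) + \<Lambda> * norm (g (Suc ?j))" using km by (simp add: norm_mult)
        moreover have "0 \<le> \<Lambda> * norm (g (Suc (Suc ?j)))" using \<Lambda> by simp
        ultimately show ?thesis by (simp add: \<gamma>_def algebra_simps)
      qed
      have B': "\<gamma> (Suc (q - 1 + i1)) \<le> C3 * \<gamma> (n + 1) * (\<nu> 0 / \<nu> e)"
      proof -
        have "norm (g (q + i1 + 0)) + norm (g (q + i1 + Suc 0))
          \<le> C3 * (norm (g (q + i1 + e)) + norm (g (q + i1 + Suc e))) * (\<nu> 0 / \<nu> e)"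
        proof (rule red[where g = "\<lambda>j. g (q + i1 + j)"])
          fix j assume j: "j \<in> {0..<e}"
          define i where "i = i1 + 1 + j"
          have i: "i < len" "q - 1 + i = q + i1 + j" using j ee lq2 by (auto simp: i_def)
          have "int i + t = int j + cf_q \<alpha> (Suc k)" using i1(1) \<tau> q lq2 by (simp add: i_def)
          then have "\<kappa>' (q - 1 + i) = lam * W (int j)" using ky[OF i(1)] per by simp
          also have "\<dots> = \<kappa> j" using \<kappa>W[of j] j ee lq2 by simp
          finally have "\<kappa>' (q - 1 + i) = \<kappa> j" .
          then show "g (q + i1 + Suc (Suc j)) = - g (q + i1 + j) - of_real (\<kappa> j) * g (q + i1 + Suc j)"
            using gs[OF i(1)] unfolding i(2) by simp
        qed simp
        moreover have "Suc (q - 1 + i1) = q + i1" "q + i1 + e = n + 1" using lq2 ee end_eq by auto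
        ultimately show ?thesis by (simp add: \<gamma>_def)
      qed
      have "\<gamma> (q - 1) \<le> C3 * ((1 + \<Lambda>) * (C3 * \<gamma> (n + 1) * (\<nu> 0 / \<nu> e))) * (\<nu> \<tau> / \<nu> (q - 1))"
      proof -
        have "\<gamma> (q - 1 + i1) \<le> (1 + \<Lambda>) * (C3 * \<gamma> (n + 1) * (\<nu> 0 / \<nu> e))"
          using M mult_left_mono[OF B', of "1 + \<Lambda>"] \<Lambda> by linarith
        then have "C3 * \<gamma> (q - 1 + i1) * (\<nu> \<tau> / \<nu> (q - 1)) \<le> C3 * ((1 + \<Lambda>) * (C3 * \<gamma> (n + 1) * (\<nu> 0 / \<nu> e))) * (\<nu> \<tau> / \<nu> (q - 1))"
          using C3 pos[of \<tau>] pos[of "q - 1"] by (intro mult_right_mono mult_left_mono) auto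
        then show ?thesis using A by linarith
      qed
      then have "\<nu> (q - 1) * \<gamma> (q - 1) \<le> \<nu> (q - 1) * (C3 * ((1 + \<Lambda>) * (C3 * \<gamma> (n + 1) * (\<nu> 0 / \<nu> e))) * (\<nu> \<tau> / \<nu> (q - 1)))"
        using pos[of "q - 1"] by (intro mult_left_mono) auto
      also have "\<dots> = (C3\<^sup>2 * (1 + \<Lambda>) * (\<nu> \<tau> / \<nu> e)) * \<gamma> (n + 1)"
        using pos[of "q - 1"] \<nu>0 by (simp add: power2_eq_square)
      also have "\<dots> \<le> 2 * \<bar>Q\<bar> * (C3\<^sup>2 * C\<^sup>2 * (1 + \<Lambda>)) * exp (-\<epsilon> * (real q - real len))"
      proof (rule up[OF _ \<gamma>n CC(3)])
        \<comment> \<open>The factor \<nu> (q - 1) has cancelled; what remains is the decay from e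
          to \<tau>, over q - len steps.\<close>
        have te: "\<tau> + len = q + e" using i1 ee lq2 by linarith
        then have "e \<le> \<tau>" using lq2 by linarith
        then have "\<nu> \<tau> \<le> C * exp (-\<epsilon> * (real \<tau> - real e)) * \<nu> e" by (rule decay)
        moreover have "real \<tau> - real e = real q - real len" using te by linarith
        ultimately have "\<nu> \<tau> / \<nu> e \<le> C * exp (-\<epsilon> * (real q - real len))" using pos[of e] by (simp add: pos_divide_le_eq)
        then have "C3\<^sup>2 * (1 + \<Lambda>) * (\<nu> \<tau> / \<nu> e) \<le> C3\<^sup>2 * (1 + \<Lambda>) * (C * exp (-\<epsilon> * (real q - real len)))" using \<Lambda> by (intro mult_left_mono) auto
        then show "C3\<^sup>2 * (1 + \<Lambda>) * (\<nu> \<tau> / \<nu> e) \<le> C3\<^sup>2 * (1 + \<Lambda>) * C * exp (-\<epsilon> * (real q - real len))" by (simp only: mult.assoc)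
        show "0 \<le> C3\<^sup>2 * (1 + \<Lambda>) * (\<nu> \<tau> / \<nu> e)" using \<Lambda> pos[of \<tau>] pos[of e] by (intro mult_nonneg_nonneg divide_nonneg_nonneg) auto
      qed (rule \<gamma>0)
      finally have "1 \<le> 2 * \<bar>Q\<bar> * (C3\<^sup>2 * C\<^sup>2 * (1 + \<Lambda>)) * exp (-\<epsilon> * (real q - real len))" using r1 by linarith
      then show False by (rule fin) (use lq2 in linarith)
    qed
  qed
qed

section \<open>The equivalences\<close>

text \<open>Convergence applied to the unit vectors at 0 and 1 bounds these two columns of the
  inverses for every \<open>p\<close>. By symmetry they contain the entries of column -n at 0 and
  1.\<close>

lemma fsm_columns_bounded:
  assumes p: "1 \<le> p" and v: "\<And>n. \<bar>v n\<bar> \<le> 1" and fsm: "fsm_applicable p (schr_op v lam)"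
  obtains n0 Q where "\<And>n. n \<ge> n0 \<Longrightarrow> \<exists>g. (\<forall>i. i \<notin> box n \<longrightarrow> g i = 0) \<and>
     (\<forall>i\<in>box n. schr_op v lam g i = (if i = - int n then 1 else 0)) \<and> norm (g 0) \<le> Q \<and> norm (g 1) \<le> Q"
proof -
  let ?A = "schr_op v lam"
  define Ai where "Ai = inverse_on p UNIV ?A"
  define Bi where "Bi = (\<lambda>n. inverse_on p (box n) (compress (box n) ?A))"
  define B where "B = (\<lambda>n. Bi n \<circ> cut (box n))"
  obtain n1 where inv: "invertible_on p UNIV ?A" and invn: "\<And>n. n \<ge> n1 \<Longrightarrow> invertible_on p (box n) (compress (box n) ?A)"
    and conv: "if p = \<infinity> then
           (\<forall>k. (\<lambda>n. opnorm p UNIV (\<lambda>y. cut (box k) (B n y - Ai y))) \<longlonglongrightarrow> 0 \<and>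
                (\<lambda>n. opnorm p UNIV (\<lambda>y. B n (cut (box k) y) - Ai (cut (box k) y))) \<longlonglongrightarrow> 0)
         else (\<forall>y \<in> lp p UNIV. (\<lambda>n. lpnorm p (B n y - Ai y)) \<longlonglongrightarrow> 0)"
    using fsm unfolding fsm_applicable_def Let_def Ai_def B_def Bi_def by auto
  have Binv: "is_inverse_on p (box n) (compress (box n) ?A) (Bi n)" if "n \<ge> n1" for n
    unfolding Bi_def by (rule is_inverse_on_inverse_on[OF invn[OF that]])
  have Ainv: "is_inverse_on p UNIV ?A Ai" unfolding Ai_def by (rule is_inverse_on_inverse_on[OF inv])
  define \<delta> where "\<delta> = (\<lambda>k n::int. if n = k then 1 else 0 :: complex)"
  have \<delta>lp: "\<delta> k \<in> lp p I" if "k \<in> I" for k I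
    unfolding \<delta>_def by (rule lp_finite_support[OF _ _ p]) (use that in auto)
  have \<delta>norm: "lpnorm p (\<delta> k) = 1" for k unfolding \<delta>_def lpnorm_indicator[OF p] by simp
  have Bsol: "Bi n (\<delta> k) \<in> lp p (box n) \<and> (\<forall>i\<in>box n. ?A (Bi n (\<delta> k)) i = \<delta> k i)" if "n \<ge> n1" "k \<in> box n" for n k
  proof -
    have "Bi n (\<delta> k) \<in> lp p (box n)" "compress (box n) ?A (Bi n (\<delta> k)) = \<delta> k"
      using Binv[OF that(1)] \<delta>lp[OF that(2)] unfolding is_inverse_on_def by blast+
    then show ?thesis using compress_apply[of "Bi n (\<delta> k)" p "box n" ?A] by metis
  qed
  have cutd: "cut (box n) (\<delta> k) = \<delta> k" if "k \<in> box n" for n k using that by (auto simp: cut_def \<delta>_def)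
  \<comment> \<open>Restricted to \<open>box 1\<close>: for \<open>p = \<infinity>\<close> the
    convergence is available for columns in a fixed box.\<close>
  have bound: "\<exists>Q n2. \<forall>n\<ge>n2. \<forall>i. norm (Bi n (\<delta> k) i) \<le> Q" if k: "k \<in> box 1" for k
  proof -
    have ev: "\<forall>\<^sub>F n in sequentially. lpnorm p (B n (\<delta> k) - Ai (\<delta> k)) < 1"
    proof (cases "p = \<infinity>")
      case False
      then have "(\<lambda>n. lpnorm p (B n (\<delta> k) - Ai (\<delta> k))) \<longlonglongrightarrow> 0" using conv \<delta>lp[of k UNIV] by simp
      then show ?thesis by (rule order_tendstoD(2)) simp
    next
      case True
      have "(\<lambda>n. opnorm p UNIV (\<lambda>y. B n (cut (box 1) y) - Ai (cut (box 1) y))) \<longlonglongrightarrow> 0" using conv True by simp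
      then have "\<forall>\<^sub>F n in sequentially. opnorm p UNIV (\<lambda>y. B n (cut (box 1) y) - Ai (cut (box 1) y)) < 1"
        by (rule order_tendstoD(2)) simp
      then show ?thesis
      proof (rule eventually_mono)
        fix n assume lt: "opnorm p UNIV (\<lambda>y. B n (cut (box 1) y) - Ai (cut (box 1) y)) < 1"
        have "ereal (lpnorm p (B n (cut (box 1) (\<delta> k)) - Ai (cut (box 1) (\<delta> k)))) \<le> opnorm p UNIV (\<lambda>y. B n (cut (box 1) y) - Ai (cut (box 1) y))"
          unfolding opnorm_def using \<delta>lp[of k UNIV] \<delta>norm[of k]
          by (intro SUP_upper[where f = "\<lambda>x. ereal (lpnorm p (B n (cut (box 1) x) - Ai (cut (box 1) x)))"]) auto
        then have "ereal (lpnorm p (B n (\<delta> k) - Ai (\<delta> k))) < 1" using lt unfolding cutd[OF k] by (rule order.strict_trans1)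
        then show "lpnorm p (B n (\<delta> k) - Ai (\<delta> k)) < 1" by simp
      qed
    qed
    then obtain n2 where n2: "\<And>n. n \<ge> n2 \<Longrightarrow> lpnorm p (B n (\<delta> k) - Ai (\<delta> k)) < 1" unfolding eventually_sequentially by blast
    have Ak: "Ai (\<delta> k) \<in> lp p UNIV" using Ainv \<delta>lp[of k UNIV] unfolding is_inverse_on_def by blast
    have "norm (Bi n (\<delta> k) i) \<le> 1 + lpnorm p (Ai (\<delta> k))" if n: "n \<ge> max 1 (max n1 n2)" for n i
    proof -
      have kb: "k \<in> box n" using k n by (auto simp: box_def)
      have Bk: "Bi n (\<delta> k) \<in> lp p UNIV" using Bsol[OF _ kb] n lp_UNIV by auto
      have Bn: "B n (\<delta> k) = Bi n (\<delta> k)" using cutd[OF kb] by (simp add: B_def)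
      have "(B n (\<delta> k) - Ai (\<delta> k)) \<in> lp p UNIV \<and> lpnorm p (B n (\<delta> k) - Ai (\<delta> k)) \<le> 2 * (lpnorm p (\<lambda>n'. 2 * Bi n (\<delta> k) n') + lpnorm p (\<lambda>n. 2 * Ai (\<delta> k) n))"
      proof (rule lp_max_dominated[OF p lp_scale[OF p Bk] lp_scale[OF p Ak]])
        fix j
        show "norm ((B n (\<delta> k) - Ai (\<delta> k)) j) \<le> norm (2 * Bi n (\<delta> k) j) \<or> norm ((B n (\<delta> k) - Ai (\<delta> k)) j) \<le> norm (2 * Ai (\<delta> k) j)"
          unfolding norm_mult using norm_triangle_ineq4[of "Bi n (\<delta> k) j" "Ai (\<delta> k) j"] by (simp add: Bn) linarith
      qed
      then have "norm ((B n (\<delta> k) - Ai (\<delta> k)) i) \<le> lpnorm p (B n (\<delta> k) - Ai (\<delta> k))" using norm_le_lpnorm[OF p] by blast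
      then have "norm (Bi n (\<delta> k) i - Ai (\<delta> k) i) < 1" using n2[of n] n by (simp add: Bn)
      then show ?thesis using norm_triangle_sub[of "Bi n (\<delta> k) i" "Ai (\<delta> k) i"] norm_le_lpnorm[OF p Ak, of i] by linarith
    qed
    then show ?thesis by blast
  qed
  have "0 \<in> box 1" "1 \<in> box 1" by (auto simp: box_def)
  then obtain Q0 m0 Q1 m1 where Q0: "\<And>n i. n \<ge> m0 \<Longrightarrow> norm (Bi n (\<delta> 0) i) \<le> Q0" and Q1: "\<And>n i. n \<ge> m1 \<Longrightarrow> norm (Bi n (\<delta> 1) i) \<le> Q1"
    using bound by metis
  show ?thesis
  proof (rule that[of "max 1 (max n1 (max m0 m1))" "max Q0 Q1"])
    fix n assume n: "max 1 (max n1 (max m0 m1)) \<le> n"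
    have bx: "- int n \<in> box n" "0 \<in> box n" "1 \<in> box n" using n by (auto simp: box_def)
    have n1: "n \<ge> n1" using n by simp
    define g where "g = Bi n (\<delta> (- int n))"
    have g: "g i = 0" if "i \<notin> box n" for i using Bsol[OF n1 bx(1)] that by (auto simp: g_def lp_def)
    have gs: "?A g i = \<delta> (- int n) i" if "i \<in> box n" for i using Bsol[OF n1 bx(1)] that by (auto simp: g_def)
    have sym: "g k = Bi n (\<delta> k) (- int n)" if k: "k \<in> box n" for k
    proof -
      let ?h = "Bi n (\<delta> k)"
      have h: "?h i = 0" if "i \<notin> box n" for i using Bsol[OF n1 k] that by (auto simp: lp_def)
      have hs: "?A ?h i = \<delta> k i" if "i \<in> box n" for i using Bsol[OF n1 k] that by auto
      have "(\<Sum>i\<in>box n. g i * ?A ?h i) = (\<Sum>i\<in>box n. ?h i * ?A g i)"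
        unfolding box_def by (rule schr_op_symmetric) (use g h in \<open>auto simp: box_def\<close>)
      moreover have "(\<Sum>i\<in>box n. g i * ?A ?h i) = (\<Sum>i\<in>box n. if i = k then g i else 0)"
        by (rule sum.cong) (use hs in \<open>simp_all add: \<delta>_def\<close>)
      moreover have "(\<Sum>i\<in>box n. ?h i * ?A g i) = (\<Sum>i\<in>box n. if i = - int n then ?h i else 0)"
        by (rule sum.cong) (use gs in \<open>simp_all add: \<delta>_def\<close>)
      moreover have "finite (box n)" by (simp add: box_def)
      ultimately show ?thesis using k bx(1) by (simp add: sum.delta)
    qed
    have "norm (g 0) \<le> max Q0 Q1" "norm (g 1) \<le> max Q0 Q1"
      using sym[OF bx(2)] sym[OF bx(3)] Q0[of n "- int n"] Q1[of n "- int n"] n by auto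
    then show "\<exists>g. (\<forall>i. i \<notin> box n \<longrightarrow> g i = 0) \<and>
     (\<forall>i\<in>box n. ?A g i = (if i = - int n then 1 else 0)) \<and> norm (g 0) \<le> max Q0 Q1 \<and> norm (g 1) \<le> max Q0 Q1"
      using g gs by (intro exI[of _ g]) (auto simp: \<delta>_def)
  qed
qed

lemma plus_part_lower_bound:
  assumes p: "1 \<le> p" and inv: "invertible_on p {0..} (plus_part (schr_op v lam))"
  shows "\<exists>c>0. lower_bound lam c v {0..}"
proof -
  obtain B where B: "is_inverse_on p {0..} (compress {0..} (schr_op v lam)) B"
    using inv unfolding invertible_on_def plus_part_def by blast
  then obtain D where D: "\<And>x. x \<in> lp p {0..} \<Longrightarrow> lpnorm p (B x) \<le> D * lpnorm p x" unfolding is_inverse_on_def by blast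
  obtain c where "c > 0" "\<And>v I B. \<lbrakk>I \<noteq> {}; is_inverse_on p I (compress I (schr_op v lam)) B;
     \<And>x. x \<in> lp p I \<Longrightarrow> lpnorm p (B x) \<le> D * lpnorm p x\<rbrakk> \<Longrightarrow> lower_bound lam c v I"
    by (rule lower_bound_of_inverse[OF p, of lam D]) (rule that; blast)
  then show ?thesis using B D by (metis atLeast_eq_UNIV_iff empty_not_UNIV greaterThan_non_empty ex_in_conv atLeast_iff order_refl)
qed

lemma plus_part_uniform_lower_bound:
  assumes p: "1 \<le> p"
  obtains c where "c > 0" "\<And>v. inv_norm p {0..} (plus_part (schr_op v lam)) \<le> ereal D \<Longrightarrow> lower_bound lam c v {0..}"
proof -
  obtain c where c: "c > 0" "\<And>v I B. \<lbrakk>I \<noteq> {}; is_inverse_on p I (compress I (schr_op v lam)) B;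
     \<And>x. x \<in> lp p I \<Longrightarrow> lpnorm p (B x) \<le> D * lpnorm p x\<rbrakk> \<Longrightarrow> lower_bound lam c v I"
    by (rule lower_bound_of_inverse[OF p, of lam D]) (rule that; blast)
  show ?thesis
  proof (rule that[OF c(1)])
    fix v assume D: "inv_norm p {0..} (plus_part (schr_op v lam)) \<le> ereal D"
    then have inv: "invertible_on p {0..} (plus_part (schr_op v lam))" by (auto simp: inv_norm_def split: if_splits)
    show "lower_bound lam c v {0..}"
      by (rule c(2)[OF _ is_inverse_on_inverse_on[OF inv[unfolded plus_part_def]] bound_of_inv_norm[OF p inv[unfolded plus_part_def] D[unfolded plus_part_def]]]) auto
  qed
qed

theorem theorem6p2:
  fixes p :: ereal and \<alpha> \<theta> lam :: real
  assumes p: "1 \<le> p"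
    and \<alpha>: "\<alpha> \<in> {0..1}" "\<alpha> \<notin> \<rat>"
    and \<theta>: "\<theta> \<in> {0..<1}"
  defines "\<theta>k \<equiv> (\<lambda>k::int. frac (of_int k * \<alpha>))"
  shows
    "(fsm_applicable p (H lam \<alpha> \<theta>)
        \<longleftrightarrow> (\<forall>\<psi> \<in> {0..<1}. invertible_on p {0..} (plus_part (H lam \<alpha> \<psi>)) \<and>
                            invertible_on p {0..} (plus_part (H_tilde lam \<alpha> \<psi>))))
   \<and> (fsm_applicable p (H lam \<alpha> \<theta>)
        \<longleftrightarrow> ((\<forall>k. invertible_on p {0..} (plus_part (H lam \<alpha> (\<theta>k k)))) \<and>
             (\<exists>C::real. \<forall>k. inv_norm p {0..} (plus_part (H lam \<alpha> (\<theta>k k))) \<le> ereal C)))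
   \<and> (fsm_applicable p (H lam \<alpha> \<theta>)
        \<longleftrightarrow> ((\<forall>k. invertible_on p {0..} (plus_part (H_tilde lam \<alpha> (\<theta>k k)))) \<and>
             (\<exists>C::real. \<forall>k. inv_norm p {0..} (plus_part (H_tilde lam \<alpha> (\<theta>k k))) \<le> ereal C)))
   \<and> (fsm_applicable p (H lam \<alpha> \<theta>)
        \<longleftrightarrow> ((\<forall>k. stable_seq p {0..} (\<lambda>m. plus_part (H lam (approximant \<alpha> m) (\<theta>k k)))) \<and>
             limsup (\<lambda>m. SUP k. inv_norm p {0..} (plus_part (H lam (approximant \<alpha> m) (\<theta>k k)))) < \<infinity>))"
proof -
  have "\<alpha> \<noteq> 0" "\<alpha> \<noteq> 1" using \<alpha>(2) by (metis Rats_0, metis Rats_1)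
  then have irr: "\<alpha> \<notin> \<rat>" "0 < \<alpha>" "\<alpha> < 1" using \<alpha> by auto
  have st: "sturm \<alpha> (vpot \<alpha> \<psi>)" "sturm \<alpha> (vpot_tilde \<alpha> \<psi>)" for \<psi>
    using irr by (auto intro: sturm_vpot sturm_vpot_tilde)
  have sb: "\<bar>v n\<bar> \<le> 1" if "sturm \<alpha> v" for v n by (rule sturm_bounded[OF that]) (use irr in auto)
  have H: "H lam \<beta> \<psi> = schr_op (vpot \<beta> \<psi>) lam" "H_tilde lam \<beta> \<psi> = schr_op (vpot_tilde \<beta> \<psi>) lam" for \<beta> \<psi>
    by (simp_all add: H_def H_tilde_def)
  have vk: "vpot \<beta> (\<theta>k k) j = vpot \<beta> (of_int k * \<alpha>) j" "vpot_tilde \<beta> (\<theta>k k) j = vpot_tilde \<beta> (of_int k * \<alpha>) j" for \<beta> k j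
    by (simp_all add: \<theta>k_def vpot_frac vpot_tilde_frac)
  define P where "P \<longleftrightarrow> (\<exists>c>0. \<forall>v. sturm \<alpha> v \<longrightarrow> lower_bound lam c v {0..})"

  have inv_of_P: "\<exists>D. \<forall>v. sturm \<alpha> v \<longrightarrow> invertible_on p {0..} (plus_part (schr_op v lam)) \<and>
      inv_norm p {0..} (plus_part (schr_op v lam)) \<le> ereal D" if P
  proof -
    obtain c where c: "c > 0" "\<And>v. sturm \<alpha> v \<Longrightarrow> lower_bound lam c v {0..}" using \<open>P\<close> unfolding P_def by blast
    obtain D where D: "\<And>v. \<lbrakk>\<And>n. \<bar>v n\<bar> \<le> 1; \<And>a. lower_bound lam c v {a..}; \<And>b. lower_bound lam c v {..b}\<rbrakk> \<Longrightarrow>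
     invertible_on p {0..} (plus_part (schr_op v lam)) \<and> inv_norm p {0..} (plus_part (schr_op v lam)) \<le> ereal D"
      by (rule half_line_invertible[OF p c(1), of lam]) (rule that; blast)
    show ?thesis
    proof (intro exI allI impI)
      fix v assume v: "sturm \<alpha> v"
      show "invertible_on p {0..} (plus_part (schr_op v lam)) \<and> inv_norm p {0..} (plus_part (schr_op v lam)) \<le> ereal D"
        by (rule D[OF sb[OF v] sturm_lower_bounds[OF c(2) v]])
    qed
  qed

  \<comment> \<open>\<open>I\<close> is the line or the half line; in either case words carry the
    bound to the line for all coded sequences, as the compactness argument requires.\<close>
  have P_of_U: P if lb: "lower_bound lam c0 (vpot \<alpha> \<psi>0) I" "{0..} \<subseteq> I" "c0 > 0"
    and pw: "\<And>\<psi>. \<exists>c>0. lower_bound lam c (vpot \<alpha> \<psi>) {0..}" "\<And>\<psi>. \<exists>c>0. lower_bound lam c (vpot_tilde \<alpha> \<psi>) {0..}" for c0 \<psi>0 I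
    unfolding P_def by (rule uniform_lower_bound[OF irr half_line_to_UNIV[OF irr lb(1,2)] lb(3) pw])

  \<comment> \<open>Either coding serves, since each word occurs at the same position in both; this
    treats the two conditions on the orbit at once.\<close>
  have P_of_orbit: P if "c > 0" and lb: "\<And>k. lower_bound lam c (W k) {0..}"
    and W: "\<And>k j. W k j = vpot \<alpha> 0 (j + k) \<or> W k j = vpot_tilde \<alpha> 0 (j + k)" for c and W :: "int \<Rightarrow> int \<Rightarrow> real"
  proof -
    have "lower_bound lam c v {0..}" if v: "sturm \<alpha> v" for v
    proof (rule lower_bound_of_words)
      fix n :: int assume n: "n \<ge> 0"
      obtain k where k: "\<And>j. j \<in> {0..n} \<Longrightarrow> v j = vpot \<alpha> 0 (j + k)" "\<And>j. j \<in> {0..n} \<Longrightarrow> v j = vpot_tilde \<alpha> 0 (j + k)"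
        using sturm_word_occurs[OF irr n v, where K = 0 and \<theta> = 0] by metis
      have "v j = W k j" if "j \<in> {0..n}" for j using W[of k j] k[OF that] by auto
      then show "\<exists>w. lower_bound lam c w {0..} \<and> (\<forall>j\<in>{0..n}. v j = w j)" using lb by blast
    qed
    then show P using \<open>c > 0\<close> unfolding P_def by blast
  qed

  have i: "fsm_applicable p (H lam \<alpha> \<theta>) \<longleftrightarrow> P"
  proof
    assume P
    then obtain c where c: "c > 0" "\<And>v. sturm \<alpha> v \<Longrightarrow> lower_bound lam c v {0..}" unfolding P_def by blast
    show "fsm_applicable p (H lam \<alpha> \<theta>)" unfolding H
      by (rule fsm_applicable_of_lower_bounds[OF p c(1) sb[OF st(1)] sturm_lower_bounds[OF c(2) st(1)]])
  next
    assume fsm: "fsm_applicable p (H lam \<alpha> \<theta>)"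
    then have "invertible_on p UNIV (schr_op (vpot \<alpha> \<theta>) lam)" unfolding fsm_applicable_def H by blast
    then obtain B where B: "is_inverse_on p UNIV (schr_op (vpot \<alpha> \<theta>) lam) B" unfolding invertible_on_def by blast
    then obtain D where D: "\<And>x. x \<in> lp p UNIV \<Longrightarrow> lpnorm p (B x) \<le> D * lpnorm p x" unfolding is_inverse_on_def by blast
    have cU: "compress UNIV A = A" for A by (auto simp: compress_def cut_def)
    obtain c0 where c0: "c0 > 0" "\<And>v I B. \<lbrakk>I \<noteq> {}; is_inverse_on p I (compress I (schr_op v lam)) B;
       \<And>x. x \<in> lp p I \<Longrightarrow> lpnorm p (B x) \<le> D * lpnorm p x\<rbrakk> \<Longrightarrow> lower_bound lam c0 v I"
      by (rule lower_bound_of_inverse[OF p, of lam D]) (rule that; blast)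
    have U: "lower_bound lam c0 (vpot \<alpha> \<theta>) UNIV" by (rule c0(2)[of UNIV _ B]) (use B D cU in auto)
    obtain n0 Q where col: "\<And>n. n \<ge> n0 \<Longrightarrow> \<exists>g. (\<forall>i. i \<notin> box n \<longrightarrow> g i = 0) \<and>
       (\<forall>i\<in>box n. schr_op (vpot \<alpha> \<theta>) lam g i = (if i = - int n then 1 else 0)) \<and> norm (g 0) \<le> Q \<and> norm (g 1) \<le> Q"
      by (rule fsm_columns_bounded[OF p sb[OF st(1)] fsm[unfolded H]]) (rule that; blast)
    \<comment> \<open>The resonance argument gives a constant for each sequence separately;
      compactness makes it uniform afterwards.\<close>
    have "\<exists>c>0. lower_bound lam c w {0..}" if w: "sturm \<alpha> w" for w
    proof (rule ccontr)
      assume "\<not> (\<exists>c>0. lower_bound lam c w {0..})"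
      then have no: "\<And>c. c > 0 \<Longrightarrow> \<not> lower_bound lam c w {0..}" by blast
      show False
        by (rule resonance[where Q = Q and \<theta> = \<theta>, OF irr w half_line_to_UNIV[OF irr U subset_UNIV w] c0(1) no]) (assumption, erule col)
    qed
    then show P using P_of_U[OF U _ c0(1)] st by auto
  qed

  have ii: "P \<longleftrightarrow> (\<forall>\<psi> \<in> {0..<1}. invertible_on p {0..} (plus_part (H lam \<alpha> \<psi>)) \<and>
                            invertible_on p {0..} (plus_part (H_tilde lam \<alpha> \<psi>)))"
  proof
    assume P
    then show "\<forall>\<psi> \<in> {0..<1}. invertible_on p {0..} (plus_part (H lam \<alpha> \<psi>)) \<and> invertible_on p {0..} (plus_part (H_tilde lam \<alpha> \<psi>))"
      using inv_of_P st unfolding H by blast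
  next
    assume inv: "\<forall>\<psi> \<in> {0..<1}. invertible_on p {0..} (plus_part (H lam \<alpha> \<psi>)) \<and> invertible_on p {0..} (plus_part (H_tilde lam \<alpha> \<psi>))"
    have f: "frac \<psi> \<in> {0..<1}" for \<psi> :: real using frac_lt_1[of \<psi>] by simp
    have pw: "\<exists>c>0. lower_bound lam c (vpot \<alpha> \<psi>) {0..}" "\<exists>c>0. lower_bound lam c (vpot_tilde \<alpha> \<psi>) {0..}" for \<psi>
    proof -
      have *: "invertible_on p {0..} (plus_part (schr_op (vpot \<alpha> \<psi>) lam))" "invertible_on p {0..} (plus_part (schr_op (vpot_tilde \<alpha> \<psi>) lam))"
        using inv[rule_format, OF f[of \<psi>]] unfolding H vpot_frac vpot_tilde_frac by auto
      show "\<exists>c>0. lower_bound lam c (vpot \<alpha> \<psi>) {0..}" by (rule plus_part_lower_bound[OF p *(1)])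
      show "\<exists>c>0. lower_bound lam c (vpot_tilde \<alpha> \<psi>) {0..}" by (rule plus_part_lower_bound[OF p *(2)])
    qed
    obtain c0 where "c0 > 0" "lower_bound lam c0 (vpot \<alpha> 0) {0..}" using pw by blast
    then show P using P_of_U pw by blast
  qed

  have iii: "P \<longleftrightarrow> (\<forall>k. invertible_on p {0..} (plus_part (H lam \<alpha> (\<theta>k k)))) \<and>
             (\<exists>C::real. \<forall>k. inv_norm p {0..} (plus_part (H lam \<alpha> (\<theta>k k))) \<le> ereal C)"
  proof
    assume P
    then show "(\<forall>k. invertible_on p {0..} (plus_part (H lam \<alpha> (\<theta>k k)))) \<and>
             (\<exists>C::real. \<forall>k. inv_norm p {0..} (plus_part (H lam \<alpha> (\<theta>k k))) \<le> ereal C)"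
      using inv_of_P st unfolding H by blast
  next
    assume "(\<forall>k. invertible_on p {0..} (plus_part (H lam \<alpha> (\<theta>k k)))) \<and>
             (\<exists>C::real. \<forall>k. inv_norm p {0..} (plus_part (H lam \<alpha> (\<theta>k k))) \<le> ereal C)"
    then obtain D where D: "\<And>k. inv_norm p {0..} (plus_part (H lam \<alpha> (\<theta>k k))) \<le> ereal D" by blast
    obtain c where c: "c > 0" "\<And>v. inv_norm p {0..} (plus_part (schr_op v lam)) \<le> ereal D \<Longrightarrow> lower_bound lam c v {0..}"
      using plus_part_uniform_lower_bound[OF p] by blast
    show P
      by (rule P_of_orbit[OF c(1), of "\<lambda>k. vpot \<alpha> (\<theta>k k)"]) (use c(2) D vk in \<open>auto simp: H vpot_shift\<close>)
  qed

  have iv: "P \<longleftrightarrow> (\<forall>k. invertible_on p {0..} (plus_part (H_tilde lam \<alpha> (\<theta>k k)))) \<and>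
             (\<exists>C::real. \<forall>k. inv_norm p {0..} (plus_part (H_tilde lam \<alpha> (\<theta>k k))) \<le> ereal C)"
  proof
    assume P
    then show "(\<forall>k. invertible_on p {0..} (plus_part (H_tilde lam \<alpha> (\<theta>k k)))) \<and>
             (\<exists>C::real. \<forall>k. inv_norm p {0..} (plus_part (H_tilde lam \<alpha> (\<theta>k k))) \<le> ereal C)"
      using inv_of_P st unfolding H by blast
  next
    assume "(\<forall>k. invertible_on p {0..} (plus_part (H_tilde lam \<alpha> (\<theta>k k)))) \<and>
             (\<exists>C::real. \<forall>k. inv_norm p {0..} (plus_part (H_tilde lam \<alpha> (\<theta>k k))) \<le> ereal C)"
    then obtain D where D: "\<And>k. inv_norm p {0..} (plus_part (H_tilde lam \<alpha> (\<theta>k k))) \<le> ereal D" by blast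
    obtain c where c: "c > 0" "\<And>v. inv_norm p {0..} (plus_part (schr_op v lam)) \<le> ereal D \<Longrightarrow> lower_bound lam c v {0..}"
      using plus_part_uniform_lower_bound[OF p] by blast
    show P
      by (rule P_of_orbit[OF c(1), of "\<lambda>k. vpot_tilde \<alpha> (\<theta>k k)"]) (use c(2) D vk in \<open>auto simp: H vpot_tilde_shift\<close>)
  qed

  note appr = approximant_tendsto[OF irr]
  have ev01: "\<forall>\<^sub>F m in sequentially. 0 \<le> approximant \<alpha> m \<and> approximant \<alpha> m \<le> 1"
    using eventually_conj[OF order_tendstoD(1)[OF appr irr(2)] order_tendstoD(2)[OF appr irr(3)]]
    by (rule eventually_mono) auto

  have v: "P \<longleftrightarrow> (\<forall>k. stable_seq p {0..} (\<lambda>m. plus_part (H lam (approximant \<alpha> m) (\<theta>k k)))) \<and>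
             limsup (\<lambda>m. SUP k. inv_norm p {0..} (plus_part (H lam (approximant \<alpha> m) (\<theta>k k)))) < \<infinity>"
  proof
    assume P
    then obtain c where c: "c > 0" "\<And>v. sturm \<alpha> v \<Longrightarrow> lower_bound lam c v {0..}" unfolding P_def by blast
    have c2: "c / 2 > 0" using c by simp
    obtain D where D: "\<And>v. \<lbrakk>\<And>n. \<bar>v n\<bar> \<le> 1; \<And>a. lower_bound lam (c / 2) v {a..}; \<And>b. lower_bound lam (c / 2) v {..b}\<rbrakk> \<Longrightarrow>
       invertible_on p {0..} (plus_part (schr_op v lam)) \<and> inv_norm p {0..} (plus_part (schr_op v lam)) \<le> ereal D"
      by (rule half_line_invertible[OF p c2, of lam]) (rule that; blast)
    \<comment> \<open>The window length of \<open>lower_bound_localize\<close>. It depends on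
      \<open>c\<close> alone, so one neighbourhood of \<alpha> serves all phases.\<close>
    define N where "N = nat \<lceil>8 / c + 2\<rceil>"
    have N: "real N \<ge> 8 / c + 2" unfolding N_def by (rule real_nat_ceiling_ge)
    have "\<forall>\<^sub>F m in sequentially. \<forall>v. sturm (approximant \<alpha> m) v \<longrightarrow> (\<exists>N' a b. a < b \<and> (\<forall>j\<in>{0..int N}. v j = real_of_int (N' (j + 1) - N' j)) \<and>
       (\<forall>\<psi>\<in>{a<..<b}. \<forall>j\<in>{0..int N + 1}. real_of_int (N' j) < real_of_int j * \<alpha> + \<psi> \<and> real_of_int j * \<alpha> + \<psi> < real_of_int (N' j) + 1))"
      by (rule eventually_compose_filterlim[OF eventually_sturm_phase[OF irr(1)] appr]) simp
    then have "\<forall>\<^sub>F m in sequentially. \<forall>v. sturm (approximant \<alpha> m) v \<longrightarrow>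
        invertible_on p {0..} (plus_part (schr_op v lam)) \<and> inv_norm p {0..} (plus_part (schr_op v lam)) \<le> ereal D"
      using ev01
    proof eventually_elim
      case (elim m)
      let ?\<beta> = "approximant \<alpha> m"
      have lb: "lower_bound lam (c / 2) v {0..}" if v: "sturm ?\<beta> v" for v
      proof (rule lower_bound_localize[OF _ c(1) N])
        fix x M a n
        assume a: "a \<ge> 0" and x: "\<And>n. n \<notin> {a..a + int N} \<Longrightarrow> x n = 0" "\<And>n. n \<ge> a \<Longrightarrow> norm (schr_op v lam x n) \<le> M"
        \<comment> \<open>Shifted to 0, the word in the window is also a word of the rotation by
          \<alpha> and is therefore subject to the bound \<open>c\<close>.\<close>
        obtain N' l r where lr: "l < r" and N': "\<And>j. j \<in> {0..int N} \<Longrightarrow> v (j + a) = real_of_int (N' (j + 1) - N' j)"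
          "\<And>\<psi> j. \<lbrakk>\<psi> \<in> {l<..<r}; j \<in> {0..int N + 1}\<rbrakk> \<Longrightarrow> real_of_int (N' j) < real_of_int j * \<alpha> + \<psi> \<and> real_of_int j * \<alpha> + \<psi> < real_of_int (N' j) + 1"
          using elim(1)[rule_format, OF sturm_shift[OF v, of a]] by blast
        define \<psi> where "\<psi> = (l + r) / 2"
        have \<psi>: "\<psi> \<in> {l<..<r}" using lr by (simp add: \<psi>_def)
        have va: "v (j + a) = vpot \<alpha> \<psi> j" if j: "j \<in> {0..int N}" for j
        proof -
          have j': "j \<in> {0..int N + 1}" "j + 1 \<in> {0..int N + 1}" using j by auto
          have "vpot \<alpha> \<psi> j = real_of_int (N' (j + 1) - N' j)"
            by (rule vpot_eq_of_floor) (use N'(2)[OF \<psi> j'(1)] N'(2)[OF \<psi> j'(2)] irr in auto)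
          then show ?thesis using N'(1)[OF j] by simp
        qed
        have "c * norm (x (n - a + a)) \<le> M"
        proof (rule lower_boundD[OF c(2)[OF st(1)[of \<psi>]], where x = "\<lambda>n. x (n + a)"])
          have "{n. x (n + a) \<noteq> 0} \<subseteq> {0..int N}" using x(1) by force
          then show "finite {n. x (n + a) \<noteq> 0}" by (rule finite_subset) simp
          show "x (n + a) = 0" if "n \<notin> {0..}" for n by (rule x(1)) (use that in auto)
          have "schr_op (vpot \<alpha> \<psi>) lam (\<lambda>n. x (n + a)) = schr_op (\<lambda>n. v (n + a)) lam (\<lambda>n. x (n + a))"
          proof (rule schr_op_cong)
            fix n assume "x (n + a) \<noteq> 0"
            then have "n + a \<in> {a..a + int N}" using x(1) by blast
            then show "vpot \<alpha> \<psi> n = v (n + a)" using va[of n] by auto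
          qed
          then show "norm (schr_op (vpot \<alpha> \<psi>) lam (\<lambda>n. x (n + a)) n) \<le> M" if "n \<in> {0..}" for n
            using x(2)[of "n + a"] that by (simp add: schr_op_shift)
        qed
        then show "c * norm (x n) \<le> M" by simp
      qed
      show ?case
      proof (intro allI impI)
        fix v assume v: "sturm ?\<beta> v"
        show "invertible_on p {0..} (plus_part (schr_op v lam)) \<and> inv_norm p {0..} (plus_part (schr_op v lam)) \<le> ereal D"
          by (rule D) (use sturm_bounded[OF v] elim(2) sturm_lower_bounds[OF lb v] in auto)
      qed
    qed
    then have "\<forall>\<^sub>F m in sequentially. \<forall>k. invertible_on p {0..} (plus_part (H lam (approximant \<alpha> m) (\<theta>k k))) \<and>
         inv_norm p {0..} (plus_part (H lam (approximant \<alpha> m) (\<theta>k k))) \<le> ereal D"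
      using ev01 by eventually_elim (auto simp: H intro!: sturm_vpot)
    then obtain m0 where m0: "\<And>m k. m \<ge> m0 \<Longrightarrow> invertible_on p {0..} (plus_part (H lam (approximant \<alpha> m) (\<theta>k k))) \<and>
         inv_norm p {0..} (plus_part (H lam (approximant \<alpha> m) (\<theta>k k))) \<le> ereal D"
      unfolding eventually_sequentially by blast
    have "limsup (\<lambda>m. SUP k. inv_norm p {0..} (plus_part (H lam (approximant \<alpha> m) (\<theta>k k)))) \<le> ereal D"
      by (rule Limsup_bounded, rule eventually_sequentiallyI[of m0]) (use m0 in \<open>auto intro!: SUP_least\<close>)
    then have "limsup (\<lambda>m. SUP k. inv_norm p {0..} (plus_part (H lam (approximant \<alpha> m) (\<theta>k k)))) < \<infinity>"
      by (rule order_le_less_trans) simp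
    then show "(\<forall>k. stable_seq p {0..} (\<lambda>m. plus_part (H lam (approximant \<alpha> m) (\<theta>k k)))) \<and>
             limsup (\<lambda>m. SUP k. inv_norm p {0..} (plus_part (H lam (approximant \<alpha> m) (\<theta>k k)))) < \<infinity>"
      using m0 unfolding stable_seq_def by blast
  next
    assume "(\<forall>k. stable_seq p {0..} (\<lambda>m. plus_part (H lam (approximant \<alpha> m) (\<theta>k k)))) \<and>
             limsup (\<lambda>m. SUP k. inv_norm p {0..} (plus_part (H lam (approximant \<alpha> m) (\<theta>k k)))) < \<infinity>"
    then obtain D where "limsup (\<lambda>m. SUP k. inv_norm p {0..} (plus_part (H lam (approximant \<alpha> m) (\<theta>k k)))) < ereal D"
      using less_PInf_Ex_of_nat by (metis ereal_dense2)
    then have "\<forall>\<^sub>F m in sequentially. (SUP k. inv_norm p {0..} (plus_part (H lam (approximant \<alpha> m) (\<theta>k k)))) < ereal D"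
      by (rule Limsup_lessD)
    then have evD: "\<forall>\<^sub>F m in sequentially. \<forall>k. inv_norm p {0..} (plus_part (H lam (approximant \<alpha> m) (\<theta>k k))) \<le> ereal D"
      by (rule eventually_mono) (meson SUP_lessD UNIV_I less_imp_le)
    obtain c where c: "c > 0" "\<And>v. inv_norm p {0..} (plus_part (schr_op v lam)) \<le> ereal D \<Longrightarrow> lower_bound lam c v {0..}"
      using plus_part_uniform_lower_bound[OF p] by blast
    have "lower_bound lam c v {0..}" if v: "sturm \<alpha> v" for v
    proof (rule lower_bound_of_words)
      fix n :: int assume n: "n \<ge> 0"
      obtain N a b where ab: "a < b" and N: "\<And>j. j \<in> {0..n} \<Longrightarrow> v j = real_of_int (N (j + 1) - N j)"
       "\<And>\<psi> j. \<lbrakk>a < \<psi>; \<psi> < b; j \<in> {0..n + 1}\<rbrakk> \<Longrightarrow> real_of_int (N j) < real_of_int j * \<alpha> + \<psi> \<and> real_of_int j * \<alpha> + \<psi> < real_of_int (N j) + 1"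
        using sturm_phase[OF irr(1) n v] by metis
      \<comment> \<open>The orbit point k \<alpha> is fixed before \<open>m\<close> grows. The
        finitely many inequalities at \<alpha> are strict and persist for the approximants, which
        then produce the same word with the phase \<theta>_k.\<close>
      obtain k r :: int where k: "a < 0 + of_int k * \<alpha> + of_int r" "0 + of_int k * \<alpha> + of_int r < b"
        using irrational_orbit_dense[OF irr(1) ab, of 0 0] by blast
      let ?\<psi> = "0 + of_int k * \<alpha> + of_int r"
      have "\<forall>\<^sub>F m in sequentially. \<forall>j\<in>{0..n + 1}. real_of_int (N j) < real_of_int j * approximant \<alpha> m + ?\<psi> \<and> real_of_int j * approximant \<alpha> m + ?\<psi> < real_of_int (N j) + 1"
      proof (rule eventually_ball_finite)
        show "\<forall>j\<in>{0..n + 1}. \<forall>\<^sub>F m in sequentially. real_of_int (N j) < real_of_int j * approximant \<alpha> m + ?\<psi> \<and> real_of_int j * approximant \<alpha> m + ?\<psi> < real_of_int (N j) + 1"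
        proof
          fix j assume j: "j \<in> {0..n + 1}"
          have l: "(\<lambda>m. real_of_int j * approximant \<alpha> m + ?\<psi>) \<longlonglongrightarrow> real_of_int j * \<alpha> + ?\<psi>" by (intro tendsto_intros appr)
          show "\<forall>\<^sub>F m in sequentially. real_of_int (N j) < real_of_int j * approximant \<alpha> m + ?\<psi> \<and> real_of_int j * approximant \<alpha> m + ?\<psi> < real_of_int (N j) + 1"
            by (intro eventually_conj order_tendstoD[OF l]) (use N(2)[OF k j] in auto)
        qed
      qed simp
      then have "\<forall>\<^sub>F m in sequentially. lower_bound lam c (vpot (approximant \<alpha> m) (\<theta>k k)) {0..} \<and> (\<forall>j\<in>{0..n}. v j = vpot (approximant \<alpha> m) (\<theta>k k) j)"
        using evD ev01
      proof eventually_elim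
        case (elim m)
        have "lower_bound lam c (vpot (approximant \<alpha> m) (\<theta>k k)) {0..}" by (rule c(2)) (use elim(2) in \<open>auto simp: H\<close>)
        moreover have "v j = vpot (approximant \<alpha> m) (\<theta>k k) j" if j: "j \<in> {0..n}" for j
        proof -
          have j': "j \<in> {0..n + 1}" "j + 1 \<in> {0..n + 1}" using j by auto
          have "vpot (approximant \<alpha> m) ?\<psi> j = real_of_int (N (j + 1) - N j)"
            by (rule vpot_eq_of_floor) (use elim(1)[rule_format, OF j'(1)] elim(1)[rule_format, OF j'(2)] elim(3) in auto)
          moreover have "vpot (approximant \<alpha> m) ?\<psi> j = vpot (approximant \<alpha> m) (\<theta>k k) j" by (simp add: vk vpot_add_of_int)
          ultimately show ?thesis using N(1)[OF j] by simp
        qed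
        ultimately show ?case by blast
      qed
      then have "\<exists>m. lower_bound lam c (vpot (approximant \<alpha> m) (\<theta>k k)) {0..} \<and> (\<forall>j\<in>{0..n}. v j = vpot (approximant \<alpha> m) (\<theta>k k) j)"
        by (rule eventually_happens'[rotated]) simp
      then show "\<exists>w. lower_bound lam c w {0..} \<and> (\<forall>j\<in>{0..n}. v j = w j)" by blast
    qed
    then show P using c(1) unfolding P_def by blast
  qed

  show ?thesis unfolding i using ii iii iv v by blast
qed

end
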